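(* Semi-sorted Enum restricted to short RPQs can be solved with preprocessing time $O(|\mathcal D|)$ and delay $O(\Delta(\mathcal D))$.
   Context: $\Sigma$ is a fixed finite alphabet of constant size. A graph database over $\Sigma$ is a pair $\mathcal{D}=(V_{\mathcal D},E_{\mathcal D})$ with a finite node set and arc set $E_{\mathcal D}\subseteq V_{\mathcal D}\times\Sigma\times V_{\mathcal D}$, of size $|\mathcal D|=\max\{|V_{\mathcal D}|,|E_{\mathcal D}|\}$; it is represented by a list of nodes, whose order defines a linear order $\preceq$ on $V_{\mathcal D}$, and per node $u$ and letter $x$ a list of the $x$-successors of $u$. The degree of $u$ is the number of distinct nodes $v$ with $(u,x,v)\in E_{\mathcal D}$ for some $x$, and $\Delta(\mathcal D)$ is the maximum degree. A path from $u$ to $v$ is a sequence $u=w_0,a_1,w_1,\dots,a_k,w_k=v$ ($k\ge0$) with $(w_{i-1},a_i,w_i)\in E_{\mathcal D}$, labelled by $a_1\cdots a_k$. For an RPQ (regular expression) $q$ over $\Sigma$, $q(\mathcal D)$ is the set of node pairs $(u,v)$ such that some path from $u$ to $v$ is labelled by a word in the language of $q$. A short RPQ is one of the form $(x_1\mid\dots\mid x_k)$ or $(x_1\mid\dots\mid x_k)(y_1\mid\dots\mid y_{k'})$ with all $x_i,y_j\in\Sigma$. Model: RAM with logarithmic word size. Enumeration: a preprocessing phase, then an enumeration phase outputting every element of $q(\mathcal D)$ exactly once and signalling termination; delay = maximum time between start and first output, between consecutive outputs, and between last output and termination. Semi-sorted: pairs are ordered according to $\preceq$ on their first component (ties ar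bitrary).
   Formalization: For short RPQs that repeat a letter inside a disjunction, preprocessing is O(|D|+|q|) instead of O(|D|), since such a query can be arbitrarily longer than D and must be read; without repetitions it is O(|D|). Bounds use max(1,|D|) and max(1,Δ(D)). *)

theory Defs
  imports Main
begin

section \<open>Graph databases\<close>

record ('v, 'a) graph_db =
  nodes :: "'v set"
  arcs :: "('v \<times> 'a \<times> 'v) set"

definition graph_db :: "'a set \<Rightarrow> ('v, 'a) graph_db \<Rightarrow> bool" where
  "graph_db S D \<longleftrightarrow> finite (nodes D) \<and> arcs D \<subseteq> nodes D \<times> S \<times> nodes D"

definition db_size :: "('v, 'a) graph_db \<Rightarrow> nat" where
  "db_size D = max (card (nodes D)) (card (arcs D))"

definition degree :: "('v, 'a) graph_db \<Rightarrow> 'v \<Rightarrow> nat" where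
  "degree D u = card {v. \<exists>x. (u, x, v) \<in> arcs D}"

text \<open>The inserted 0 only matters for a database without nodes.\<close>

definition max_degree :: "('v, 'a) graph_db \<Rightarrow> nat" where
  "max_degree D = Max (insert 0 (degree D ` nodes D))"

text \<open>\<open>path D u w v\<close>: some path from \<open>u\<close> to \<open>v\<close> is labelled by \<open>w\<close>.\<close>

inductive path :: "('v, 'a) graph_db \<Rightarrow> 'v \<Rightarrow> 'a list \<Rightarrow> 'v \<Rightarrow> bool" for D where
  path_Nil: "u \<in> nodes D \<Longrightarrow> path D u [] u"
| path_Cons: "(u, x, u') \<in> arcs D \<Longrightarrow> path D u' w v \<Longrightarrow> path D u (x # w) v"


section \<open>Regular path queries\<close>

datatype 'a rexp =
    Empty
  | Eps
  | Letter 'a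
  | Alt "'a rexp" "'a rexp"
  | Conc "'a rexp" "'a rexp"
  | Star "'a rexp"

primrec lang :: "'a rexp \<Rightarrow> 'a list set" where
  "lang Empty = {}"
| "lang Eps = {[]}"
| "lang (Letter x) = {[x]}"
| "lang (Alt r s) = lang r \<union> lang s"
| "lang (Conc r s) = {v @ w | v w. v \<in> lang r \<and> w \<in> lang s}"
| "lang (Star r) = {concat ws | ws. set ws \<subseteq> lang r}"

definition rpq_eval :: "'a rexp \<Rightarrow> ('v, 'a) graph_db \<Rightarrow> ('v \<times> 'v) set" where
  "rpq_eval q D = {(u, v). \<exists>w \<in> lang q. path D u w v}"

fun letter_alt :: "'a list \<Rightarrow> 'a rexp" where
  "letter_alt [] = Empty"
| "letter_alt [x] = Letter x"
| "letter_alt (x # xs) = Alt (Letter x) (letter_alt xs)"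

definition short_rpq :: "'a set \<Rightarrow> 'a rexp \<Rightarrow> bool" where
  "short_rpq S q \<longleftrightarrow>
     (\<exists>xs. xs \<noteq> [] \<and> set xs \<subseteq> S \<and> q = letter_alt xs) \<or>
     (\<exists>xs ys. xs \<noteq> [] \<and> ys \<noteq> [] \<and> set xs \<subseteq> S \<and> set ys \<subseteq> S \<and>
        q = Conc (letter_alt xs) (letter_alt ys))"

primrec letter_occs :: "'a rexp \<Rightarrow> 'a list" where
  "letter_occs Empty = []"
| "letter_occs Eps = []"
| "letter_occs (Letter x) = [x]"
| "letter_occs (Alt r s) = letter_occs r @ letter_occs s"
| "letter_occs (Conc r s) = letter_occs r @ letter_occs s"
| "letter_occs (Star r) = letter_occs r"

text \<open>
  On a short RPQ \<open>factors\<close> recovers \<open>[[x\<^sub>1, \<dots>, x\<^sub>k]]\<close> or \<open>[[x\<^sub>1, \<dots>, x\<^sub>k], [y\<^sub>1, \<dots>, y\<^sub>k\<^sub>']]\<close>.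
\<close>

definition factors :: "'a rexp \<Rightarrow> 'a list list" where
  "factors q = (case q of Conc r s \<Rightarrow> [letter_occs r, letter_occs s] | _ \<Rightarrow> [letter_occs q])"

definition repetition_free :: "'a rexp \<Rightarrow> bool" where
  "repetition_free q \<longleftrightarrow> (\<forall>f \<in> set (factors q). distinct f)"


section \<open>Random access machine\<close>

text \<open>
  A program uses finitely many registers (those it mentions) and a word-addressed memory.
  Every instruction takes one time unit.  The arithmetic below is unbounded; logarithmic word
  size is a requirement on runs, see \<open>words_below\<close>.
\<close>

datatype operand = Imm nat | Reg nat

datatype arith = Add | Sub | Mul | Div

datatype instr =
    Arith arith nat operand operand
  | Load nat operand
  | Store operand operand
  | JumpEq operand operand nat
  | JumpLess operand operand nat
  | Output operand operand
  | Halt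

record state =
  pc :: nat
  regs :: "nat \<Rightarrow> nat"
  mem :: "nat \<Rightarrow> nat"

fun operand_val :: "state \<Rightarrow> operand \<Rightarrow> nat" where
  "operand_val s (Imm n) = n"
| "operand_val s (Reg r) = regs s r"

fun arith_val :: "arith \<Rightarrow> nat \<Rightarrow> nat \<Rightarrow> nat" where
  "arith_val Add x y = x + y"
| "arith_val Sub x y = x - y"
| "arith_val Mul x y = x * y"
| "arith_val Div x y = x div y"

fun instr_step :: "instr \<Rightarrow> state \<Rightarrow> state" where
  "instr_step (Arith f r x y) s =
     s\<lparr>pc := pc s + 1, regs := (regs s)(r := arith_val f (operand_val s x) (operand_val s y))\<rparr>"
| "instr_step (Load r x) s = s\<lparr>pc := pc s + 1, regs := (regs s)(r := mem s (operand_val s x))\<rparr>"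
| "instr_step (Store x y) s =
     s\<lparr>pc := pc s + 1, mem := (mem s)(operand_val s x := operand_val s y)\<rparr>"
| "instr_step (JumpEq x y l) s =
     s\<lparr>pc := (if operand_val s x = operand_val s y then l else pc s + 1)\<rparr>"
| "instr_step (JumpLess x y l) s =
     s\<lparr>pc := (if operand_val s x < operand_val s y then l else pc s + 1)\<rparr>"
| "instr_step (Output x y) s = s\<lparr>pc := pc s + 1\<rparr>"
| "instr_step Halt s = s"

definition halted :: "instr list \<Rightarrow> state \<Rightarrow> bool" where
  "halted P s \<longleftrightarrow> length P \<le> pc s \<or> P ! pc s = Halt"

definition step :: "instr list \<Rightarrow> state \<Rightarrow> state" where
  "step P s = (if halted P s then s else instr_step (P ! pc s) s)"

definition exec :: "instr list \<Rightarrow> state \<Rightarrow> nat \<Rightarrow> state" where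
  "exec P s t = (step P ^^ t) s"

definition halts_at :: "instr list \<Rightarrow> state \<Rightarrow> nat \<Rightarrow> bool" where
  "halts_at P s T \<longleftrightarrow> halted P (exec P s T) \<and> (\<forall>t < T. \<not> halted P (exec P s t))"

definition output_of :: "instr list \<Rightarrow> state \<Rightarrow> (nat \<times> nat) option" where
  "output_of P s =
     (if halted P s then None
      else case P ! pc s of
        Output x y \<Rightarrow> Some (operand_val s x, operand_val s y)
      | _ \<Rightarrow> None)"

definition output_steps :: "instr list \<Rightarrow> state \<Rightarrow> nat \<Rightarrow> nat list" where
  "output_steps P s T = filter (\<lambda>t. output_of P (exec P s t) \<noteq> None) [0..<T]"

definition outputs :: "instr list \<Rightarrow> state \<Rightarrow> nat \<Rightarrow> (nat \<times> nat) list" where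
  "outputs P s T = map (\<lambda>t. the (output_of P (exec P s t))) (output_steps P s T)"

text \<open>
  For a run halting at time \<open>T\<close>: the largest gap between consecutive elements of the sequence
  start, outputs, termination.  The output instruction that starts at time \<open>t\<close> is complete
  at time \<open>t + 1\<close>.
\<close>

definition delay :: "instr list \<Rightarrow> state \<Rightarrow> nat \<Rightarrow> nat" where
  "delay P s T =
     (let ts = map Suc (output_steps P s T)
      in Max (set (map2 (\<lambda>later earlier. later - earlier) (ts @ [T]) (0 # ts))))"

text \<open>
  Throughout the first \<open>T\<close> steps all words stay below \<open>B\<close>.  With \<open>B\<close> polynomial in the
  input length this says that words have logarithmically many bits.
\<close>

definition words_below :: "nat \<Rightarrow> instr list \<Rightarrow> state \<Rightarrow> nat \<Rightarrow> bool" where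
  "words_below B P s T \<longleftrightarrow>
     (\<forall>t \<le> T. (\<forall>r. regs (exec P s t) r < B) \<and> (\<forall>a. mem (exec P s t) a < B))"

definition initial_state :: "nat list \<Rightarrow> state" where
  "initial_state inp =
     \<lparr>pc = 0, regs = (\<lambda>_. 0), mem = (\<lambda>a. if a < length inp then inp ! a else 0)\<rparr>"


section \<open>Representation of the input\<close>

text \<open>
  The alphabet is given as a list \<open>sig\<close> without repetitions, the node set as a list \<open>vs\<close>, whose
  order is the linear order on the nodes.  A node or a letter is represented in the machine by
  its position in this list.
\<close>

definition position :: "'b list \<Rightarrow> 'b \<Rightarrow> nat" where
  "position xs x = length (takeWhile (\<lambda>y. y \<noteq> x) xs)"

definition represents ::
  "'a list \<Rightarrow> 'v list \<Rightarrow> ('v \<Rightarrow> 'a \<Rightarrow> 'v list) \<Rightarrow> ('v, 'a) graph_db \<Rightarrow> bool" where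
  "represents sig vs succs D \<longleftrightarrow>
     distinct vs \<and> set vs = nodes D \<and>
     (\<forall>u \<in> nodes D. \<forall>x \<in> set sig.
        distinct (succs u x) \<and> set (succs u x) = {v. (u, x, v) \<in> arcs D})"

text \<open>
  The successor lists are stored one after the other.  With \<open>s = length sig\<close>, the list of the
  \<open>x\<close>-successors of \<open>u\<close> occupies the positions from entry \<open>i\<close> (inclusive) to entry \<open>i + 1\<close>
  (exclusive) of the offset table, where \<open>i = position vs u * s + position sig x\<close>; offsets are
  relative to the end of the offset table.
\<close>

definition encode_db :: "'a list \<Rightarrow> 'v list \<Rightarrow> ('v \<Rightarrow> 'a \<Rightarrow> 'v list) \<Rightarrow> nat list" where
  "encode_db sig vs succs =
     (let blocks = [map (position vs) (succs u x). u \<leftarrow> vs, x \<leftarrow> sig]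
      in map (\<lambda>i. length (concat (take i blocks))) [0..<length blocks + 1] @ concat blocks)"

definition encode_query :: "'a list \<Rightarrow> 'a rexp \<Rightarrow> nat list" where
  "encode_query sig q =
     length (factors q) # concat (map (\<lambda>f. length f # map (position sig) f) (factors q))"

definition encode_input ::
  "'a list \<Rightarrow> 'v list \<Rightarrow> ('v \<Rightarrow> 'a \<Rightarrow> 'v list) \<Rightarrow> 'a rexp \<Rightarrow> nat list" where
  "encode_input sig vs succs q = length vs # encode_query sig q @ encode_db sig vs succs"


section \<open>Semi-sorted enumeration\<close>

definition semi_sorted_enumeration :: "'v list \<Rightarrow> ('v \<times> 'v) set \<Rightarrow> (nat \<times> nat) list \<Rightarrow> bool" where
  "semi_sorted_enumeration vs R out \<longleftrightarrow>
     (\<exists>res. distinct res \<and> set res = R \<and>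
        sorted_wrt (\<lambda>p p'. position vs (fst p) \<le> position vs (fst p')) res \<and>
        out = map (\<lambda>(u, v). (position vs u, position vs v)) res)"

text \<open>
  \<open>pre\<close> is the program of the preprocessing phase, \<open>enum\<close> that of the enumeration phase, which
  starts in the configuration reached by \<open>pre\<close>.  All words stay below \<open>B\<close>.
\<close>

definition solves_semi_sorted_enum ::
  "instr list \<Rightarrow> instr list \<Rightarrow> nat list \<Rightarrow> nat \<Rightarrow> 'v list \<Rightarrow> ('v \<times> 'v) set \<Rightarrow> nat \<Rightarrow> nat \<Rightarrow> bool" where
  "solves_semi_sorted_enum pre enum inp B vs R pre_time max_delay \<longleftrightarrow>
     (\<exists>T T' s s'.
        s = initial_state inp \<and> halts_at pre s T \<and>
        words_below B pre s T \<and> outputs pre s T = [] \<and> T \<le> pre_time \<and>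
        s' = (exec pre s T)\<lparr>pc := 0\<rparr> \<and> halts_at enum s' T' \<and>
        words_below B enum s' T' \<and> semi_sorted_enumeration vs R (outputs enum s' T') \<and>
        delay enum s' T' \<le> max_delay)"

end

theory Submission
  imports Defs
begin

text \<open>
  For an alphabet of fixed size, linear preprocessing stores, for every node \<open>u\<close>, the duplicate-free
  list \<open>A u\<close> of its successors under the first factor, and for every node \<open>z\<close> the duplicate-free list
  \<open>Y z\<close> of its successors under the second factor (\<open>Y z = [z]\<close> if there is no second factor).
  The answers with first component \<open>u\<close> are \<open>(u, v)\<close> with \<open>v\<close> in some \<open>Y z\<close>, \<open>z\<close> in \<open>A u\<close>.
  Preprocessing also records, in order, the nodes \<open>u\<close> that have an answer, together with a
  \<open>z*\<close> in \<open>A u\<close> whose list \<open>Y z*\<close> has maximal length.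

  To enumerate the answers of \<open>u\<close>, first mark all of \<open>Y z*\<close>, then proceed by columns: column \<open>j\<close>
  outputs the \<open>j\<close>-th entry of \<open>Y z*\<close> and afterwards the unmarked ones among the \<open>j\<close>-th entries of the
  other lists \<open>Y z\<close>, marking them.  As \<open>Y z*\<close> is reserved for its own columns, each column starts
  with an output; it takes time proportional to the length of \<open>A u\<close>, so the delay is linear in the
  maximum degree.
\<close>

section \<open>Structured programs and their compilation\<close>

text \<open>For one \<open>u\<close> there may be quadratically many pairs of a \<open>z\<close> and
  a position in \<open>Y z\<close>, measured in the degree, but only linearly many distinct targets.
  Working through the lists one after the other could therefore skip duplicates for quadratically
  many steps. A column meets each list only once, and taking the longest list as \<open>z*\<close>
  ensures that no column lies beyond its end. The reservation is needed because an entry of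
  \<open>Y z*\<close> may also occur in an earlier column of another list; if it were output there,
  its own column could stay silent. Reserving is paid once per node, before its first output, and is
  linear in the degree. Passing over nodes without answers would cause unbounded silence, hence the
  list of nodes that have one. Outputs, time and delay are components of the state of a structured
  language, so one invariant per loop proves correctness and delay together. Word size is derived
  afterwards, from the running time and a syntactic condition on the code.\<close>

text \<open>
  Programs work on ten unbounded arrays besides the read-only input \<open>inp\<close> of length \<open>w\<close>.  Cell \<open>i\<close> of
  array \<open>j\<close> is stored at address \<open>w + 10 * i + j\<close>; source register 0 has to contain \<open>w\<close> whenever an
  array is accessed.  Source register \<open>r\<close> becomes machine register \<open>r + 3\<close>, the machine registers
  0 to 2 serve address computations.
\<close>

datatype cond = CEq operand operand | CLess operand operand

datatype basic =
    BArith arith nat operand operand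
  | BInput nat operand
  | BLoad nat nat operand
  | BStore nat operand operand
  | BOut operand operand

datatype com =
    Basic basic
  | Seq com com (infixr \<open>;;\<close> 60)
  | When cond com
  | While cond com

text \<open>
  The last three components are ghost state: the outputs so far, the number of steps since the last
  output (or the start), and the largest such number at an output.
\<close>

record sstate =
  rg :: "nat \<Rightarrow> nat"
  ar :: "nat \<Rightarrow> nat \<Rightarrow> nat"
  emitted :: "(nat \<times> nat) list"
  gap :: nat
  worst :: nat

fun oval :: "sstate \<Rightarrow> operand \<Rightarrow> nat" where
  "oval s (Imm n) = n"
| "oval s (Reg r) = rg s r"

fun cval :: "sstate \<Rightarrow> cond \<Rightarrow> bool" where
  "cval s (CEq x y) \<longleftrightarrow> oval s x = oval s y"
| "cval s (CLess x y) \<longleftrightarrow> oval s x < oval s y"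

definition tick :: "nat \<Rightarrow> sstate \<Rightarrow> sstate" where
  "tick k s = s\<lparr>gap := gap s + k\<rparr>"

text \<open>These are the conditions under which a compiled access hits the intended cell: from
  address \<open>w\<close> on the memory holds the arrays, and \<open>address_code\<close> takes its
  base from source register 0.\<close>

fun guard :: "nat \<Rightarrow> basic \<Rightarrow> sstate \<Rightarrow> bool" where
  "guard w (BInput r x) s \<longleftrightarrow> oval s x < w"
| "guard w (BLoad r j x) s \<longleftrightarrow> rg s 0 = w \<and> j < 10"
| "guard w (BStore j x y) s \<longleftrightarrow> rg s 0 = w \<and> j < 10"
| "guard w _ s \<longleftrightarrow> True"

text \<open>Each tick is a number of compiled instructions; three of the four for an array access
  compute the address. An output counts itself in \<open>worst\<close> before \<open>gap\<close>
  restarts at 0, in accordance with \<open>delay\<close>, where an output is complete one step after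
  it starts.\<close>

fun effect :: "(nat \<Rightarrow> nat) \<Rightarrow> basic \<Rightarrow> sstate \<Rightarrow> sstate" where
  "effect inp (BArith f r x y) s =
     tick 1 (s\<lparr>rg := (rg s)(r := arith_val f (oval s x) (oval s y))\<rparr>)"
| "effect inp (BInput r x) s = tick 1 (s\<lparr>rg := (rg s)(r := inp (oval s x))\<rparr>)"
| "effect inp (BLoad r j x) s = tick 4 (s\<lparr>rg := (rg s)(r := ar s j (oval s x))\<rparr>)"
| "effect inp (BStore j x y) s =
     tick 4 (s\<lparr>ar := (ar s)(j := (ar s j)(oval s x := oval s y))\<rparr>)"
| "effect inp (BOut x y) s =
     s\<lparr>emitted := emitted s @ [(oval s x, oval s y)], gap := 0, worst := max (worst s) (gap s + 1)\<rparr>"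

text \<open>The ticks count executed jumps: entering a body takes one, a failed test costs itself
  and a \<open>goto\<close>, and every iteration adds the jump back.\<close>

inductive big :: "(nat \<Rightarrow> nat) \<Rightarrow> nat \<Rightarrow> com \<Rightarrow> sstate \<Rightarrow> sstate \<Rightarrow> bool" for inp w where
  big_Basic: "guard w b s \<Longrightarrow> big inp w (Basic b) s (effect inp b s)"
| big_Seq: "big inp w c s s' \<Longrightarrow> big inp w d s' s'' \<Longrightarrow> big inp w (c ;; d) s s''"
| big_When_True: "cval s b \<Longrightarrow> big inp w c (tick 1 s) s' \<Longrightarrow> big inp w (When b c) s s'"
| big_When_False: "\<not> cval s b \<Longrightarrow> big inp w (When b c) s (tick 2 s)"
| big_While_True: "cval s b \<Longrightarrow> big inp w c (tick 1 s) s' \<Longrightarrow>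
     big inp w (While b c) (tick 1 s') s'' \<Longrightarrow> big inp w (While b c) s s''"
| big_While_False: "\<not> cval s b \<Longrightarrow> big inp w (While b c) s (tick 2 s)"

fun lift_operand :: "operand \<Rightarrow> operand" where
  "lift_operand (Imm n) = Imm n"
| "lift_operand (Reg r) = Reg (r + 3)"

definition address_code :: "nat \<Rightarrow> operand \<Rightarrow> instr list" where
  "address_code j x =
     [Arith Mul 0 (lift_operand x) (Imm 10), Arith Add 1 (Reg 0) (Imm j),
      Arith Add 2 (Reg 1) (Reg 3)]"

fun basic_code :: "basic \<Rightarrow> instr list" where
  "basic_code (BArith f r x y) = [Arith f (r + 3) (lift_operand x) (lift_operand y)]"
| "basic_code (BInput r x) = [Load (r + 3) (lift_operand x)]"
| "basic_code (BLoad r j x) = address_code j x @ [Load (r + 3) (Reg 2)]"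
| "basic_code (BStore j x y) = address_code j x @ [Store (Reg 2) (lift_operand y)]"
| "basic_code (BOut x y) = [Output (lift_operand x) (lift_operand y)]"

fun cond_jump :: "cond \<Rightarrow> nat \<Rightarrow> instr" where
  "cond_jump (CEq x y) l = JumpEq (lift_operand x) (lift_operand y) l"
| "cond_jump (CLess x y) l = JumpLess (lift_operand x) (lift_operand y) l"

definition goto :: "nat \<Rightarrow> instr" where
  "goto l = JumpEq (Imm 0) (Imm 0) l"

fun csize :: "com \<Rightarrow> nat" where
  "csize (Basic b) = length (basic_code b)"
| "csize (c ;; d) = csize c + csize d"
| "csize (When b c) = csize c + 2"
| "csize (While b c) = csize c + 3"

text \<open>Jump targets are absolute, so the start address \<open>a\<close> is carried along;
  \<open>csize\<close> supplies the forward targets.\<close>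

fun compile :: "nat \<Rightarrow> com \<Rightarrow> instr list" where
  "compile a (Basic b) = basic_code b"
| "compile a (c ;; d) = compile a c @ compile (a + csize c) d"
| "compile a (When b c) = cond_jump b (a + 2) # goto (a + 2 + csize c) # compile (a + 2) c"
| "compile a (While b c) =
     cond_jump b (a + 2) # goto (a + 3 + csize c) # compile (a + 2) c @ [goto a]"

lemma length_compile [simp]: "length (compile a c) = csize c"
  by (induction c arbitrary: a) auto

section \<open>Machine runs and the simulation of structured programs\<close>

definition run :: "instr list \<Rightarrow> state \<Rightarrow> (nat \<times> nat) option list \<Rightarrow> state \<Rightarrow> bool" where
  "run P \<sigma> tr \<sigma>' \<longleftrightarrow> \<sigma>' = exec P \<sigma> (length tr) \<and>
     (\<forall>t < length tr. \<not> halted P (exec P \<sigma> t) \<and> output_of P (exec P \<sigma> t) = tr ! t)"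

lemma exec_0 [simp]: "exec P \<sigma> 0 = \<sigma>"
  by (simp add: exec_def)

lemma exec_add: "exec P \<sigma> (t + t') = exec P (exec P \<sigma> t) t'"
  by (simp add: exec_def funpow_add add.commute[of t])

lemma exec_Suc: "exec P \<sigma> (Suc t) = step P (exec P \<sigma> t)"
  by (simp add: exec_def)

lemma run_append:
  assumes "run P \<sigma> tr \<sigma>'" "run P \<sigma>' tr' \<sigma>''"
  shows "run P \<sigma> (tr @ tr') \<sigma>''"
proof -
  have "\<not> halted P (exec P \<sigma> t) \<and> output_of P (exec P \<sigma> t) = (tr @ tr') ! t"
    if "t < length (tr @ tr')" for t
  proof (cases "t < length tr")
    case True
    then show ?thesis using assms(1) by (simp add: run_def nth_append)
  next
    case False
    then obtain u where u: "t = length tr + u" using le_Suc_ex not_less by blast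
    then show ?thesis using assms that by (simp add: run_def exec_add)
  qed
  then show ?thesis using assms by (simp add: run_def exec_add)
qed

lemma run_step:
  assumes "\<not> halted P \<sigma>"
  shows "run P \<sigma> [output_of P \<sigma>] (step P \<sigma>)"
  using assms exec_Suc[of P \<sigma> 0] by (simp add: run_def)

definition code_at :: "instr list \<Rightarrow> nat \<Rightarrow> instr list \<Rightarrow> bool" where
  "code_at P a is \<longleftrightarrow> (\<exists>xs ys. P = xs @ is @ ys \<and> length xs = a)"

lemma code_at_Cons:
  "code_at P a (i # is) \<longleftrightarrow> a < length P \<and> P ! a = i \<and> code_at P (Suc a) is"
proof
  assume "code_at P a (i # is)"
  then obtain xs ys where "P = xs @ (i # is) @ ys" "length xs = a" by (auto simp: code_at_def)
  moreover have "a < length P \<and> P ! a = i" using calculation by auto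
  moreover have "P = (xs @ [i]) @ is @ ys" "length (xs @ [i]) = Suc a"
    using calculation by auto
  ultimately show "a < length P \<and> P ! a = i \<and> code_at P (Suc a) is"
    unfolding code_at_def by (intro conjI exI[of _ "xs @ [i]"] exI[of _ ys]) auto
next
  assume *: "a < length P \<and> P ! a = i \<and> code_at P (Suc a) is"
  then obtain xs ys where P: "P = xs @ is @ ys" "length xs = Suc a" by (auto simp: code_at_def)
  then have "xs ! a = i" using * by (simp add: nth_append)
  then have "xs = take a xs @ [i]"
    using take_Suc_conv_app_nth[of a xs] P(2) by simp
  then obtain xs' where "xs = xs' @ [i]" by blast
  then show "code_at P a (i # is)" using P(2)
    P(1) unfolding code_at_def by (intro exI[of _ xs'] exI[of _ ys]) simp
qed

lemma code_at_append:
  "code_at P a (is @ js) \<longleftrightarrow> code_at P a is \<and> code_at P (a + length is) js"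
proof (induction "is" arbitrary: a)
  case Nil
  show ?case by (auto simp: code_at_def)
next
  case (Cons i "is")
  then show ?case by (simp add: code_at_Cons)
qed

text \<open>Recomputes the ghost components from a machine trace with one entry per step;
  \<open>compile_correct\<close> uses it to tie them to what the machine really does.\<close>

fun gstep :: "(nat \<times> nat) option \<Rightarrow> (nat \<times> nat) list \<times> nat \<times> nat \<Rightarrow> (nat \<times> nat) list \<times> nat \<times> nat"
where
  "gstep None (es, g, m) = (es, g + 1, m)"
| "gstep (Some e) (es, g, m) = (es @ [e], 0, max m (g + 1))"

definition ghost :: "sstate \<Rightarrow> (nat \<times> nat) list \<times> nat \<times> nat" where
  "ghost s = (emitted s, gap s, worst s)"

text \<open>Interleaving the arrays by residues modulo 10 gives each of them unbounded space without
  knowing any size in advance.\<close>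

definition layout :: "(nat \<Rightarrow> nat) \<Rightarrow> nat \<Rightarrow> (nat \<Rightarrow> nat \<Rightarrow> nat) \<Rightarrow> nat \<Rightarrow> nat" where
  "layout inp w m a = (if a < w then inp a else m ((a - w) mod 10) ((a - w) div 10))"

lemma layout_array: "j < 10 \<Longrightarrow> layout inp w m (i * 10 + j + w) = m j i"
  by (simp add: layout_def)

lemma layout_update:
  assumes "j < 10"
  shows "(layout inp w m)(i * 10 + j + w := v) = layout inp w (m(j := (m j)(i := v)))"
proof
  fix a
  have "a - w \<noteq> i * 10 + j" if "a \<noteq> i * 10 + j + w" "a \<ge> w" using that by auto
  moreover have "b = b div 10 * 10 + b mod 10" for b :: nat by simp
  ultimately have "(a - w) mod 10 \<noteq> j \<or> (a - w) div 10 \<noteq> i"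
    if "a \<noteq> i * 10 + j + w" "a \<ge> w" using that by metis
  then show "((layout inp w m)(i * 10 + j + w := v)) a = layout inp w (m(j := (m j)(i := v))) a"
    using assms by (auto simp: layout_def)
qed

text \<open>The program counter and machine registers 0 to 2 are left open, so jumps and address
  computations preserve the relation.\<close>

definition sim :: "(nat \<Rightarrow> nat) \<Rightarrow> nat \<Rightarrow> sstate \<Rightarrow> state \<Rightarrow> bool" where
  "sim inp w s \<sigma> \<longleftrightarrow> (\<forall>r. regs \<sigma> (r + 3) = rg s r) \<and> mem \<sigma> = layout inp w (ar s)"

lemma sim_operand: "sim inp w s \<sigma> \<Longrightarrow> operand_val \<sigma> (lift_operand x) = oval s x"
  by (cases x) (auto simp: sim_def)

lemma sim_tick [simp]: "sim inp w (tick k s) \<sigma> = sim inp w s \<sigma>"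
  by (simp add: sim_def tick_def)

lemma sim_pc [simp]: "sim inp w s (\<sigma>\<lparr>pc := p\<rparr>) = sim inp w s \<sigma>"
  by (simp add: sim_def)

lemma cval_tick [simp]: "cval (tick k s) b = cval s b"
  by (cases b; cases "(case b of CEq x y \<Rightarrow> x | CLess x y \<Rightarrow> x)";
      cases "(case b of CEq x y \<Rightarrow> y | CLess x y \<Rightarrow> y)") (auto simp: tick_def)

lemma ghost_tick: "ghost (tick (Suc k) s) = gstep None (ghost (tick k s))"
  by (simp add: ghost_def tick_def)

definition silent :: "instr \<Rightarrow> bool" where
  "silent i \<longleftrightarrow> i \<noteq> Halt \<and> (\<forall>x y. i \<noteq> Output x y)"

lemma run_silent:
  assumes "P ! pc \<sigma> = i" "pc \<sigma> < length P" "silent i"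
  shows "run P \<sigma> [None] (instr_step i \<sigma>)"
  using run_step[of P \<sigma>] assms
  by (cases i) (auto simp: silent_def halted_def step_def output_of_def)

lemma run_cond_jump:
  assumes "P ! pc \<sigma> = cond_jump b l" "pc \<sigma> < length P" "sim inp w s \<sigma>"
  shows "run P \<sigma> [None] (\<sigma>\<lparr>pc := if cval s b then l else Suc (pc \<sigma>)\<rparr>)"
  using run_silent[OF assms(1,2)] assms(3)
  by (cases b) (auto simp: silent_def sim_operand)

lemma run_goto:
  assumes "P ! pc \<sigma> = goto l" "pc \<sigma> < length P"
  shows "run P \<sigma> [None] (\<sigma>\<lparr>pc := l\<rparr>)"
  using run_silent[OF assms] by (simp add: silent_def goto_def)

lemma run_address:
  assumes "code_at P a (address_code j x)" "pc \<sigma> = a" "sim inp w s \<sigma>" "rg s 0 = w"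
  shows "\<exists>\<sigma>'. run P \<sigma> [None, None, None] \<sigma>' \<and> sim inp w s \<sigma>' \<and> pc \<sigma>' = a + 3 \<and>
    regs \<sigma>' 2 = oval s x * 10 + j + w"
proof -
  let ?i1 = "Arith Mul 0 (lift_operand x) (Imm 10)"
  let ?i2 = "Arith Add 1 (Reg 0) (Imm j)"
  let ?i3 = "Arith Add 2 (Reg 1) (Reg 3)"
  let ?\<sigma>1 = "instr_step ?i1 \<sigma>"
  let ?\<sigma>2 = "instr_step ?i2 ?\<sigma>1"
  let ?\<sigma>3 = "instr_step ?i3 ?\<sigma>2"
  have c: "a < length P" "P ! a = ?i1" "Suc a < length P" "P ! Suc a = ?i2"
    "Suc (Suc a) < length P" "P ! Suc (Suc a) = ?i3"
    using assms(1) by (auto simp: address_code_def code_at_Cons)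
  have r: "run P \<sigma> [None] ?\<sigma>1" "run P ?\<sigma>1 [None] ?\<sigma>2" "run P ?\<sigma>2 [None] ?\<sigma>3"
    by (rule run_silent; use c assms(2) in \<open>simp add: silent_def\<close>)+
  from run_append[OF run_append[OF r(1,2)] r(3)]
  have "run P \<sigma> [None, None, None] ?\<sigma>3" by simp
  moreover have "sim inp w s ?\<sigma>3" using assms(3) by (simp add: sim_def)
  moreover have "regs \<sigma> 3 = w" using assms(3,4)
    by (metis add_0 sim_def)
  then have "regs ?\<sigma>3 2 = oval s x * 10 + j + w"
    using assms(3) by (simp add: sim_operand)
  ultimately show ?thesis using assms(2) by auto
qed

lemma compile_basic_correct:
  assumes "guard w b s" "sim inp w s \<sigma>" "pc \<sigma> = a" "code_at P a (basic_code b)"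
  shows "\<exists>tr \<sigma>'. run P \<sigma> tr \<sigma>' \<and> sim inp w (effect inp b s) \<sigma>' \<and>
    pc \<sigma>' = a + length (basic_code b) \<and> ghost (effect inp b s) = fold gstep tr (ghost s)"
proof (cases b)
  case (BArith f r x y)
  have "run P \<sigma> [None] (instr_step (Arith f (r + 3) (lift_operand x) (lift_operand y)) \<sigma>)"
    using assms BArith by (intro run_silent) (auto simp: code_at_Cons silent_def)
  then show ?thesis using assms(2,3) BArith
    by - (intro exI conjI, assumption, auto simp: sim_operand ghost_def tick_def, auto simp: sim_def)
next
  case (BInput r x)
  have "run P \<sigma> [None] (instr_step (Load (r + 3) (lift_operand x)) \<sigma>)"
    using assms BInput by (intro run_silent) (auto simp: code_at_Cons silent_def)
  then show ?thesis using assms(1-3) BInput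
    by - (intro exI conjI, assumption, auto simp: sim_operand ghost_def tick_def, auto simp: sim_def layout_def)
next
  case (BLoad r j x)
  obtain \<sigma>' where \<sigma>': "run P \<sigma> [None, None, None] \<sigma>'" "sim inp w s \<sigma>'" "pc \<sigma>' = a + 3"
    "regs \<sigma>' 2 = oval s x * 10 + j + w"
    using run_address[of P a j x \<sigma> inp w s] assms BLoad by (auto simp: code_at_append)
  have "run P \<sigma>' [None] (instr_step (Load (r + 3) (Reg 2)) \<sigma>')"
    using assms BLoad \<sigma>'
    by (intro run_silent) (auto simp: code_at_append code_at_Cons address_code_def silent_def numeral_3_eq_3)
  from run_append[OF \<sigma>'(1) this] show ?thesis using assms(1-3) BLoad \<sigma>'
    by - (intro exI conjI, assumption, auto simp: ghost_def tick_def address_code_def, auto simp: sim_def layout_array)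
next
  case (BStore j x y)
  obtain \<sigma>' where \<sigma>': "run P \<sigma> [None, None, None] \<sigma>'" "sim inp w s \<sigma>'" "pc \<sigma>' = a + 3"
    "regs \<sigma>' 2 = oval s x * 10 + j + w"
    using run_address[of P a j x \<sigma> inp w s] assms BStore by (auto simp: code_at_append)
  have "run P \<sigma>' [None] (instr_step (Store (Reg 2) (lift_operand y)) \<sigma>')"
    using assms BStore \<sigma>'
    by (intro run_silent) (auto simp: code_at_append code_at_Cons address_code_def silent_def numeral_3_eq_3)
  from run_append[OF \<sigma>'(1) this] show ?thesis using assms(1-3) BStore \<sigma>'
    by - (intro exI conjI, assumption, auto simp: sim_operand ghost_def tick_def address_code_def, auto simp: sim_def layout_update)
next
  case (BOut x y)
  have c: "pc \<sigma> < length P" "P ! pc \<sigma> = Output (lift_operand x) (lift_operand y)"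
    using assms BOut by (auto simp: code_at_Cons)
  then have "run P \<sigma> [Some (oval s x, oval s y)] (\<sigma>\<lparr>pc := pc \<sigma> + 1\<rparr>)"
    using run_step[of P \<sigma>] assms(2)
    by (auto simp: halted_def step_def output_of_def sim_operand)
  then show ?thesis using assms(2,3) BOut
    by - (intro exI conjI, assumption, auto simp: ghost_def, auto simp: sim_def)
qed

text \<open>Induction on the big-step derivation, general in machine state and address because
  subcommands start inside the program. Traces of the parts are concatenated, with one
  \<open>None\<close> per jump, which settles outputs and time at once.\<close>

theorem compile_correct:
  assumes "big inp w c s s'"
  shows "sim inp w s \<sigma> \<Longrightarrow> pc \<sigma> = a \<Longrightarrow> code_at P a (compile a c) \<Longrightarrow>
    \<exists>tr \<sigma>'. run P \<sigma> tr \<sigma>' \<and> sim inp w s' \<sigma>' \<and> pc \<sigma>' = a + csize c \<and>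
      ghost s' = fold gstep tr (ghost s)"
  using assms
proof (induction arbitrary: \<sigma> a)
  case (big_Basic b s)
  then show ?case using compile_basic_correct by simp
next
  case (big_Seq c s s' d s'')
  then have "code_at P a (compile a c)" "code_at P (a + csize c) (compile (a + csize c) d)"
    by (auto simp: code_at_append)
  from big_Seq(3)[OF big_Seq(5,6) this(1)] obtain tr \<sigma>' where
    1: "run P \<sigma> tr \<sigma>'" "sim inp w s' \<sigma>'" "pc \<sigma>' = a + csize c" "ghost s' = fold gstep tr (ghost s)"
    by blast
  from big_Seq(4)[OF 1(2,3)] \<open>code_at P (a + csize c) _\<close> obtain tr' \<sigma>'' where
    2: "run P \<sigma>' tr' \<sigma>''" "sim inp w s'' \<sigma>''" "pc \<sigma>'' = a + csize c + csize d"
      "ghost s'' = fold gstep tr' (ghost s')"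
    by blast
  show ?case using run_append[OF 1(1) 2(1)] 1 2 by (auto intro!: exI[of _ "tr @ tr'"])
next
  case (big_When_True s b c s')
  let ?\<sigma> = "\<sigma>\<lparr>pc := a + 2\<rparr>"
  have 0: "run P \<sigma> [None] ?\<sigma>"
    using run_cond_jump[of P \<sigma> b "a + 2" inp w s] big_When_True by (auto simp: code_at_Cons)
  from big_When_True(3)[of ?\<sigma> "a + 2"] big_When_True(4-6) obtain tr \<sigma>' where
    1: "run P ?\<sigma> tr \<sigma>'" "sim inp w s' \<sigma>'" "pc \<sigma>' = a + 2 + csize c"
      "ghost s' = fold gstep tr (ghost (tick 1 s))"
    by (auto simp: code_at_Cons)
  show ?case using run_append[OF 0 1(1)] 1 ghost_tick[of 0 s]
    by (intro exI[of _ "None # tr"] exI[of _ \<sigma>']) (simp add: tick_def)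
next
  case (big_When_False s b c)
  let ?\<sigma> = "\<sigma>\<lparr>pc := Suc a\<rparr>"
  let ?\<tau> = "\<sigma>\<lparr>pc := a + 2 + csize c\<rparr>"
  have 0: "run P \<sigma> [None] ?\<sigma>"
    using run_cond_jump[of P \<sigma> b "a + 2" inp w s] big_When_False by (auto simp: code_at_Cons)
  have 1: "run P ?\<sigma> [None] ?\<tau>"
    using run_goto[of P ?\<sigma>] big_When_False by (auto simp: code_at_Cons)
  show ?case using run_append[OF 0 1] big_When_False
    by (intro exI[of _ "[None, None]"] exI[of _ ?\<tau>]) (auto simp: ghost_def tick_def sim_def)
next
  case (big_While_True s b c s' s'')
  let ?\<sigma> = "\<sigma>\<lparr>pc := a + 2\<rparr>"
  have 0: "run P \<sigma> [None] ?\<sigma>"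
    using run_cond_jump[of P \<sigma> b "a + 2" inp w s] big_While_True by (auto simp: code_at_Cons)
  from big_While_True(4)[of ?\<sigma> "a + 2"] big_While_True(6-8) obtain tr \<sigma>' where
    1: "run P ?\<sigma> tr \<sigma>'" "sim inp w s' \<sigma>'" "pc \<sigma>' = a + 2 + csize c"
      "ghost s' = fold gstep tr (ghost (tick 1 s))"
    by (auto simp: code_at_Cons code_at_append)
  let ?\<sigma>' = "\<sigma>'\<lparr>pc := a\<rparr>"
  have 2: "run P \<sigma>' [None] ?\<sigma>'"
    using run_goto[of P \<sigma>' a] 1(3) big_While_True by (auto simp: code_at_Cons code_at_append)
  from big_While_True(5)[of ?\<sigma>' a] big_While_True(7,8) 1 obtain tr' \<sigma>'' where
    3: "run P ?\<sigma>' tr' \<sigma>''" "sim inp w s'' \<sigma>''" "pc \<sigma>'' = a + csize (While b c)"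
      "ghost s'' = fold gstep tr' (ghost (tick 1 s'))"
    by auto
  show ?case using run_append[OF run_append[OF run_append[OF 0 1(1)] 2] 3(1)] 1 3
      ghost_tick[of 0 s] ghost_tick[of 0 s']
    by (intro exI[of _ "None # tr @ None # tr'"] exI[of _ \<sigma>'']) (simp add: tick_def)
next
  case (big_While_False s b c)
  let ?\<sigma> = "\<sigma>\<lparr>pc := Suc a\<rparr>"
  let ?\<tau> = "\<sigma>\<lparr>pc := a + 3 + csize c\<rparr>"
  have 0: "run P \<sigma> [None] ?\<sigma>"
    using run_cond_jump[of P \<sigma> b "a + 2" inp w s] big_While_False by (auto simp: code_at_Cons)
  have 1: "run P ?\<sigma> [None] ?\<tau>"
    using run_goto[of P ?\<sigma>] big_While_False by (auto simp: code_at_Cons)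
  show ?case using run_append[OF 0 1] big_While_False
    by (intro exI[of _ "[None, None]"] exI[of _ ?\<tau>]) (auto simp: ghost_def tick_def sim_def)
qed


section \<open>Traces and word size\<close>

definition trace_steps :: "'e option list \<Rightarrow> nat list" where
  "trace_steps tr = filter (\<lambda>t. tr ! t \<noteq> None) [0..<length tr]"

lemma trace_steps_snoc:
  "trace_steps (tr @ [x]) = trace_steps tr @ (if x = None then [] else [length tr])"
proof -
  have "filter (\<lambda>t. (tr @ [x]) ! t \<noteq> None) [0..<length tr] = trace_steps tr"
    unfolding trace_steps_def by (intro filter_cong) (auto simp: nth_append)
  then show ?thesis by (simp add: trace_steps_def[of "tr @ [x]"])
qed

text \<open>\<open>map2\<close> stops at the shorter list, so the surplus \<open>ys\<close> is
  ignored: it is empty for \<open>delay\<close>, and a singleton when the extended list of times is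
  paired with its own shift.\<close>

lemma map2_gaps_snoc:
  "map2 f (ts @ [x]) (a # ts @ ys) = map2 f ts (a # ts) @ [f x (last (a # ts))]"
  by (induction ts arbitrary: a) auto

text \<open>Reverse induction, because \<open>gstep\<close> acts at the end of the trace. The bound
  on the last output time is carried along since subtraction on \<open>nat\<close> truncates; the
  inserted 0 is the value of \<open>worst\<close> before any output.\<close>

lemma fold_gstep_trace:
  fixes tr :: "(nat \<times> nat) option list"
  defines "ts \<equiv> map Suc (trace_steps tr)"
  shows "fold gstep tr ([], 0, 0) =
    (map (\<lambda>t. the (tr ! t)) (trace_steps tr), length tr - last (0 # ts),
     Max (insert 0 (set (map2 (-) ts (0 # ts))))) \<and> last (0 # ts) \<le> length tr"
  unfolding ts_def
proof (induction tr rule: rev_induct)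
  case Nil
  show ?case by (simp add: trace_steps_def)
next
  case (snoc x tr)
  let ?ts = "map Suc (trace_steps tr)"
  have out: "map (\<lambda>t. the ((tr @ [x]) ! t)) (trace_steps tr) = map (\<lambda>t. the (tr ! t)) (trace_steps tr)"
    by (auto simp: trace_steps_def nth_append)
  show ?case
  proof (cases x)
    case None
    then show ?thesis using snoc out by (auto simp: trace_steps_snoc Suc_diff_le simp del: nth_append)
  next
    case (Some e)
    let ?ts' = "map Suc (trace_steps (tr @ [x]))"
    define g where "g = length tr - last (0 # ?ts)"
    define m where "m = Max (insert 0 (set (map2 (-) ?ts (0 # ?ts))))"
    have ts': "?ts' = ?ts @ [Suc (length tr)]" using Some by (simp add: trace_steps_snoc)
    have IH: "fold gstep tr ([], 0, 0) = (map (\<lambda>t. the (tr ! t)) (trace_steps tr), g, m)"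
      "last (0 # ?ts) \<le> length tr"
      using snoc by (simp_all only: g_def m_def)
    have "map2 (-) ?ts' (0 # ?ts') = map2 (-) ?ts (0 # ?ts) @ [Suc (length tr) - last (0 # ?ts)]"
      unfolding ts' using map2_gaps_snoc[of "(-)" ?ts "Suc (length tr)" 0 "[Suc (length tr)]"] by simp
    also have "Suc (length tr) - last (0 # ?ts) = g + 1"
      using IH(2) unfolding g_def by (simp only: Suc_diff_le Suc_eq_plus1)
    finally have "insert 0 (set (map2 (-) ?ts' (0 # ?ts'))) =
        insert (g + 1) (insert 0 (set (map2 (-) ?ts (0 # ?ts))))"
      by (simp only: set_append list.set insert_commute Un_insert_right Un_empty_right)
    then have "Max (insert 0 (set (map2 (-) ?ts' (0 # ?ts')))) = max (g + 1) m"
      unfolding m_def by (simp only:, intro Max_insert) auto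
    moreover have "map (\<lambda>t. the ((tr @ [x]) ! t)) (trace_steps (tr @ [x])) =
        map (\<lambda>t. the (tr ! t)) (trace_steps tr) @ [e]"
      using out Some by (simp add: trace_steps_snoc)
    moreover have "fold gstep (tr @ [x]) ([], 0, 0) =
        (map (\<lambda>t. the (tr ! t)) (trace_steps tr) @ [e], 0, max m (g + 1))"
      using IH(1) Some by simp
    moreover have "last (0 # ?ts') = length (tr @ [x])" unfolding ts' by simp
    ultimately show ?thesis by (simp only: max.commute) simp
  qed
qed

lemma run_observations:
  assumes "run P \<sigma> tr \<sigma>'" "halted P \<sigma>'" "fold gstep tr ([], 0, 0) = (es, g, m)"
  shows "halts_at P \<sigma> (length tr)" "outputs P \<sigma> (length tr) = es"
    "delay P \<sigma> (length tr) = max m g" "exec P \<sigma> (length tr) = \<sigma>'"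
proof -
  show "halts_at P \<sigma> (length tr)" "exec P \<sigma> (length tr) = \<sigma>'"
    using assms(1,2) by (auto simp: run_def halts_at_def)
  have steps: "output_steps P \<sigma> (length tr) = trace_steps tr"
    unfolding output_steps_def trace_steps_def
    using assms(1) by (intro filter_cong) (auto simp: run_def)
  let ?ts = "map Suc (trace_steps tr)"
  have f: "es = map (\<lambda>t. the (tr ! t)) (trace_steps tr)" "g = length tr - last (0 # ?ts)"
    "m = Max (insert 0 (set (map2 (-) ?ts (0 # ?ts))))"
    using fold_gstep_trace[of tr] assms(3) by auto
  show "outputs P \<sigma> (length tr) = es"
    using assms(1) by (auto simp: outputs_def steps f(1) trace_steps_def run_def)
  have "delay P \<sigma> (length tr) = Max (set (map2 (-) (?ts @ [length tr]) (0 # ?ts)))"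
    by (simp add: delay_def steps Let_def)
  also have "map2 (-) (?ts @ [length tr]) (0 # ?ts) = map2 (-) ?ts (0 # ?ts) @ [g]"
    using map2_gaps_snoc[of "(-)" ?ts "length tr" 0 "[]"] f(2) by simp
  also have "Max (set (map2 (-) ?ts (0 # ?ts) @ [g])) = max m g"
  proof -
    \<comment> \<open>Next to the element \<open>g\<close> the default 0 no longer influences the
      maximum.\<close>
    have "Max (insert 0 (insert g (set (map2 (-) ?ts (0 # ?ts))))) = Max (insert g (set (map2 (-) ?ts (0 # ?ts))))"
      by (subst Max_insert) auto
    moreover have "Max (insert g (insert 0 (set (map2 (-) ?ts (0 # ?ts))))) = max g m"
      unfolding f(3) by (subst Max_insert) auto
    ultimately show ?thesis by (simp add: insert_commute max.commute)
  qed
  finally show "delay P \<sigma> (length tr) = max m g" .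
qed

text \<open>Each output closes a stretch of at most \<open>m\<close> steps and \<open>g\<close>
  steps follow the last one. So a bound on the delay also bounds the total time, on which the word
  size of the enumeration phase rests.\<close>

lemma fold_gstep_length:
  fixes tr :: "(nat \<times> nat) option list"
  assumes "fold gstep tr ([], 0, 0) = (es, g, m)"
  shows "length tr \<le> length es * m + g"
  using assms
proof (induction tr arbitrary: es g m rule: rev_induct)
  case (snoc x tr)
  obtain es' g' m' where eq: "fold gstep tr ([], 0, 0) = (es', g', m')"
    by (cases "fold gstep tr ([], 0, 0)") auto
  note IH = snoc(1)[OF eq]
  show ?case
  proof (cases x)
    case None
    then show ?thesis using IH eq snoc(2) by auto
  next
    case (Some e)
    then have e: "es = es' @ [e]" "g = 0" "m = max m' (g' + 1)" using eq snoc(2) by auto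
    then have "length es' * m' \<le> length es' * m" by simp
    moreover have "length es * m = length es' * m + m" "g' + 1 \<le> m" using e by auto
    ultimately have "length tr + 1 \<le> length es * m" using IH by linarith
    then show ?thesis using e(1,2) by simp
  qed
qed simp

text \<open>
  In a tame program register \<open>r\<close> stays below \<open>f r * (V + t * C)\<close> at time \<open>t\<close>: sums and multiples
  only move values to registers of larger weight, whereas counters advance by at most \<open>C\<close> per step.
  So polynomial running time already implies logarithmic word size.
\<close>

fun weight :: "(nat \<Rightarrow> nat) \<Rightarrow> operand \<Rightarrow> nat" where
  "weight f (Imm n) = 1"
| "weight f (Reg r) = f r"

fun small :: "nat \<Rightarrow> operand \<Rightarrow> bool" where
  "small C (Imm n) \<longleftrightarrow> n \<le> C"
| "small C (Reg r) \<longleftrightarrow> True"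

fun tame :: "(nat \<Rightarrow> nat) \<Rightarrow> nat \<Rightarrow> instr \<Rightarrow> bool" where
  "tame f C (Arith Add r x y) \<longleftrightarrow> small C x \<and> small C y \<and>
     (weight f x + weight f y \<le> f r \<or> (\<exists>c. y = Imm c \<and> weight f x \<le> f r))"
| "tame f C (Arith Sub r x y) \<longleftrightarrow> small C x \<and> weight f x \<le> f r"
| "tame f C (Arith Mul r x y) \<longleftrightarrow> small C x \<and> (\<exists>c. y = Imm c \<and> weight f x * c \<le> f r)"
| "tame f C (Arith Div r x y) \<longleftrightarrow> small C x \<and> weight f x \<le> f r"
| "tame f C (Store x y) \<longleftrightarrow> small C y \<and> weight f y \<le> 1"
| "tame f C _ \<longleftrightarrow> True"

definition weighted :: "(nat \<Rightarrow> nat) \<Rightarrow> nat \<Rightarrow> state \<Rightarrow> bool" where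
  "weighted f V \<sigma> \<longleftrightarrow> (\<forall>r. regs \<sigma> r \<le> f r * V) \<and> (\<forall>a. mem \<sigma> a \<le> V)"

lemma weighted_mono:
  assumes "weighted f V \<sigma>" "V \<le> V'"
  shows "weighted f V' \<sigma>"
  unfolding weighted_def
proof (intro conjI allI)
  fix r show "regs \<sigma> r \<le> f r * V'"
    using assms mult_le_mono2[OF assms(2), of "f r"] by (auto simp: weighted_def intro: le_trans)
next
  fix a show "mem \<sigma> a \<le> V'" using assms by (auto simp: weighted_def intro: le_trans)
qed

lemma weighted_operand:
  "weighted f V \<sigma> \<Longrightarrow> small C x \<Longrightarrow> C \<le> V \<Longrightarrow> operand_val \<sigma> x \<le> weight f x * V"
  by (cases x) (auto simp: weighted_def)

lemma weighted_set_reg: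
  "weighted f V \<sigma> \<Longrightarrow> v \<le> f r * V \<Longrightarrow> weighted f V (\<sigma>\<lparr>pc := p, regs := (regs \<sigma>)(r := v)\<rparr>)"
  by (auto simp: weighted_def)

text \<open>Only adding a constant consumes the extra \<open>C\<close>, which suffices as
  \<open>f r\<close> is at least 1; all other results are already bounded at
  \<open>V\<close>.\<close>

lemma weighted_instr_step:
  assumes "weighted f V \<sigma>" "C \<le> V" "\<And>r. 1 \<le> f r" "tame f C i"
  shows "weighted f (V + C) (instr_step i \<sigma>)"
proof -
  have W: "weighted f (V + C) \<sigma>" using weighted_mono[OF assms(1)] by simp
  have 1: "v \<le> f r * (V + C)" if "v \<le> weight f x * V" "weight f x \<le> f r" for v x r
    using mult_le_mono[OF that(2), of V "V + C"] that(1) by auto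
  show ?thesis
  proof (cases i)
    case (Arith op r x y)
    have "arith_val op (operand_val \<sigma> x) (operand_val \<sigma> y) \<le> f r * (V + C)"
    proof (cases op)
      case Add
      then have t: "small C x" "small C y"
        "weight f x + weight f y \<le> f r \<or> (\<exists>c. y = Imm c \<and> weight f x \<le> f r)"
        using assms(4) Arith by auto
      have v: "operand_val \<sigma> x \<le> weight f x * V" "operand_val \<sigma> y \<le> weight f y * V"
        using weighted_operand[OF assms(1)] t assms(2) by auto
      from t(3) show ?thesis
      proof
        assume "weight f x + weight f y \<le> f r"
        then have "(weight f x + weight f y) * V \<le> f r * (V + C)" by (intro mult_le_mono) auto
        then show ?thesis using v Add by (simp add: algebra_simps)
      next
        assume "\<exists>c. y = Imm c \<and> weight f x \<le> f r"
        then obtain c where c: "y = Imm c" "weight f x \<le> f r" by blast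
        have "weight f x * V \<le> f r * V" using c(2) by simp
        then have "operand_val \<sigma> x \<le> f r * V" using v(1) by (rule le_trans[rotated])
        moreover have "c \<le> f r * C" using mult_le_mono[OF assms(3)[of r], of c C] t(2) c(1) by simp
        ultimately show ?thesis using c(1) Add by (simp add: add_mult_distrib2)
      qed
    next
      case Sub
      then have "operand_val \<sigma> x - operand_val \<sigma> y \<le> weight f x * V" "weight f x \<le> f r"
        using weighted_operand[OF assms(1), of C x] assms(2,4) Arith by auto
      from 1[OF this] show ?thesis using Sub by simp
    next
      case Mul
      then obtain c where c: "small C x" "y = Imm c" "weight f x * c \<le> f r"
        using assms(4) Arith by auto
      have "operand_val \<sigma> x * c \<le> weight f x * V * c"
        using weighted_operand[OF assms(1) c(1) assms(2)] by (intro mult_le_mono) auto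
      also have "\<dots> = weight f x * c * V" by simp
      also have "\<dots> \<le> f r * (V + C)" using c(3) by (intro mult_le_mono) auto
      finally show ?thesis using Mul c(2) by simp
    next
      case Div
      have "operand_val \<sigma> x div operand_val \<sigma> y \<le> operand_val \<sigma> x" by simp
      then have "operand_val \<sigma> x div operand_val \<sigma> y \<le> weight f x * V" "weight f x \<le> f r"
        using Div weighted_operand[OF assms(1), of C x] assms(2,4) Arith
        by (auto intro: le_trans[OF div_le_dividend])
      from 1[OF this] show ?thesis using Div by simp
    qed
    then show ?thesis using weighted_set_reg[OF W] Arith by simp
  next
    case (Load r x)
    have "mem \<sigma> (operand_val \<sigma> x) \<le> 1 * (V + C)" using W by (simp add: weighted_def)
    also have "\<dots> \<le> f r * (V + C)" by (intro mult_le_mono assms(3)) auto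
    finally show ?thesis using weighted_set_reg[OF W] Load by simp
  next
    case (Store x y)
    have "operand_val \<sigma> y \<le> weight f y * V"
      using weighted_operand[OF assms(1) _ assms(2)] assms(4) Store by simp
    also have "\<dots> \<le> 1 * V" using assms(4) Store by (intro mult_le_mono) auto
    finally show ?thesis using W Store by (auto simp: weighted_def)
  qed (use W in \<open>auto simp: weighted_def\<close>)
qed

lemma weighted_exec:
  assumes "weighted f V \<sigma>" "C \<le> V" "\<And>r. 1 \<le> f r" "list_all (tame f C) P"
  shows "weighted f (V + t * C) (exec P \<sigma> t)"
proof (induction t)
  case (Suc t)
  show ?case
  proof (cases "halted P (exec P \<sigma> t)")
    case True
    then show ?thesis using Suc weighted_mono by (auto simp: exec_Suc step_def)
  next
    case False
    then have "tame f C (P ! pc (exec P \<sigma> t))"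
      using assms(4) by (auto simp: halted_def list_all_length)
    from weighted_instr_step[OF Suc _ assms(3) this] show ?thesis
      using assms(2) False by (simp add: exec_Suc step_def algebra_simps)
  qed
qed (use assms in simp)

lemma words_below_exec:
  assumes "weighted f V \<sigma>" "C \<le> V" "\<And>r. 1 \<le> f r" "\<And>r. f r \<le> F" "list_all (tame f C) P"
    and "F * (V + T * C) < B"
  shows "words_below B P \<sigma> T"
  unfolding words_below_def
proof (intro allI impI conjI)
  fix t r a assume "t \<le> T"
  then have "V + t * C \<le> V + T * C" by simp
  then have W: "weighted f (V + T * C) (exec P \<sigma> t)"
    using weighted_mono weighted_exec[OF assms(1,2,3,5)] by blast
  then have "regs (exec P \<sigma> t) r \<le> f r * (V + T * C)" by (simp add: weighted_def)
  also have "\<dots> \<le> F * (V + T * C)" by (intro mult_le_mono assms(4)) auto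
  finally show "regs (exec P \<sigma> t) r < B" using assms(6) by simp
  have "mem (exec P \<sigma> t) a \<le> 1 * (V + T * C)" using W by (simp add: weighted_def)
  also have "\<dots> \<le> F * (V + T * C)"
    using assms(3)[of 0] assms(4)[of 0] by (intro mult_le_mono) linarith+
  finally show "mem (exec P \<sigma> t) a < B" using assms(6) by simp
qed

fun tame_com :: "(nat \<Rightarrow> nat) \<Rightarrow> nat \<Rightarrow> com \<Rightarrow> bool" where
  "tame_com f C (Basic b) \<longleftrightarrow> list_all (tame f C) (basic_code b)"
| "tame_com f C (c ;; d) \<longleftrightarrow> tame_com f C c \<and> tame_com f C d"
| "tame_com f C (When b c) \<longleftrightarrow> tame_com f C c"
| "tame_com f C (While b c) \<longleftrightarrow> tame_com f C c"

lemma tame_compile: "tame_com f C c \<Longrightarrow> list_all (tame f C) (compile a c)"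
proof (induction c arbitrary: a)
  case (When b c)
  then show ?case by (cases b) (auto simp: goto_def)
next
  case (While b c)
  then show ?case by (cases b) (auto simp: goto_def)
qed auto

section \<open>Total correctness and its transfer to the machine\<close>

definition wp :: "(nat \<Rightarrow> nat) \<Rightarrow> nat \<Rightarrow> com \<Rightarrow> (sstate \<Rightarrow> bool) \<Rightarrow> sstate \<Rightarrow> bool" where
  "wp inp w c Q s \<longleftrightarrow> (\<exists>s'. big inp w c s s' \<and> Q s')"

lemma wp_mono: "wp inp w c Q s \<Longrightarrow> (\<And>s'. Q s' \<Longrightarrow> R s') \<Longrightarrow> wp inp w c R s"
  unfolding wp_def by blast

text \<open>The invariant describes the loop head after the jump back, so time bounds stated in
  \<open>I\<close> include that tick.\<close>

lemma wp_While:
  fixes m :: "sstate \<Rightarrow> nat"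
  assumes "I s"
    and "\<And>s. I s \<Longrightarrow> cval s b \<Longrightarrow> wp inp w c (\<lambda>s'. I (tick 1 s') \<and> m (tick 1 s') < m s) (tick 1 s)"
    and "\<And>s. I s \<Longrightarrow> \<not> cval s b \<Longrightarrow> Q (tick 2 s)"
  shows "wp inp w (While b c) Q s"
  using assms(1)
proof (induction "m s" arbitrary: s rule: less_induct)
  case less
  show ?case
  proof (cases "cval s b")
    case True
    then obtain s' where s': "big inp w c (tick 1 s) s'" "I (tick 1 s')" "m (tick 1 s') < m s"
      using assms(2)[OF less(2)] by (auto simp: wp_def)
    from less(1)[OF s'(3,2)] show ?thesis
      using s'(1) True unfolding wp_def by (blast intro: big.intros)
  next
    case False
    then show ?thesis using assms(3)[OF less(2)] unfolding wp_def by (blast intro: big.intros)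
  qed
qed

text \<open>Starting from \<open>([], 0, 0)\<close>, the final ghost components are exactly the
  observations of the machine run.\<close>

theorem wp_compile:
  assumes "wp inp w c Q s" "sim inp w s \<sigma>" "pc \<sigma> = 0" "ghost s = ([], 0, 0)"
  defines "P \<equiv> compile 0 c"
  obtains T s' where "Q s'" "halts_at P \<sigma> T" "sim inp w s' (exec P \<sigma> T)"
    "outputs P \<sigma> T = emitted s'" "delay P \<sigma> T = max (worst s') (gap s')"
    "T \<le> length (emitted s') * worst s' + gap s'"
proof -
  obtain s' where s': "big inp w c s s'" "Q s'" using assms(1) by (auto simp: wp_def)
  have "code_at P 0 (compile 0 c)" unfolding P_def code_at_def by (auto intro!: exI[of _ "[]"])
  from compile_correct[OF s'(1) assms(2,3) this] obtain tr \<sigma>' where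
    *: "run P \<sigma> tr \<sigma>'" "sim inp w s' \<sigma>'" "pc \<sigma>' = csize c" "ghost s' = fold gstep tr ([], 0, 0)"
    using assms(4) by auto
  then have f: "fold gstep tr ([], 0, 0) = (emitted s', gap s', worst s')" by (simp add: ghost_def)
  have "halted P \<sigma>'" using *(3) by (simp add: halted_def P_def)
  note o = run_observations[OF *(1) this f]
  show thesis using that[OF s'(2) o(1) _ o(2,3)] o(4) *(2) fold_gstep_length[OF f] by simp
qed


section \<open>The programs\<close>

text \<open>
  The arrays \<open>aFL1\<close>, \<open>aFL2\<close> flag the letters of the two factors.  Row \<open>u\<close> of the table \<open>A\<close> consists of the
  cells of \<open>aAL\<close> from \<open>aAO u\<close> to \<open>aAO (u + 1)\<close>, similarly for \<open>Y\<close>.  A node is marked if its entry in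
  \<open>aST\<close> is the current stamp \<open>rC\<close>, so that incrementing \<open>rC\<close> removes all marks.  For the \<open>i\<close>-th node
  \<open>aACT i\<close> with answers, the longest list \<open>Y z*\<close> starts at \<open>aBST i\<close> and has length \<open>aBD i\<close>.
\<close>

abbreviation (input) "rW \<equiv> 0 :: nat"
abbreviation (input) "rN \<equiv> 1 :: nat"
abbreviation (input) "rNF \<equiv> 2 :: nat"
abbreviation (input) "rDT \<equiv> 3 :: nat"
abbreviation (input) "rOT \<equiv> 4 :: nat"
abbreviation (input) "rE \<equiv> 5 :: nat"
abbreviation (input) "rP \<equiv> 6 :: nat"
abbreviation (input) "rX \<equiv> 7 :: nat"
abbreviation (input) "rV \<equiv> 8 :: nat"
abbreviation (input) "rU \<equiv> 9 :: nat"
abbreviation (input) "rO \<equiv> 10 :: nat"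
abbreviation (input) "rC \<equiv> 11 :: nat"
abbreviation (input) "rY \<equiv> 12 :: nat"
abbreviation (input) "rL \<equiv> 13 :: nat"
abbreviation (input) "rF \<equiv> 14 :: nat"
abbreviation (input) "rQ \<equiv> 15 :: nat"
abbreviation (input) "rM \<equiv> 16 :: nat"
abbreviation (input) "rB \<equiv> 17 :: nat"
abbreviation (input) "rZ \<equiv> 18 :: nat"
abbreviation (input) "rS \<equiv> 19 :: nat"
abbreviation (input) "rI \<equiv> 20 :: nat"
abbreviation (input) "rJ \<equiv> 21 :: nat"
abbreviation (input) "rNS \<equiv> 22 :: nat"
abbreviation (input) "rK \<equiv> 23 :: nat"

abbreviation (input) "aFL1 \<equiv> 0 :: nat"
abbreviation (input) "aFL2 \<equiv> 1 :: nat"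
abbreviation (input) "aYO \<equiv> 2 :: nat"
abbreviation (input) "aYL \<equiv> 3 :: nat"
abbreviation (input) "aAO \<equiv> 4 :: nat"
abbreviation (input) "aAL \<equiv> 5 :: nat"
abbreviation (input) "aST \<equiv> 6 :: nat"
abbreviation (input) "aACT \<equiv> 7 :: nat"
abbreviation (input) "aBST \<equiv> 8 :: nat"
abbreviation (input) "aBD \<equiv> 9 :: nat"

abbreviation add :: "nat \<Rightarrow> operand \<Rightarrow> operand \<Rightarrow> com" where
  "add r x y \<equiv> Basic (BArith Add r x y)"
abbreviation move :: "nat \<Rightarrow> operand \<Rightarrow> com" where
  "move r x \<equiv> Basic (BArith Add r x (Imm 0))"
abbreviation incr :: "nat \<Rightarrow> com" where
  "incr r \<equiv> Basic (BArith Add r (Reg r) (Imm 1))"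
abbreviation input :: "nat \<Rightarrow> operand \<Rightarrow> com" where
  "input r x \<equiv> Basic (BInput r x)"
abbreviation load :: "nat \<Rightarrow> nat \<Rightarrow> operand \<Rightarrow> com" where
  "load r j x \<equiv> Basic (BLoad r j x)"
abbreviation store :: "nat \<Rightarrow> operand \<Rightarrow> operand \<Rightarrow> com" where
  "store j x y \<equiv> Basic (BStore j x y)"

inductive_cases big_BasicE: "big inp w (Basic b) s s'"
inductive_cases big_SeqE: "big inp w (c ;; d) s s'"
inductive_cases big_WhenE: "big inp w (When b c) s s'"

lemma wp_Basic [simp]:
  "wp inp w (Basic b) Q s \<longleftrightarrow> guard w b s \<and> Q (effect inp b s)"
  by (auto simp: wp_def intro: big.intros elim: big_BasicE)

lemma wp_Seq [simp]: "wp inp w (c ;; d) Q s \<longleftrightarrow> wp inp w c (wp inp w d Q) s"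
  by (auto simp: wp_def intro: big.intros elim!: big_SeqE)

lemma wp_When [simp]:
  "wp inp w (When b c) Q s \<longleftrightarrow> (if cval s b then wp inp w c Q (tick 1 s) else Q (tick 2 s))"
  by (cases "cval s b") (auto simp: wp_def intro: big.intros[unfolded One_nat_def] elim!: big_WhenE)

section \<open>Duplicate-free lists and tables inside arrays\<close>

definition enumerates :: "(nat \<Rightarrow> 'b) \<Rightarrow> nat \<Rightarrow> nat \<Rightarrow> 'b set \<Rightarrow> bool" where
  "enumerates f a b A \<longleftrightarrow> a \<le> b \<and> inj_on f {a..<b} \<and> f ` {a..<b} = A"

lemma enumerates_empty [simp]: "enumerates f a a A \<longleftrightarrow> A = {}"
  by (auto simp: enumerates_def)

lemma enumerates_frame [simp]:
  "b \<le> y \<Longrightarrow> enumerates (f(y := v)) a b A = enumerates f a b A"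
  unfolding enumerates_def
  by (intro conj_cong refl inj_on_cong arg_cong2[where f = "(=)"] image_cong) auto

lemma enumerates_snoc:
  "enumerates f a y A \<Longrightarrow> v \<notin> A \<Longrightarrow> enumerates (f(y := v)) a (Suc y) (insert v A)"
  by (auto simp: enumerates_def atLeastLessThanSuc inj_on_def)

lemma enumerates_card: "enumerates f a b A \<Longrightarrow> card A = b - a"
  by (auto simp: enumerates_def card_image)

definition table :: "(nat \<Rightarrow> nat) \<Rightarrow> (nat \<Rightarrow> nat) \<Rightarrow> nat \<Rightarrow> (nat \<Rightarrow> nat set) \<Rightarrow> bool" where
  "table off lst m R \<longleftrightarrow> (\<forall>u<m. enumerates lst (off u) (off (Suc u)) (R u))"

lemma table_mono: "table off lst m R \<Longrightarrow> u \<le> u' \<Longrightarrow> u' \<le> m \<Longrightarrow> off u \<le> off u'"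
proof (induction u')
  case (Suc u')
  then have "off u' \<le> off (Suc u')" by (auto simp: table_def enumerates_def)
  then show ?case using Suc by (cases "u = Suc u'") auto
qed simp

text \<open>Rows are contiguous, so all of them end at or before \<open>off m\<close>, and a write
  from there on touches none.\<close>

lemma table_frame:
  assumes "table off lst m R" "off m \<le> y"
  shows "table off (lst(y := v)) m R"
  unfolding table_def
proof (intro allI impI)
  fix u assume "u < m"
  then have "off (Suc u) \<le> y" using table_mono[OF assms(1), of "Suc u" m] assms(2) by simp
  then show "enumerates (lst(y := v)) (off u) (off (Suc u)) (R u)"
    using assms(1) \<open>u < m\<close> by (simp add: table_def)
qed

lemma table_Suc:
  assumes "table off lst m R" "enumerates lst (off m) y (R m)"
  shows "table (off(Suc m := y)) lst (Suc m) R"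
  using assms by (auto simp: table_def less_Suc_eq)

text \<open>The fixed alphabet size \<open>k\<close> is compiled in. \<open>rE\<close> ends at the
  cell behind the first factor, which holds the length of the second one if there is one.
  \<open>rOT\<close>, \<open>rDT\<close> and \<open>rW\<close> become the start of the offset table,
  the start of the successor data and the end of the input.\<close>

definition query_prog :: "nat \<Rightarrow> com" where
  "query_prog k =
     input rN (Imm 0) ;; input rNF (Imm 1) ;; input rE (Imm 2) ;; add rE (Reg rE) (Imm 3) ;;
     move rP (Imm 3) ;; move rOT (Reg rE) ;;
     When (CEq (Reg rNF) (Imm 2))
       (input rX (Reg rE) ;; add rOT (Reg rE) (Reg rX) ;; incr rOT) ;;
     Basic (BArith Mul rNS (Reg rN) (Imm k)) ;; add rDT (Reg rOT) (Reg rNS) ;;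
     input rX (Reg rDT) ;; incr rDT ;; add rW (Reg rDT) (Reg rX)"

definition flag_prog :: "nat \<Rightarrow> nat \<Rightarrow> com" where
  "flag_prog fl e = While (CLess (Reg rP) (Reg e))
     (input rX (Reg rP) ;; store fl (Reg rX) (Imm 1) ;; incr rP)"

definition flags_prog :: com where
  "flags_prog =
     flag_prog aFL1 rE ;;
     When (CEq (Reg rNF) (Imm 2)) (add rP (Reg rE) (Imm 1) ;; flag_prog aFL2 rOT)"

text \<open>The table for a missing second factor; otherwise \<open>table_prog\<close> overwrites
  it. The last store closes the last row.\<close>

definition identity_prog :: com where
  "identity_prog =
     move rU (Imm 0) ;;
     While (CLess (Reg rU) (Reg rN))
       (store aYO (Reg rU) (Reg rU) ;; store aYL (Reg rU) (Reg rU) ;; incr rU) ;;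
     store aYO (Reg rU) (Reg rU)"

text \<open>Stamps never exceed \<open>rC\<close>, so a smaller stamp means unmarked.\<close>

definition scan_prog :: "nat \<Rightarrow> com" where
  "scan_prog lst =
     While (CLess (Reg rP) (Reg rE))
       (add rQ (Reg rDT) (Reg rP) ;; input rV (Reg rQ) ;; incr rP ;; load rX aST (Reg rV) ;;
        When (CLess (Reg rX) (Reg rC))
          (store aST (Reg rV) (Reg rC) ;; store lst (Reg rY) (Reg rV) ;; incr rY))"

text \<open>\<open>rO\<close> steps over the offsets of all letters, flagged or not, and so ends at
  the first offset of the next node.\<close>

definition row_prog :: "nat \<Rightarrow> nat \<Rightarrow> nat \<Rightarrow> com" where
  "row_prog k fl lst =
     While (CLess (Reg rL) (Imm k))
       (input rP (Reg rO) ;; incr rO ;; input rE (Reg rO) ;; load rF fl (Reg rL) ;;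
        When (CEq (Reg rF) (Imm 1)) (scan_prog lst) ;;
        incr rL)"

definition table_prog :: "nat \<Rightarrow> nat \<Rightarrow> nat \<Rightarrow> nat \<Rightarrow> com" where
  "table_prog k fl off lst =
     move rO (Reg rOT) ;; move rU (Imm 0) ;; move rY (Imm 0) ;; store off (Imm 0) (Imm 0) ;;
     While (CLess (Reg rU) (Reg rN))
       (incr rC ;; move rL (Imm 0) ;; row_prog k fl lst ;; incr rU ;; store off (Reg rU) (Reg rY))"

definition best_prog :: com where
  "best_prog =
     While (CLess (Reg rP) (Reg rE))
       (load rV aAL (Reg rP) ;; incr rP ;; load rS aYO (Reg rV) ;; incr rV ;;
        load rX aYO (Reg rV) ;; Basic (BArith Sub rX (Reg rX) (Reg rS)) ;;
        When (CLess (Reg rB) (Reg rX)) (move rB (Reg rX) ;; move rZ (Reg rS)))"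

text \<open>\<open>rP\<close> is not reset between nodes: rows are adjacent, so all runs of
  \<open>best_prog\<close> together read \<open>aAL\<close> once. The maximum \<open>rB\<close> is
  positive exactly if the node has an answer.\<close>

definition active_prog :: com where
  "active_prog =
     move rM (Imm 0) ;; move rU (Imm 0) ;; move rP (Imm 0) ;;
     While (CLess (Reg rU) (Reg rN))
       (add rX (Reg rU) (Imm 1) ;; load rE aAO (Reg rX) ;; move rB (Imm 0) ;;
        best_prog ;;
        When (CLess (Imm 0) (Reg rB))
          (store aACT (Reg rM) (Reg rU) ;; store aBST (Reg rM) (Reg rZ) ;;
           store aBD (Reg rM) (Reg rB) ;; incr rM) ;;
        incr rU)"

definition pre_prog :: "nat \<Rightarrow> com" where
  "pre_prog k = query_prog k ;; flags_prog ;; identity_prog ;;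
     When (CEq (Reg rNF) (Imm 2)) (table_prog k aFL2 aYO aYL) ;;
     table_prog k aFL1 aAO aAL ;; active_prog"

definition reserve_prog :: com where
  "reserve_prog =
     While (CLess (Reg rP) (Reg rE))
       (load rV aYL (Reg rP) ;; store aST (Reg rV) (Reg rC) ;; incr rP)"

definition column_prog :: com where
  "column_prog =
     While (CLess (Reg rP) (Reg rE))
       (load rV aAL (Reg rP) ;; incr rP ;; load rS aYO (Reg rV) ;;
        add rK (Reg rS) (Reg rJ) ;; incr rV ;; load rX aYO (Reg rV) ;;
        When (CLess (Reg rK) (Reg rX))
          (load rV aYL (Reg rK) ;; load rX aST (Reg rV) ;;
           When (CLess (Reg rX) (Reg rC))
             (store aST (Reg rV) (Reg rC) ;; Basic (BOut (Reg rU) (Reg rV)))))"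

definition source_prog :: com where
  "source_prog =
     While (CLess (Reg rJ) (Reg rB))
       (add rK (Reg rZ) (Reg rJ) ;; load rV aYL (Reg rK) ;; Basic (BOut (Reg rU) (Reg rV)) ;;
        load rP aAO (Reg rU) ;; add rX (Reg rU) (Imm 1) ;; load rE aAO (Reg rX) ;;
        column_prog ;; incr rJ)"

definition enum_prog :: com where
  "enum_prog =
     move rI (Imm 0) ;;
     While (CLess (Reg rI) (Reg rM))
       (load rU aACT (Reg rI) ;; load rZ aBST (Reg rI) ;; load rB aBD (Reg rI) ;;
        incr rC ;; add rE (Reg rZ) (Reg rB) ;; move rP (Reg rZ) ;; reserve_prog ;;
        move rJ (Imm 0) ;; source_prog ;; incr rI)"

text \<open>Array indices have weight at most 2, so register 0 gets 2 * 10 and register 1 one more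
  for the array number; register 2 adds the weight 5 + k of the base \<open>rW\<close>. The base is
  the sum of \<open>rDT\<close> and \<open>rX\<close>, and \<open>rDT\<close> that of
  \<open>rOT\<close> and \<open>rNS\<close>; the latter has weight k, but at least 1 as required of
  all weights. \<open>rOT\<close>, \<open>rE\<close>, \<open>rK\<close> and \<open>rQ\<close> are
  sums as well. Whatever is stored in an array has weight 1.\<close>

fun prog_weight :: "nat \<Rightarrow> nat \<Rightarrow> nat" where
  "prog_weight k r =
     (if r = 0 then 20 else if r = 1 then 21 else if r = 2 then 26 + k
      else if r = rW + 3 then 5 + k
      else if r = rQ + 3 then 6 + k
      else if r = rDT + 3 then 4 + k
      else if r \<in> {rOT + 3, rO + 3} then 3
      else if r \<in> {rE + 3, rK + 3, rP + 3} then 2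
      else if r = rNS + 3 then max 1 k
      else 1)"

lemma tame_pre_prog: "tame_com (prog_weight k) 10 (pre_prog k)"
  by (simp add: pre_prog_def query_prog_def flags_prog_def flag_prog_def identity_prog_def
      table_prog_def row_prog_def scan_prog_def active_prog_def best_prog_def address_code_def)

lemma tame_enum_prog: "tame_com (prog_weight k) 10 enum_prog"
  by (simp add: enum_prog_def source_prog_def column_prog_def reserve_prog_def address_code_def)


section \<open>Reading the query\<close>

definition ready_for :: "nat \<Rightarrow> nat \<Rightarrow> nat \<Rightarrow> nat \<Rightarrow> nat \<Rightarrow> sstate \<Rightarrow> bool" where
  "ready_for w n nf dt ot s \<longleftrightarrow>
     rg s rW = w \<and> rg s rN = n \<and> rg s rNF = nf \<and> rg s rDT = dt \<and> rg s rOT = ot"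

text \<open>What the programs use of the input, as arithmetic on addresses. \<open>k1\<close> and
  \<open>k2\<close> are the lengths of the factors. The offset table fills \<open>n * k + 1\<close>
  cells from \<open>ot\<close>, hence \<open>dt\<close>; its last entry is the number of successor
  entries, hence \<open>w\<close>.\<close>

locale stored_database =
  fixes inp :: "nat \<Rightarrow> nat" and w n k nf k1 k2 ot dt :: nat and F1 F2 :: "nat set"
  assumes inp_n: "inp 0 = n" and inp_nf: "inp 1 = nf" and nf: "nf \<in> {1, 2}"
    and inp_k1: "inp 2 = k1" and F1: "F1 = (\<lambda>i. inp (3 + i)) ` {..<k1}"
    and inp_k2: "nf = 2 \<Longrightarrow> inp (3 + k1) = k2"
    and F2: "nf = 2 \<Longrightarrow> F2 = (\<lambda>i. inp (4 + k1 + i)) ` {..<k2}"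
    and letters: "F1 \<subseteq> {..<k}" "F2 \<subseteq> {..<k}"
    and ot: "ot = (if nf = 2 then 4 + k1 + k2 else 3 + k1)"
    and dt: "dt = Suc (ot + n * k)"
    and w: "w = dt + inp (ot + n * k)"
    and offsets: "i < n * k \<Longrightarrow> inp (ot + i) \<le> inp (Suc (ot + i))"
    and entries: "p < inp (ot + n * k) \<Longrightarrow> inp (dt + p) < n"
begin

definition succs :: "nat \<Rightarrow> nat \<Rightarrow> nat set" where
  "succs u l = (\<lambda>p. inp (dt + p)) ` {inp (ot + (u * k + l))..<inp (Suc (ot + (u * k + l)))}"

definition step_set :: "nat set \<Rightarrow> nat \<Rightarrow> nat set" where
  "step_set F u = (\<Union>l\<in>F. succs u l)"

definition m :: nat where "m = inp (ot + n * k)"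

lemma offset_mono: "i \<le> j \<Longrightarrow> j \<le> n * k \<Longrightarrow> inp (ot + i) \<le> inp (ot + j)"
proof (induction j)
  case (Suc j)
  then show ?case using offsets[of j] by (cases "i = Suc j") auto
qed simp

lemma offset_le: "i \<le> n * k \<Longrightarrow> inp (ot + i) \<le> m"
  unfolding m_def by (rule offset_mono) auto

lemma ot_less_w: "ot < w"
  by (simp add: w dt)

abbreviation ready :: "sstate \<Rightarrow> bool" where
  "ready \<equiv> ready_for w n nf dt ot"

lemma wp_query_prog:
  fixes s :: sstate
  assumes "gap s = 0" "rg s = (\<lambda>_. 0)"
  shows "wp inp w (query_prog k) (\<lambda>s'. ready s' \<and> rg s' rC = 0 \<and> ar s' = ar s \<and>
    emitted s' = emitted s \<and> worst s' = worst s \<and> gap s' \<le> 30 \<and> rg s' rP = 3 \<and> rg s' rE = 3 + k1) s"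
proof -
  have *: "inp (3 + k1) = k2" "inp (k1 + 3) = k2" if "nf = 2"
    using inp_k2 that by (auto simp: add.commute)
  show ?thesis
  proof (cases "nf = 2")
    case True
    then have "ot = Suc (k1 + 3 + k2)" by (simp add: ot)
    then show ?thesis using assms *[OF True] w dt True
      unfolding query_prog_def ready_for_def by (simp add: tick_def inp_n inp_k1 inp_nf[simplified])
  next
    case False
    then have "ot = k1 + 3" by (simp add: ot)
    then show ?thesis using assms w dt False
      unfolding query_prog_def ready_for_def by (simp add: tick_def inp_n inp_k1 inp_nf[simplified])
  qed
qed

lemma wp_flag_prog:
  fixes s :: sstate
  assumes "ready s" "j < 10" "rg s rP = a" "rg s e = a + b" "a + b \<le> ot"
    "e \<noteq> rP" "e \<noteq> rX" "\<And>i. ar s j i = 0"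
  defines "Post \<equiv> \<lambda>s' :: sstate. (\<forall>r. r \<noteq> rP \<longrightarrow> r \<noteq> rX \<longrightarrow> rg s' r = rg s r) \<and>
    (\<forall>i. ar s' j i = (if i \<in> (\<lambda>i. inp (a + i)) ` {..<b} then 1 else 0)) \<and>
    (\<forall>j'. j' \<noteq> j \<longrightarrow> ar s' j' = ar s j') \<and> emitted s' = emitted s \<and> worst s' = worst s \<and>
    gap s' \<le> gap s + 20 * b + 2"
  shows "wp inp w (flag_prog j e) Post s"
proof -
  define I where "I s' \<longleftrightarrow> (\<forall>r. r \<noteq> rP \<longrightarrow> r \<noteq> rX \<longrightarrow> rg s' r = rg s r) \<and>
    (\<exists>i\<le>b. rg s' rP = a + i \<and> (\<forall>l. ar s' j l = (if l \<in> (\<lambda>i. inp (a + i)) ` {..<i} then 1 else 0)) \<and>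
       gap s' \<le> gap s + 20 * i) \<and>
    (\<forall>j'. j' \<noteq> j \<longrightarrow> ar s' j' = ar s j') \<and> emitted s' = emitted s \<and> worst s' = worst s" for s' :: sstate
  show ?thesis unfolding flag_prog_def
  proof (rule wp_While[where I = I and m = "\<lambda>s. a + b - rg s rP"])
    show "I s" using assms by (auto simp: I_def intro!: exI[of _ 0])
  next
    fix t assume I: "I t" and c: "cval t (CLess (Reg rP) (Reg e))"
    then obtain i where i: "i \<le> b" "rg t rP = a + i" "gap t \<le> gap s + 20 * i"
      "\<forall>l. ar t j l = (if l \<in> (\<lambda>i. inp (a + i)) ` {..<i} then 1 else 0)" by (auto simp: I_def)
    moreover from i c I assms have "i < b" by (simp add: I_def)
    moreover have "rg t rW = w" "a + i < w" using assms \<open>i < b\<close> I ot_less_w by (auto simp: I_def ready_for_def)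
    ultimately show "wp inp w (input rX (Reg rP) ;; store j (Reg rX) (Imm 1) ;; incr rP)
      (\<lambda>s'. I (tick 1 s') \<and> a + b - rg (tick 1 s') rP < a + b - rg t rP) (tick 1 t)"
      using I assms by (auto simp: I_def tick_def lessThan_Suc intro!: exI[of _ "Suc i"])
  next
    fix t assume I: "I t" and c: "\<not> cval t (CLess (Reg rP) (Reg e))"
    then have "rg t rP = a + b" using assms by (auto simp: I_def)
    then show "Post (tick 2 t)" using I by (auto simp: I_def Post_def tick_def)
  qed
qed

lemma wp_flags_prog:
  assumes "ready s" "rg s rC = 0" "rg s rP = 3" "rg s rE = 3 + k1" "ar s = (\<lambda>_ _. 0)"
  shows "wp inp w flags_prog (\<lambda>s'. ready s' \<and> rg s' rC = 0 \<and>
     (\<forall>l. ar s' aFL1 l = 1 \<longleftrightarrow> l \<in> F1) \<and> (nf = 2 \<longrightarrow> (\<forall>l. ar s' aFL2 l = 1 \<longleftrightarrow> l \<in> F2)) \<and>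
     (\<forall>v. ar s' aST v = 0) \<and> emitted s' = emitted s \<and> worst s' = worst s \<and>
     gap s' \<le> gap s + 20 * ot + 10) s"
  unfolding flags_prog_def wp_Seq
proof (rule wp_mono[OF wp_flag_prog[where a = 3 and b = k1]], goal_cases)
  \<comment> \<open>The ninth goal is the consequence of the postcondition; the eight before it are
    the premises of \<open>wp_flag_prog\<close>.\<close>
  case (9 t)
  then have t: "ready t" "rg t rC = 0" "rg t rE = 3 + k1" "\<forall>l. ar t aFL1 l = 1 \<longleftrightarrow> l \<in> F1"
    "\<forall>j. j \<noteq> aFL1 \<longrightarrow> ar t j = ar s j" "emitted t = emitted s" "worst t = worst s"
    "gap t \<le> gap s + 20 * k1 + 2"
    using assms by (simp_all add: ready_for_def F1)
  show ?case
  proof (cases "nf = 2")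
    case True
    let ?t = "tick 1 (tick 1 t\<lparr>rg := (rg t)(rP := Suc (3 + k1))\<rparr>)"
    have "wp inp w (flag_prog aFL2 rOT) (\<lambda>s'. ready s' \<and> rg s' rC = 0 \<and>
     (\<forall>l. ar s' aFL1 l = 1 \<longleftrightarrow> l \<in> F1) \<and> (nf = 2 \<longrightarrow> (\<forall>l. ar s' aFL2 l = 1 \<longleftrightarrow> l \<in> F2)) \<and>
     (\<forall>v. ar s' aST v = 0) \<and> emitted s' = emitted s \<and> worst s' = worst s \<and>
     gap s' \<le> gap s + 20 * ot + 10) ?t"
    proof (rule wp_mono[OF wp_flag_prog[where a = "Suc (3 + k1)" and b = k2]], goal_cases)
      case (9 t')
      then show ?case using t assms True F2 by (auto simp: ready_for_def tick_def ot)
    qed (use t assms True in \<open>auto simp: ready_for_def tick_def ot\<close>)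
    then show ?thesis using True t by (simp add: ready_for_def tick_def)
  next
    case False
    then show ?thesis using t assms ot by (simp add: ready_for_def tick_def)
  qed
qed (use assms ot in \<open>auto simp: ready_for_def\<close>)

lemma wp_identity_prog:
  assumes "ready s"
  shows "wp inp w identity_prog (\<lambda>s'. ready s' \<and> rg s' rC = rg s rC \<and>
     (\<forall>j. j \<noteq> aYO \<longrightarrow> j \<noteq> aYL \<longrightarrow> ar s' j = ar s j) \<and>
     table (ar s' aYO) (ar s' aYL) n (\<lambda>u. {u}) \<and> emitted s' = emitted s \<and> worst s' = worst s \<and>
     gap s' \<le> gap s + 20 * n + 10) s"
proof -
  define I where "I s' \<longleftrightarrow> ready s' \<and> rg s' rC = rg s rC \<and> rg s' rU \<le> n \<and>
     (\<forall>j. j \<noteq> aYO \<longrightarrow> j \<noteq> aYL \<longrightarrow> ar s' j = ar s j) \<and>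
     (\<forall>i<rg s' rU. ar s' aYO i = i \<and> ar s' aYL i = i) \<and>
     emitted s' = emitted s \<and> worst s' = worst s \<and>
     gap s' \<le> gap s + 1 + 20 * rg s' rU" for s' :: sstate
  show ?thesis unfolding identity_prog_def wp_Seq wp_Basic
  proof (intro conjI, simp, rule wp_While[where I = I and m = "\<lambda>s. n - rg s rU"])
    show "I (effect inp (BArith Add rU (Imm 0) (Imm 0)) s)"
      using assms by (simp add: I_def ready_for_def tick_def)
  next
    fix t assume I: "I t" and c: "cval t (CLess (Reg rU) (Reg rN))"
    then show "wp inp w (store aYO (Reg rU) (Reg rU) ;; store aYL (Reg rU) (Reg rU) ;; incr rU)
      (\<lambda>s'. I (tick 1 s') \<and> n - rg (tick 1 s') rU < n - rg t rU) (tick 1 t)"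
      by (auto simp: I_def ready_for_def tick_def less_Suc_eq)
  next
    fix t assume I: "I t" and c: "\<not> cval t (CLess (Reg rU) (Reg rN))"
    then have u: "rg t rU = n" by (simp add: I_def ready_for_def)
    \<comment> \<open>The entry at \<open>n\<close>, one past the last node, is written after the
      loop and ends the last row.\<close>
    define off where "off = (ar t aYO)(n := n)"
    have "off i = i" if "i \<le> n" for i using I u that by (simp add: I_def off_def)
    moreover have "ar t aYL i = i" if "i < n" for i using I u that by (simp add: I_def)
    ultimately have "table off (ar t aYL) n (\<lambda>u. {u})"
      by (simp add: table_def enumerates_def)
    then show "guard w (BStore aYO (Reg rU) (Reg rU)) (tick 2 t) \<and>
      (\<lambda>s'. ready s' \<and> rg s' rC = rg s rC \<and>
     (\<forall>j. j \<noteq> aYO \<longrightarrow> j \<noteq> aYL \<longrightarrow> ar s' j = ar s j) \<and>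
     table (ar s' aYO) (ar s' aYL) n (\<lambda>u. {u}) \<and> emitted s' = emitted s \<and> worst s' = worst s \<and>
     gap s' \<le> gap s + 20 * n + 10) (effect inp (BStore aYO (Reg rU) (Reg rU)) (tick 2 t))"
      using I u unfolding off_def by (simp add: I_def ready_for_def tick_def)
  qed
qed

end


section \<open>Successor tables\<close>

context stored_database
begin

text \<open>
  The tables for rows below \<open>u\<close> are complete, row \<open>u\<close> contains \<open>A\<close> so far, and exactly \<open>A\<close> is marked.
\<close>

definition filling ::
  "nat \<Rightarrow> nat \<Rightarrow> nat set \<Rightarrow> sstate \<Rightarrow> nat \<Rightarrow> nat set \<Rightarrow> sstate \<Rightarrow> bool" where
  "filling off lst F s0 u A s \<longleftrightarrow> ready s \<and> (\<forall>v. ar s aST v \<le> rg s rC) \<and>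
     {v. ar s aST v = rg s rC} = A \<and> rg s rU = u \<and> ar s off 0 = 0 \<and>
     table (ar s off) (ar s lst) u (step_set F) \<and> enumerates (ar s lst) (ar s off u) (rg s rY) A \<and>
     (\<forall>j. j \<noteq> aST \<longrightarrow> j \<noteq> off \<longrightarrow> j \<noteq> lst \<longrightarrow> ar s j = ar s0 j) \<and>
     emitted s = emitted s0 \<and> worst s = worst s0"

lemma filling_cong:
  assumes "filling off lst F s0 u A s" "ar s' = ar s" "emitted s' = emitted s" "worst s' = worst s"
    "\<And>r. r \<in> {rW, rN, rNF, rDT, rOT, rC, rU, rY} \<Longrightarrow> rg s' r = rg s r"
  shows "filling off lst F s0 u A s'"
  using assms(1) unfolding filling_def ready_for_def assms(2-4) by (simp add: assms(5))

lemma filling_gap [simp]: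
  "filling off lst F s0 u A (s\<lparr>gap := g\<rparr>) = filling off lst F s0 u A s"
  by (simp add: filling_def ready_for_def)

lemma filling_rg [simp]:
  "r \<notin> {rW, rN, rNF, rDT, rOT, rC, rU, rY} \<Longrightarrow>
   filling off lst F s0 u A (s\<lparr>rg := f(r := x)\<rparr>) = filling off lst F s0 u A (s\<lparr>rg := f\<rparr>)"
  by (simp add: filling_def ready_for_def)

lemma filling_insert:
  assumes "filling off lst F s0 u A s" "off \<noteq> aST" "lst \<noteq> aST" "off \<noteq> lst" "v \<notin> A"
    "ar s' = (ar s)(aST := (ar s aST)(v := rg s rC), lst := (ar s lst)(rg s rY := v))"
    "emitted s' = emitted s" "worst s' = worst s" "rg s' rY = Suc (rg s rY)"
    "\<And>r. r \<in> {rW, rN, rNF, rDT, rOT, rC, rU} \<Longrightarrow> rg s' r = rg s r"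
  shows "filling off lst F s0 u (insert v A) s'"
proof -
  have "ar s off u \<le> rg s rY" using assms(1) by (simp add: filling_def enumerates_def)
  then have "table (ar s off) ((ar s lst)(rg s rY := v)) u (step_set F)"
    using assms(1) by (intro table_frame) (auto simp: filling_def)
  moreover have "enumerates ((ar s lst)(rg s rY := v)) (ar s off u) (Suc (rg s rY)) (insert v A)"
    using assms(1,5) by (intro enumerates_snoc) (auto simp: filling_def)
  ultimately show ?thesis
    using assms(1-4) unfolding filling_def ready_for_def assms(6-9)
    by (auto simp: assms(10))
qed

text \<open>
  The time bounds charge the loop counters: the node, the position in the offset table and the position
  in the data are all monotone, so skipped successor lists cost nothing extra.
\<close>

lemma wp_scan_prog:
  assumes fill: "filling off lst F s0 u A s" and arrays: "off \<noteq> aST" "lst \<noteq> aST" "off \<noteq> lst" "lst < 10"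
    and p: "rg s rP = p" "rg s rE = e" "p \<le> e" "e \<le> m" "rg s rY \<le> p"
  shows "wp inp w (scan_prog lst) (\<lambda>s'.
    filling off lst F s0 u (A \<union> (\<lambda>p. inp (dt + p)) ` {p..<e}) s' \<and> rg s' rY \<le> e \<and>
    rg s' rL = rg s rL \<and> rg s' rO = rg s rO \<and> gap s' \<le> gap s + 40 * (e - p) + 2) s"
proof -
  define I where "I s' \<longleftrightarrow> p \<le> rg s' rP \<and> rg s' rP \<le> e \<and> rg s' rE = e \<and>
    filling off lst F s0 u (A \<union> (\<lambda>p. inp (dt + p)) ` {p..<rg s' rP}) s' \<and> rg s' rY \<le> rg s' rP \<and>
    rg s' rL = rg s rL \<and> rg s' rO = rg s rO \<and> gap s' \<le> gap s + 40 * (rg s' rP - p)"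
    for s' :: sstate
  show ?thesis unfolding scan_prog_def
  proof (rule wp_While[where I = I and m = "\<lambda>s. e - rg s rP"])
    show "I s" using fill p by (simp add: I_def)
  next
    fix t assume I: "I t" and "cval t (CLess (Reg rP) (Reg rE))"
    then have c: "rg t rP < e" by (simp add: I_def)
    define v where "v = inp (dt + rg t rP)"
    let ?A = "A \<union> (\<lambda>p. inp (dt + p)) ` {p..<rg t rP}"
    have A: "A \<union> (\<lambda>p. inp (dt + p)) ` {p..<Suc (rg t rP)} = insert v ?A"
      using I by (auto simp: I_def v_def atLeastLessThanSuc)
    have fill: "filling off lst F s0 u ?A t" using I by (simp add: I_def)
    have r: "rg t rW = w" "rg t rDT = dt" "\<forall>v. ar t aST v \<le> rg t rC" "{v. ar t aST v = rg t rC} = ?A"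
      using fill by (auto simp: filling_def ready_for_def)
    then have st: "ar t aST v < rg t rC \<longleftrightarrow> v \<notin> ?A" by (metis (mono_tags) le_neq_implies_less mem_Collect_eq nat_neq_iff)
    have "dt + rg t rP < w" using c p by (simp add: w m_def)
    show "wp inp w (add rQ (Reg rDT) (Reg rP) ;; input rV (Reg rQ) ;; incr rP ;; load rX aST (Reg rV) ;;
        When (CLess (Reg rX) (Reg rC))
          (store aST (Reg rV) (Reg rC) ;; store lst (Reg rY) (Reg rV) ;; incr rY))
      (\<lambda>s'. I (tick 1 s') \<and> e - rg (tick 1 s') rP < e - rg t rP) (tick 1 t)"
    proof (cases "v \<in> ?A")
      case True
      then have "\<not> ar t aST v < rg t rC" using st by simp
      moreover have "insert v ?A = ?A" using True by blast
      ultimately show ?thesis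
        using I c r(1,2) \<open>dt + rg t rP < w\<close> fill
        by (simp add: I_def tick_def A v_def[symmetric] del: image_Un Un_insert_right)
          (intro conjI; arith)
    next
      case False
      then have "ar t aST v < rg t rC" using st by simp
      then show ?thesis
        using I c r(1,2) arrays \<open>dt + rg t rP < w\<close>
        by (simp add: I_def tick_def A v_def[symmetric] del: Un_insert_right)
          (intro conjI filling_insert[OF fill _ _ _ False]; (force | arith))
    qed
  next
    fix t assume I: "I t" and c: "\<not> cval t (CLess (Reg rP) (Reg rE))"
    then have "rg t rP = e" by (simp add: I_def)
    then show "filling off lst F s0 u (A \<union> (\<lambda>p. inp (dt + p)) ` {p..<e}) (tick 2 t) \<and>
      rg (tick 2 t) rY \<le> e \<and> rg (tick 2 t) rL = rg s rL \<and> rg (tick 2 t) rO = rg s rO \<and>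
      gap (tick 2 t) \<le> gap s + 40 * (e - p) + 2"
      using I by (simp add: I_def, simp add: tick_def)
  qed
qed

text \<open>Comparing \<open>rY\<close> with a data offset records that an entry is read before it
  is written. Over all rows this yields \<open>ar s' off n <= m\<close>, which keeps later scans of
  the table linear.\<close>

lemma wp_row_prog:
  assumes fill: "filling off lst F s0 u {} s"
    and arrays: "off \<noteq> aST" "lst \<noteq> aST" "off \<noteq> lst" "lst < 10"
      "fl < 10" "fl \<noteq> aST" "fl \<noteq> off" "fl \<noteq> lst"
    and flags: "\<And>l. ar s0 fl l = 1 \<longleftrightarrow> l \<in> F" and F: "F \<subseteq> {..<k}"
    and u: "u < n" "rg s rL = 0" "rg s rO = ot + u * k" "rg s rY \<le> inp (ot + u * k)"
    and g: "gap s \<le> g + 40 * (u * k) + 40 * inp (ot + u * k)"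
  shows "wp inp w (row_prog k fl lst) (\<lambda>s'.
    filling off lst F s0 u (step_set F u) s' \<and> rg s' rO = ot + Suc u * k \<and>
    rg s' rY \<le> inp (ot + Suc u * k) \<and>
    gap s' \<le> g + 40 * (Suc u * k) + 40 * inp (ot + Suc u * k) + 2) s"
proof -
  have uk: "Suc u * k \<le> n * k" using u(1) by (intro mult_le_mono1) simp
  define I where "I s' \<longleftrightarrow> rg s' rL \<le> k \<and> rg s' rO = ot + (u * k + rg s' rL) \<and>
    filling off lst F s0 u (\<Union>l\<in>F \<inter> {..<rg s' rL}. succs u l) s' \<and> rg s' rY \<le> inp (rg s' rO) \<and>
    gap s' \<le> g + 40 * (u * k + rg s' rL) + 40 * inp (rg s' rO)"
    for s' :: sstate
  show ?thesis unfolding row_prog_def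
  proof (rule wp_While[where I = I and m = "\<lambda>s. k - rg s rL"])
    show "I s" using fill u g by (simp add: I_def)
  next
    fix t assume I: "I t" and "cval t (CLess (Reg rL) (Imm k))"
    then have c: "rg t rL < k" by simp
    let ?l = "rg t rL"
    let ?A = "\<Union>l\<in>F \<inter> {..<?l}. succs u l"
    let ?p = "inp (ot + (u * k + ?l))"
    let ?e = "inp (Suc (ot + (u * k + ?l)))"
    have i: "u * k + ?l < n * k" using uk c by simp
    have pe: "?p \<le> ?e" "?e \<le> m" using offsets[OF i] offset_le[of "Suc (u * k + ?l)"] i by auto
    have w': "Suc (ot + (u * k + ?l)) < w" using i by (simp add: w dt)
    have t: "rg t rO = ot + (u * k + ?l)" "filling off lst F s0 u ?A t" "rg t rY \<le> ?p"
      "gap t \<le> g + 40 * (u * k + ?l) + 40 * ?p"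
      using I by (auto simp: I_def)
    have r: "rg t rW = w" "ar t fl = ar s0 fl" using t(2) arrays by (auto simp: filling_def ready_for_def)
    \<comment> \<open>Seven steps: two input reads, one increment and an array access of
      four.\<close>
    define t' where "t' = tick 7 (t\<lparr>rg := (rg t)(rP := ?p, rO := Suc (ot + (u * k + ?l)), rE := ?e,
      rF := ar s0 fl ?l)\<rparr>)"
    have fill': "filling off lst F s0 u ?A t'"
      by (rule filling_cong[OF t(2)]) (auto simp: t'_def tick_def)
    let ?Q = "\<lambda>s'. I (tick 1 s') \<and> k - rg (tick 1 s') rL < k - rg t rL"
    have "wp inp w (When (CEq (Reg rF) (Imm 1)) (scan_prog lst) ;; incr rL) ?Q (tick 1 t')"
    proof (cases "?l \<in> F")
      case True
      then have f: "ar s0 fl ?l = 1" using flags by simp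
      have A: "?A \<union> (\<lambda>p. inp (dt + p)) ` {?p..<?e} = (\<Union>l\<in>F \<inter> {..<Suc ?l}. succs u l)"
        using True by (auto simp: succs_def lessThan_Suc)
      have "wp inp w (scan_prog lst) (wp inp w (incr rL) ?Q) (tick 1 (tick 1 t'))"
      proof (rule wp_mono[OF wp_scan_prog[of off lst F s0 u ?A _ ?p ?e]])
        fix s'
        assume *: "filling off lst F s0 u (?A \<union> (\<lambda>p. inp (dt + p)) ` {?p..<?e}) s' \<and> rg s' rY \<le> ?e \<and>
          rg s' rL = rg (tick 1 (tick 1 t')) rL \<and> rg s' rO = rg (tick 1 (tick 1 t')) rO \<and>
          gap s' \<le> gap (tick 1 (tick 1 t')) + 40 * (?e - ?p) + 2"
        then have l: "rg s' rL = ?l" "rg s' rO = Suc (ot + (u * k + ?l))"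
          "gap s' \<le> gap t + 11 + 40 * (?e - ?p)" by (auto simp: t'_def tick_def)
        have "filling off lst F s0 u (\<Union>l\<in>F \<inter> {..<Suc ?l}. succs u l)
          (s'\<lparr>rg := (rg s')(rL := Suc ?l), gap := Suc (Suc (gap s'))\<rparr>)"
          using * unfolding A by (auto intro: filling_cong)
        then show "wp inp w (incr rL) ?Q s'"
          using * l t c pe by (auto simp: I_def tick_def)
      qed (use fill' arrays pe t in \<open>auto simp: t'_def tick_def\<close>)
      then show ?thesis using f by (simp add: t'_def tick_def)
    next
      case False
      then have f: "ar s0 fl ?l \<noteq> 1" using flags by simp
      have A: "(\<Union>l\<in>F \<inter> {..<Suc ?l}. succs u l) = ?A"
        using False by (auto simp: lessThan_Suc)
      have "filling off lst F s0 u ?A (t'\<lparr>rg := (rg t')(rL := Suc ?l), gap := gap'\<rparr>)" for gap'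
        by (rule filling_cong[OF fill']) auto
      then show ?thesis using f t c pe A by (auto simp: I_def tick_def t'_def)
    qed
    then show "wp inp w (input rP (Reg rO) ;; incr rO ;; input rE (Reg rO) ;; load rF fl (Reg rL) ;;
        When (CEq (Reg rF) (Imm 1)) (scan_prog lst) ;; incr rL) ?Q (tick 1 t)"
      using t r arrays w' by (simp add: t'_def tick_def add.commute)
  next
    fix t assume I: "I t" and c: "\<not> cval t (CLess (Reg rL) (Imm k))"
    then have l: "rg t rL = k" by (simp add: I_def)
    have "F \<inter> {..<k} = F" using F by blast
    show "filling off lst F s0 u (step_set F u) (tick 2 t) \<and> rg (tick 2 t) rO = ot + Suc u * k \<and>
      rg (tick 2 t) rY \<le> inp (ot + Suc u * k) \<and>
      gap (tick 2 t) \<le> g + 40 * (Suc u * k) + 40 * inp (ot + Suc u * k) + 2"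
    proof -
      have rO: "rg t rO = ot + Suc u * k" using I l by (simp add: I_def)
      show ?thesis using I l rO \<open>F \<inter> {..<k} = F\<close>
        by (simp add: I_def step_set_def, simp add: tick_def)
    qed
  qed
qed

lemma wp_table_prog:
  assumes s: "ready s" "\<forall>v. ar s aST v \<le> rg s rC"
    and arrays: "off < 10" "off \<noteq> aST" "lst \<noteq> aST" "off \<noteq> lst" "lst < 10"
      "fl < 10" "fl \<noteq> aST" "fl \<noteq> off" "fl \<noteq> lst"
    and flags: "\<And>l. ar s fl l = 1 \<longleftrightarrow> l \<in> F" and F: "F \<subseteq> {..<k}"
  shows "wp inp w (table_prog k fl off lst) (\<lambda>s'. ready s' \<and> (\<forall>v. ar s' aST v \<le> rg s' rC) \<and>
     (\<forall>j. j \<noteq> aST \<longrightarrow> j \<noteq> off \<longrightarrow> j \<noteq> lst \<longrightarrow> ar s' j = ar s j) \<and>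
     table (ar s' off) (ar s' lst) n (step_set F) \<and> ar s' off 0 = 0 \<and> ar s' off n \<le> m \<and>
     emitted s' = emitted s \<and> worst s' = worst s \<and>
     gap s' \<le> gap s + 40 * n + 40 * (n * k) + 40 * m + 10) s"
proof -
  define I where "I s' \<longleftrightarrow> ready s' \<and> (\<forall>v. ar s' aST v \<le> rg s' rC) \<and> rg s' rU \<le> n \<and>
     rg s' rO = ot + rg s' rU * k \<and> rg s' rY = ar s' off (rg s' rU) \<and> rg s' rY \<le> inp (rg s' rO) \<and>
     (\<forall>j. j \<noteq> aST \<longrightarrow> j \<noteq> off \<longrightarrow> j \<noteq> lst \<longrightarrow> ar s' j = ar s j) \<and>
     table (ar s' off) (ar s' lst) (rg s' rU) (step_set F) \<and> ar s' off 0 = 0 \<and>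
     emitted s' = emitted s \<and> worst s' = worst s \<and>
     gap s' \<le> gap s + 7 + 40 * rg s' rU + 40 * (rg s' rU * k) + 40 * inp (rg s' rO)"
    for s' :: sstate
  let ?body = "incr rC ;; move rL (Imm 0) ;; row_prog k fl lst ;; incr rU ;; store off (Reg rU) (Reg rY)"
  let ?Post = "\<lambda>s'. ready s' \<and> (\<forall>v. ar s' aST v \<le> rg s' rC) \<and>
     (\<forall>j. j \<noteq> aST \<longrightarrow> j \<noteq> off \<longrightarrow> j \<noteq> lst \<longrightarrow> ar s' j = ar s j) \<and>
     table (ar s' off) (ar s' lst) n (step_set F) \<and> ar s' off 0 = 0 \<and> ar s' off n \<le> m \<and>
     emitted s' = emitted s \<and> worst s' = worst s \<and>
     gap s' \<le> gap s + 40 * n + 40 * (n * k) + 40 * m + 10"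
  have loop: "wp inp w (While (CLess (Reg rU) (Reg rN)) ?body) ?Post t" if "I t" for t
  proof (rule wp_While[where I = I and m = "\<lambda>s. n - rg s rU"])
    fix t assume I: "I t" and "cval t (CLess (Reg rU) (Reg rN))"
    then have c: "rg t rU < n" by (simp add: I_def ready_for_def)
    let ?u = "rg t rU"
    let ?t = "tick 3 (t\<lparr>rg := (rg t)(rC := Suc (rg t rC), rL := 0)\<rparr>)"
    let ?Q = "\<lambda>s'. I (tick 1 s') \<and> n - rg (tick 1 s') rU < n - rg t rU"
    \<comment> \<open>All stamps are at most the old \<open>rC\<close>, so the incremented stamp
      marks nobody and the new row starts empty.\<close>
    have "ar t aST v \<noteq> Suc (rg t rC)" for v using I by (auto simp: I_def dest: spec[of _ v])
    then have "filling off lst F s ?u {} ?t"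
      using I by (auto simp: filling_def I_def ready_for_def tick_def le_Suc_eq)
    then have "wp inp w (row_prog k fl lst) (wp inp w (incr rU ;; store off (Reg rU) (Reg rY)) ?Q) ?t"
    proof (rule wp_mono[OF wp_row_prog[where g = "gap s + 10 + 40 * ?u"]])
      fix s' assume *: "filling off lst F s ?u (step_set F ?u) s' \<and> rg s' rO = ot + Suc ?u * k \<and>
        rg s' rY \<le> inp (ot + Suc ?u * k) \<and>
        gap s' \<le> gap s + 10 + 40 * ?u + 40 * (Suc ?u * k) + 40 * inp (ot + Suc ?u * k) + 2"
      then have "table ((ar s' off)(Suc ?u := rg s' rY)) (ar s' lst) (Suc ?u) (step_set F)"
        by (intro table_Suc) (auto simp: filling_def)
      then show "wp inp w (incr rU ;; store off (Reg rU) (Reg rY)) ?Q s'"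
        using * arrays c by (auto simp: I_def filling_def ready_for_def tick_def)
    qed (use I arrays flags F c in \<open>auto simp: I_def tick_def\<close>)
    then show "wp inp w ?body ?Q (tick 1 t)" by (simp add: tick_def numeral_3_eq_3)
  next
    fix t assume I: "I t" and c: "\<not> cval t (CLess (Reg rU) (Reg rN))"
    then have "rg t rU = n" by (simp add: I_def ready_for_def)
    then show "?Post (tick 2 t)" using I by (auto simp: I_def ready_for_def tick_def m_def)
  qed (rule that)
  show ?thesis unfolding table_prog_def wp_Seq wp_Basic
    using s arrays by (intro conjI loop) (auto simp: I_def ready_for_def table_def tick_def)
qed

end


section \<open>Nodes with answers\<close>

text \<open>
  \<open>b\<close> is the maximal length of a list \<open>Y (al q)\<close> for \<open>q\<close> in the scanned range, and unless \<open>b = 0\<close>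
  such a list starts at \<open>z\<close>.
\<close>

definition scanned :: "(nat \<Rightarrow> nat) \<Rightarrow> (nat \<Rightarrow> nat) \<Rightarrow> nat \<Rightarrow> nat \<Rightarrow> nat \<Rightarrow> nat \<Rightarrow> bool" where
  "scanned yo al a e b z \<longleftrightarrow>
     (\<forall>q\<in>{a..<e}. yo (Suc (al q)) - yo (al q) \<le> b) \<and>
     (b = 0 \<or> (\<exists>q\<in>{a..<e}. z = yo (al q) \<and> b = yo (Suc (al q)) - yo (al q)))"

text \<open>The strict order of \<open>act\<close> will give semi-sortedness and separate the
  answers of different nodes. By the last clause a node is left out only if all its lists
  \<open>Y z\<close> are empty.\<close>

definition active_list ::
  "(nat \<Rightarrow> nat) \<Rightarrow> (nat \<Rightarrow> nat) \<Rightarrow> (nat \<Rightarrow> nat) \<Rightarrow> nat \<Rightarrow> nat \<Rightarrow>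
   (nat \<Rightarrow> nat) \<Rightarrow> (nat \<Rightarrow> nat) \<Rightarrow> (nat \<Rightarrow> nat) \<Rightarrow> bool" where
  "active_list yo ao al u M act bst bd \<longleftrightarrow>
     (\<forall>i<M. act i < u \<and> 0 < bd i \<and>
        scanned yo al (ao (act i)) (ao (Suc (act i))) (bd i) (bst i)) \<and>
     (\<forall>j<M. \<forall>i<j. act i < act j) \<and>
     (\<forall>v<u. v \<in> act ` {..<M} \<or> (\<forall>q\<in>{ao v..<ao (Suc v)}. yo (Suc (al q)) \<le> yo (al q)))"

lemma active_list_skip:
  assumes "active_list yo ao al u M act bst bd" "scanned yo al (ao u) (ao (Suc u)) 0 z"
  shows "active_list yo ao al (Suc u) M act bst bd"
  using assms unfolding active_list_def scanned_def by (auto simp: less_Suc_eq)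

lemma active_list_add:
  assumes "active_list yo ao al u M act bst bd" "scanned yo al (ao u) (ao (Suc u)) b z" "0 < b"
  shows "active_list yo ao al (Suc u) (Suc M) (act(M := u)) (bst(M := z)) (bd(M := b))"
proof -
  have "(act(M := u)) ` {..<Suc M} = insert u (act ` {..<M})" by (auto simp: lessThan_Suc)
  then show ?thesis using assms unfolding active_list_def by (auto simp: less_Suc_eq)
qed

context stored_database
begin

lemma wp_best_prog:
  assumes "ready s" "rg s rP = a" "rg s rE = e" "a \<le> e" "rg s rB = 0"
  shows "wp inp w best_prog (\<lambda>s'. ready s' \<and> ar s' = ar s \<and> rg s' rC = rg s rC \<and>
    rg s' rU = rg s rU \<and> rg s' rM = rg s rM \<and> rg s' rP = e \<and>
    scanned (ar s aYO) (ar s aAL) a e (rg s' rB) (rg s' rZ) \<and>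
    emitted s' = emitted s \<and> worst s' = worst s \<and> gap s' \<le> gap s + 40 * (e - a) + 2) s"
proof -
  define I where "I s' \<longleftrightarrow> ready s' \<and> ar s' = ar s \<and> rg s' rC = rg s rC \<and>
    rg s' rU = rg s rU \<and> rg s' rM = rg s rM \<and> a \<le> rg s' rP \<and> rg s' rP \<le> e \<and> rg s' rE = e \<and>
    scanned (ar s aYO) (ar s aAL) a (rg s' rP) (rg s' rB) (rg s' rZ) \<and>
    emitted s' = emitted s \<and> worst s' = worst s \<and> gap s' \<le> gap s + 40 * (rg s' rP - a)"
    for s' :: sstate
  show ?thesis unfolding best_prog_def
  proof (rule wp_While[where I = I and m = "\<lambda>s. e - rg s rP"])
    show "I s" using assms by (simp add: I_def scanned_def)
  next
    fix t assume I: "I t" and "cval t (CLess (Reg rP) (Reg rE))"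
    then have c: "rg t rP < e" by (simp add: I_def)
    define d where "d = ar s aYO (Suc (ar s aAL (rg t rP))) - ar s aYO (ar s aAL (rg t rP))"
    have "scanned (ar s aYO) (ar s aAL) a (Suc (rg t rP)) d (ar s aYO (ar s aAL (rg t rP)))"
      if "rg t rB < d"
      using I that by (fastforce simp: I_def scanned_def d_def atLeastLessThanSuc)
    moreover have "scanned (ar s aYO) (ar s aAL) a (Suc (rg t rP)) (rg t rB) (rg t rZ)"
      if "\<not> rg t rB < d"
      using I that by (auto simp: I_def scanned_def d_def atLeastLessThanSuc)
    moreover have "gap t + 30 \<le> gap s + 40 * (Suc (rg t rP) - a)" using I by (auto simp: I_def Suc_diff_le)
    moreover have "e - Suc (rg t rP) < e - rg t rP" using c by simp
    ultimately show "wp inp w (load rV aAL (Reg rP) ;; incr rP ;; load rS aYO (Reg rV) ;; incr rV ;;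
        load rX aYO (Reg rV) ;; Basic (BArith Sub rX (Reg rX) (Reg rS)) ;;
        When (CLess (Reg rB) (Reg rX)) (move rB (Reg rX) ;; move rZ (Reg rS)))
      (\<lambda>s'. I (tick 1 s') \<and> e - rg (tick 1 s') rP < e - rg t rP) (tick 1 t)"
      using I c by (simp add: I_def ready_for_def tick_def d_def[symmetric])
  next
    fix t assume I: "I t" and c: "\<not> cval t (CLess (Reg rP) (Reg rE))"
    then have "rg t rP = e" by (simp add: I_def)
    then show "ready (tick 2 t) \<and> ar (tick 2 t) = ar s \<and> rg (tick 2 t) rC = rg s rC \<and>
    rg (tick 2 t) rU = rg s rU \<and> rg (tick 2 t) rM = rg s rM \<and> rg (tick 2 t) rP = e \<and>
    scanned (ar s aYO) (ar s aAL) a e (rg (tick 2 t) rB) (rg (tick 2 t) rZ) \<and>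
    emitted (tick 2 t) = emitted s \<and> worst (tick 2 t) = worst s \<and>
    gap (tick 2 t) \<le> gap s + 40 * (e - a) + 2"
      using I by (simp add: I_def ready_for_def tick_def)
  qed
qed

lemma wp_active_prog:
  assumes "ready s" "table (ar s aAO) (ar s aAL) n R" "ar s aAO 0 = 0"
  shows "wp inp w active_prog (\<lambda>s'. ready s' \<and>
    (\<forall>j. j \<noteq> aACT \<longrightarrow> j \<noteq> aBST \<longrightarrow> j \<noteq> aBD \<longrightarrow> ar s' j = ar s j) \<and> rg s' rC = rg s rC \<and>
    active_list (ar s aYO) (ar s aAO) (ar s aAL) n (rg s' rM) (ar s' aACT) (ar s' aBST) (ar s' aBD) \<and>
    emitted s' = emitted s \<and> worst s' = worst s \<and>
    gap s' \<le> gap s + 40 * n + 40 * ar s aAO n + 10) s"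
proof -
  define I where "I s' \<longleftrightarrow> ready s' \<and>
    (\<forall>j. j \<noteq> aACT \<longrightarrow> j \<noteq> aBST \<longrightarrow> j \<noteq> aBD \<longrightarrow> ar s' j = ar s j) \<and> rg s' rC = rg s rC \<and>
    rg s' rU \<le> n \<and> rg s' rP = ar s aAO (rg s' rU) \<and>
    active_list (ar s aYO) (ar s aAO) (ar s aAL) (rg s' rU) (rg s' rM) (ar s' aACT) (ar s' aBST) (ar s' aBD) \<and>
    emitted s' = emitted s \<and> worst s' = worst s \<and>
    gap s' \<le> gap s + 3 + 40 * rg s' rU + 40 * rg s' rP" for s' :: sstate
  let ?rest = "When (CLess (Imm 0) (Reg rB))
          (store aACT (Reg rM) (Reg rU) ;; store aBST (Reg rM) (Reg rZ) ;;
           store aBD (Reg rM) (Reg rB) ;; incr rM) ;; incr rU"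
  let ?body = "add rX (Reg rU) (Imm 1) ;; load rE aAO (Reg rX) ;; move rB (Imm 0) ;; best_prog ;; ?rest"
  let ?Post = "\<lambda>s'. ready s' \<and>
    (\<forall>j. j \<noteq> aACT \<longrightarrow> j \<noteq> aBST \<longrightarrow> j \<noteq> aBD \<longrightarrow> ar s' j = ar s j) \<and> rg s' rC = rg s rC \<and>
    active_list (ar s aYO) (ar s aAO) (ar s aAL) n (rg s' rM) (ar s' aACT) (ar s' aBST) (ar s' aBD) \<and>
    emitted s' = emitted s \<and> worst s' = worst s \<and>
    gap s' \<le> gap s + 40 * n + 40 * ar s aAO n + 10"
  have loop: "wp inp w (While (CLess (Reg rU) (Reg rN)) ?body) ?Post t" if "I t" for t
  proof (rule wp_While[where I = I and m = "\<lambda>s. n - rg s rU"])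
    fix t assume I: "I t" and "cval t (CLess (Reg rU) (Reg rN))"
    then have c: "rg t rU < n" by (simp add: I_def ready_for_def)
    let ?u = "rg t rU"
    let ?t = "tick 7 (t\<lparr>rg := (rg t)(rX := Suc ?u, rE := ar s aAO (Suc ?u), rB := 0)\<rparr>)"
    let ?Q = "\<lambda>s'. I (tick 1 s') \<and> n - rg (tick 1 s') rU < n - rg t rU"
    have mono: "ar s aAO ?u \<le> ar s aAO (Suc ?u)"
      using table_mono[OF assms(2), of ?u "Suc ?u"] c by simp
    have "wp inp w best_prog (wp inp w ?rest ?Q) ?t"
    proof (rule wp_mono[OF wp_best_prog[where a = "ar s aAO ?u" and e = "ar s aAO (Suc ?u)"]])
      fix s'
      assume *: "ready s' \<and> ar s' = ar ?t \<and> rg s' rC = rg ?t rC \<and>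
        rg s' rU = rg ?t rU \<and> rg s' rM = rg ?t rM \<and> rg s' rP = ar s aAO (Suc ?u) \<and>
        scanned (ar ?t aYO) (ar ?t aAL) (ar s aAO ?u) (ar s aAO (Suc ?u)) (rg s' rB) (rg s' rZ) \<and>
        emitted s' = emitted ?t \<and> worst s' = worst ?t \<and>
        gap s' \<le> gap ?t + 40 * (ar s aAO (Suc ?u) - ar s aAO ?u) + 2"
      have act: "active_list (ar s aYO) (ar s aAO) (ar s aAL) ?u (rg t rM) (ar t aACT) (ar t aBST) (ar t aBD)"
        using I by (simp add: I_def)
      have sc: "scanned (ar s aYO) (ar s aAL) (ar s aAO ?u) (ar s aAO (Suc ?u)) (rg s' rB) (rg s' rZ)"
        using * I by (simp add: I_def tick_def)
      have g: "gap s' + 20 \<le> gap s + 3 + 40 * Suc ?u + 40 * ar s aAO (Suc ?u)"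
        using * I mono by (auto simp: I_def tick_def)
      show "wp inp w ?rest ?Q s'"
      proof (cases "rg s' rB = 0")
        case True
        then show ?thesis using * I c g active_list_skip[OF act, of "rg s' rZ"] sc
          by (simp add: I_def ready_for_def tick_def)
      next
        case False
        then show ?thesis using * I c g active_list_add[OF act sc]
          by (simp add: I_def ready_for_def tick_def)
      qed
    qed (use I c mono in \<open>auto simp: I_def ready_for_def tick_def\<close>)
    then show "wp inp w ?body ?Q (tick 1 t)" using I by (simp add: tick_def I_def ready_for_def eval_nat_numeral)
  next
    fix t assume I: "I t" and c: "\<not> cval t (CLess (Reg rU) (Reg rN))"
    then have "rg t rU = n" by (simp add: I_def ready_for_def)
    then show "?Post (tick 2 t)" using I by (auto simp: I_def ready_for_def tick_def)
  qed (rule that)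
  show ?thesis unfolding active_prog_def wp_Seq wp_Basic
    using assms by (intro conjI loop) (auto simp: I_def ready_for_def active_list_def tick_def)
qed

text \<open>Singleton rows make a one-factor query a composition with the identity, so both shapes
  share one enumeration.\<close>

definition second_rows :: "nat \<Rightarrow> nat set" where
  "second_rows = (if nf = 2 then step_set F2 else (\<lambda>z. {z}))"

definition prepared :: "sstate \<Rightarrow> bool" where
  "prepared s \<longleftrightarrow> ready s \<and> (\<forall>v. ar s aST v \<le> rg s rC) \<and>
     table (ar s aYO) (ar s aYL) n second_rows \<and>
     table (ar s aAO) (ar s aAL) n (step_set F1) \<and>
     active_list (ar s aYO) (ar s aAO) (ar s aAL) n (rg s rM) (ar s aACT) (ar s aBST) (ar s aBD)"

lemma wp_pre_prog:
  fixes s :: sstate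
  assumes "rg s = (\<lambda>_. 0)" "ar s = (\<lambda>_ _. 0)" "emitted s = []" "gap s = 0" "worst s = 0"
  shows "wp inp w (pre_prog k) (\<lambda>s'. prepared s' \<and> emitted s' = [] \<and>
    gap s' \<le> 200 * (n + n * k + m + ot + 1)) s"
proof -
  let ?R = "\<lambda>s'. prepared s' \<and> emitted s' = [] \<and> gap s' \<le> 200 * (n + n * k + m + ot + 1)"
  \<comment> \<open>What either branch of the conditional on the second factor guarantees; the bound
    on \<open>gap\<close> sums those of the programs run so far.\<close>
  define Y where "Y t \<longleftrightarrow> ready t \<and> (\<forall>v. ar t aST v \<le> rg t rC) \<and>
    (\<forall>l. ar t aFL1 l = 1 \<longleftrightarrow> l \<in> F1) \<and> table (ar t aYO) (ar t aYL) n second_rows \<and>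
    emitted t = [] \<and> gap t \<le> 80 + 20 * ot + 60 * n + 40 * (n * k) + 40 * m" for t :: sstate
  have tables: "wp inp w (table_prog k aFL1 aAO aAL ;; active_prog) ?R t" if "Y t" for t
    unfolding wp_Seq
  proof (rule wp_mono[OF wp_table_prog[where F = F1]], goal_cases)
    case (14 t1)
    then have t1: "ready t1" "\<forall>v. ar t1 aST v \<le> rg t1 rC" "table (ar t1 aYO) (ar t1 aYL) n second_rows"
      "emitted t1 = []" "table (ar t1 aAO) (ar t1 aAL) n (step_set F1)" "ar t1 aAO 0 = 0"
      "ar t1 aAO n \<le> m" "gap t1 \<le> 90 + 20 * ot + 100 * n + 80 * (n * k) + 80 * m"
      using that by (simp_all add: Y_def)
    show ?case
    proof (rule wp_mono[OF wp_active_prog[OF t1(1,5,6)]])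
    qed (use t1 in \<open>auto simp: prepared_def\<close>)
  qed (use that letters in \<open>auto simp: Y_def\<close>)
  have ids: "wp inp w (identity_prog ;; When (CEq (Reg rNF) (Imm 2)) (table_prog k aFL2 aYO aYL) ;;
     table_prog k aFL1 aAO aAL ;; active_prog) ?R t"
    if t: "ready t" "rg t rC = 0" "\<forall>l. ar t aFL1 l = 1 \<longleftrightarrow> l \<in> F1"
      "nf = 2 \<longrightarrow> (\<forall>l. ar t aFL2 l = 1 \<longleftrightarrow> l \<in> F2)"
      "\<forall>v. ar t aST v = 0" "emitted t = []" "gap t \<le> 30 + 20 * ot + 10" for t
    unfolding wp_Seq[of _ _ identity_prog]
  proof (rule wp_mono[OF wp_identity_prog[OF t(1)]])
    fix t1
    assume "ready t1 \<and> rg t1 rC = rg t rC \<and>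
     (\<forall>j. j \<noteq> aYO \<longrightarrow> j \<noteq> aYL \<longrightarrow> ar t1 j = ar t j) \<and>
     table (ar t1 aYO) (ar t1 aYL) n (\<lambda>u. {u}) \<and> emitted t1 = emitted t \<and> worst t1 = worst t \<and>
     gap t1 \<le> gap t + 20 * n + 10"
    then have t1: "ready t1" "rg t1 rC = 0" "\<forall>l. ar t1 aFL1 l = 1 \<longleftrightarrow> l \<in> F1"
      "nf = 2 \<longrightarrow> (\<forall>l. ar t1 aFL2 l = 1 \<longleftrightarrow> l \<in> F2)" "\<forall>v. ar t1 aST v = 0" "emitted t1 = []"
      "gap t1 \<le> 50 + 20 * ot + 20 * n" "table (ar t1 aYO) (ar t1 aYL) n (\<lambda>u. {u})"
      using t by simp_all
    have "wp inp w (When (CEq (Reg rNF) (Imm 2)) (table_prog k aFL2 aYO aYL)) Y t1"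
    proof (cases "nf = 2")
      case True
      have sr: "second_rows = step_set F2" unfolding second_rows_def using True by simp
      have f2: "\<forall>l. ar t1 aFL2 l = 1 \<longleftrightarrow> l \<in> F2" using t1(4) True by blast
      have "ready (tick 1 t1)" using t1(1) by (simp add: ready_for_def tick_def)
      have "wp inp w (table_prog k aFL2 aYO aYL) Y (tick 1 t1)"
      proof (rule wp_mono[OF wp_table_prog[where F = F2]])
      qed (use \<open>ready (tick 1 t1)\<close> f2 t1(2,3,5-7) letters in \<open>simp_all add: Y_def sr, simp_all add: tick_def\<close>)
      then show ?thesis using t1(1) True by (simp add: ready_for_def)
    next
      case False
      then show ?thesis using t1
        by (simp add: ready_for_def Y_def second_rows_def tick_def)
    qed
    then show "wp inp w (When (CEq (Reg rNF) (Imm 2)) (table_prog k aFL2 aYO aYL) ;;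
     table_prog k aFL1 aAO aAL ;; active_prog) ?R t1"
      unfolding wp_Seq[of _ _ "When _ _"] by (rule wp_mono) (rule tables)
  qed
  show ?thesis unfolding pre_prog_def wp_Seq[of _ _ "query_prog k"] wp_Seq[of _ _ flags_prog]
  proof (rule wp_mono[OF wp_query_prog[OF assms(4,1)]])
    fix t
    assume t: "ready t \<and> rg t rC = 0 \<and> ar t = ar s \<and>
      emitted t = emitted s \<and> worst t = worst s \<and> gap t \<le> 30 \<and> rg t rP = 3 \<and> rg t rE = 3 + k1"
    show "wp inp w flags_prog (wp inp w (identity_prog ;;
       When (CEq (Reg rNF) (Imm 2)) (table_prog k aFL2 aYO aYL) ;;
       table_prog k aFL1 aAO aAL ;; active_prog) ?R) t"
    proof (rule wp_mono[OF wp_flags_prog])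
      fix t'
      assume "ready t' \<and> rg t' rC = 0 \<and>
       (\<forall>l. ar t' aFL1 l = 1 \<longleftrightarrow> l \<in> F1) \<and> (nf = 2 \<longrightarrow> (\<forall>l. ar t' aFL2 l = 1 \<longleftrightarrow> l \<in> F2)) \<and>
       (\<forall>v. ar t' aST v = 0) \<and> emitted t' = emitted t \<and> worst t' = worst t \<and>
       gap t' \<le> gap t + 20 * ot + 10"
      then show "wp inp w (identity_prog ;; When (CEq (Reg rNF) (Imm 2)) (table_prog k aFL2 aYO aYL) ;;
         table_prog k aFL1 aAO aAL ;; active_prog) ?R t'"
        using t assms(3) by (intro ids) auto
    qed (use t assms(2) in auto)
  qed
qed

end


section \<open>Enumeration by columns\<close>

text \<open>The arrays left by preprocessing are fixed as functions, since enumeration changes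
  nothing but the stamps. \<open>dl\<close> stands for the degree; its positivity absorbs additive
  constants.\<close>

locale prepared_database = stored_database +
  fixes yo yl ao al act bst bd :: "nat \<Rightarrow> nat" and M dl :: nat
  assumes second: "table yo yl n second_rows" and first: "table ao al n (step_set F1)"
    and active: "active_list yo ao al n M act bst bd"
    and dl_first: "\<And>u. u < n \<Longrightarrow> card (step_set F1 u) \<le> dl"
    and dl_second: "\<And>u. u < n \<Longrightarrow> card (second_rows u) \<le> dl"
    and dl_pos: "0 < dl"
begin

definition kept :: "sstate \<Rightarrow> bool" where
  "kept s \<longleftrightarrow> ready s \<and> (\<forall>v. ar s aST v \<le> rg s rC) \<and> ar s aYO = yo \<and> ar s aYL = yl \<and>
     ar s aAO = ao \<and> ar s aAL = al \<and> ar s aACT = act \<and> ar s aBST = bst \<and> ar s aBD = bd \<and>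
     rg s rM = M"

text \<open>
  \<open>S\<close> is the reserved list \<open>Y z*\<close>, and \<open>X\<close> the set of targets already output for \<open>u\<close> after the outputs \<open>es\<close>
  for earlier nodes.
\<close>

definition listing ::
  "(nat \<times> nat) list \<Rightarrow> nat set \<Rightarrow> nat \<Rightarrow> nat set \<Rightarrow> sstate \<Rightarrow> bool" where
  "listing es S u X s \<longleftrightarrow> kept s \<and> rg s rU = u \<and> {v. ar s aST v = rg s rC} = S \<union> X \<and>
     (\<exists>xs. emitted s = es @ map (Pair u) xs \<and> distinct xs \<and> set xs = X)"

lemma listing_gap [simp]: "listing es S u X (s\<lparr>gap := g\<rparr>) = listing es S u X s"
  by (simp add: listing_def kept_def ready_for_def)

lemma listing_worst [simp]: "listing es S u X (s\<lparr>worst := g\<rparr>) = listing es S u X s"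
  by (simp add: listing_def kept_def ready_for_def)

lemma listing_rg [simp]:
  "r \<notin> {rW, rN, rNF, rDT, rOT, rC, rU, rM} \<Longrightarrow>
   listing es S u X (s\<lparr>rg := f(r := x)\<rparr>) = listing es S u X (s\<lparr>rg := f\<rparr>)"
  by (simp add: listing_def kept_def ready_for_def)

lemma listing_kept:
  "listing es S u X s \<Longrightarrow> rg s rW = w \<and> ar s aYO = yo \<and> ar s aYL = yl \<and>
     ar s aAO = ao \<and> ar s aAL = al \<and> rg s rU = u"
  by (simp add: listing_def kept_def ready_for_def)

text \<open>A reserved target is already marked, so only the output list grows.\<close>

lemma listing_emit:
  assumes "listing es S u X s" "v \<in> S" "v \<notin> X"
  shows "listing es S u (insert v X) (s\<lparr>emitted := emitted s @ [(u, v)]\<rparr>)"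
proof -
  obtain xs where "emitted s = es @ map (Pair u) xs" "distinct xs" "set xs = X"
    using assms(1) by (auto simp: listing_def)
  then have "\<exists>ys. emitted s @ [(u, v)] = es @ map (Pair u) ys \<and> distinct ys \<and> set ys = insert v X"
    using assms(3) by (intro exI[of _ "xs @ [v]"]) auto
  moreover have "S \<union> insert v X = S \<union> X" using assms(2) by blast
  ultimately show ?thesis using assms(1) unfolding listing_def kept_def ready_for_def by simp
qed

lemma listing_mark:
  assumes "listing es S u X s" "v \<notin> S \<union> X"
  shows "listing es S u (insert v X) (s\<lparr>ar := (ar s)(aST := (ar s aST)(v := rg s rC)),
    emitted := emitted s @ [(u, v)]\<rparr>)"
proof -
  obtain xs where "emitted s = es @ map (Pair u) xs" "distinct xs" "set xs = X"
    using assms(1) by (auto simp: listing_def)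
  then have "\<exists>ys. emitted s @ [(u, v)] = es @ map (Pair u) ys \<and> distinct ys \<and> set ys = insert v X"
    using assms(2) by (intro exI[of _ "xs @ [v]"]) auto
  moreover have "{v'. ((ar s aST)(v := rg s rC)) v' = rg s rC} = S \<union> insert v X"
    using assms(1) by (auto simp: listing_def)
  ultimately show ?thesis using assms(1) unfolding listing_def kept_def ready_for_def by simp
qed

text \<open>Column \<open>j\<close> of the overview, cut to a range of the lists.\<close>

definition column_part :: "nat \<Rightarrow> nat \<Rightarrow> nat \<Rightarrow> nat set" where
  "column_part j a e = {yl (yo (al q) + j) | q. q \<in> {a..<e} \<and> yo (al q) + j < yo (Suc (al q))}"

lemma column_part_Suc:
  "a \<le> p \<Longrightarrow> column_part j a (Suc p) = column_part j a p \<union>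
     (if yo (al p) + j < yo (Suc (al p)) then {yl (yo (al p) + j)} else {})"
  by (auto simp: column_part_def less_Suc_eq)

text \<open>Whether a list contributes is not predictable, but the bound on \<open>gap\<close> holds
  in any case: an output resets it, and otherwise each list adds at most 40. The last hypothesis
  leaves room for an output at the very end. Reserved targets are marked, hence the difference with
  \<open>S\<close>.\<close>

lemma wp_column_prog:
  assumes l: "listing es S u X s" and p: "rg s rP = a" "rg s rE = e" "a \<le> e"
    and g: "gap s \<le> g" "worst s \<le> D" "g + 40 * (e - a) + 40 \<le> D"
  shows "wp inp w column_prog (\<lambda>s'. listing es S u (X \<union> (column_part (rg s rJ) a e - S)) s' \<and>
    (\<forall>r\<in>{rI, rJ, rZ, rB}. rg s' r = rg s r) \<and> gap s' \<le> g + 40 * (e - a) + 2 \<and> worst s' \<le> D) s"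
proof -
  define j where "j = rg s rJ"
  define I where "I s' \<longleftrightarrow> a \<le> rg s' rP \<and> rg s' rP \<le> e \<and> rg s' rE = e \<and>
    listing es S u (X \<union> (column_part j a (rg s' rP) - S)) s' \<and>
    rg s' rJ = j \<and> (\<forall>r\<in>{rI, rZ, rB}. rg s' r = rg s r) \<and> gap s' \<le> g + 40 * (rg s' rP - a) \<and> worst s' \<le> D"
    for s' :: sstate
  show ?thesis unfolding column_prog_def
  proof (rule wp_While[where I = I and m = "\<lambda>s. e - rg s rP"])
    show "I s" using assms by (simp add: I_def j_def column_part_def)
  next
    fix t assume I: "I t" and "cval t (CLess (Reg rP) (Reg rE))"
    then have c: "rg t rP < e" by (simp add: I_def)
    let ?p = "rg t rP"
    let ?X = "X \<union> (column_part j a ?p - S)"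
    define q where "q = yo (al ?p) + j"
    define z where "z = Suc (al ?p)"
    have li: "listing es S u ?X t" using I by (simp add: I_def)
    note r = listing_kept[OF li]
    have rj: "rg t rJ = j" using I by (simp add: I_def j_def)
    have ap: "a \<le> ?p" using I by (simp add: I_def)
    have gp: "gap t + 40 \<le> D" "gap t + 36 \<le> g + 40 * (Suc ?p - a)" "worst t \<le> D"
      using I c g by (auto simp: I_def Suc_diff_le)
    have dec: "e - Suc ?p < e - ?p" using c by simp
    let ?Q = "\<lambda>s'. I (tick 1 s') \<and> e - rg (tick 1 s') rP < e - rg t rP"
    have I': "(\<forall>r\<in>{rI, rZ, rB}. rg t r = rg s r)" "rg t rE = e" using I by (auto simp: I_def)
    have X: "X \<union> (column_part j a (Suc ?p) - S) = (if q < yo z \<and> yl q \<notin> S then insert (yl q) ?X else ?X)"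
      unfolding column_part_Suc[OF ap] q_def z_def by auto
    show "wp inp w (load rV aAL (Reg rP) ;; incr rP ;; load rS aYO (Reg rV) ;;
        add rK (Reg rS) (Reg rJ) ;; incr rV ;; load rX aYO (Reg rV) ;;
        When (CLess (Reg rK) (Reg rX))
          (load rV aYL (Reg rK) ;; load rX aST (Reg rV) ;;
           When (CLess (Reg rX) (Reg rC))
             (store aST (Reg rV) (Reg rC) ;; Basic (BOut (Reg rU) (Reg rV))))) ?Q (tick 1 t)"
    proof (cases "q < yo z")
      case False
      then have "X \<union> (column_part j a (Suc ?p) - S) = ?X" using X by simp
      then show ?thesis using False I' li gp c ap dec r rj
        by (simp add: I_def tick_def q_def[symmetric] z_def[symmetric])
    next
      case q: True
      have st: "ar t aST v < rg t rC \<longleftrightarrow> v \<notin> S \<union> ?X" for v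
        using li unfolding listing_def kept_def
        by (metis (mono_tags, lifting) le_neq_implies_less mem_Collect_eq nat_neq_iff)
      show ?thesis
      proof (cases "yl q \<in> S \<union> ?X")
        case True
        then have "X \<union> (column_part j a (Suc ?p) - S) = ?X" using X by auto
        moreover have "\<not> ar t aST (yl q) < rg t rC" using st True by blast
        ultimately show ?thesis using q I' li gp c ap dec r rj
          by (simp add: I_def tick_def q_def[symmetric] z_def[symmetric])
      next
        case False
        then have "X \<union> (column_part j a (Suc ?p) - S) = insert (yl q) ?X" using X q by auto
        moreover have "ar t aST (yl q) < rg t rC" using st False by blast
        moreover note listing_mark[OF li False]
        ultimately show ?thesis using q I' gp c ap dec r rj
          by (simp add: I_def tick_def q_def[symmetric] z_def[symmetric], simp add: listing_def kept_def ready_for_def)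
      qed
    qed
  next
    fix t assume I: "I t" and c: "\<not> cval t (CLess (Reg rP) (Reg rE))"
    then have "rg t rP = e" by (simp add: I_def)
    then show "listing es S u (X \<union> (column_part (rg s rJ) a e - S)) (tick 2 t) \<and>
      (\<forall>r\<in>{rI, rJ, rZ, rB}. rg (tick 2 t) r = rg s r) \<and> gap (tick 2 t) \<le> g + 40 * (e - a) + 2 \<and>
      worst (tick 2 t) \<le> D"
      using I by (simp add: I_def tick_def j_def)
  qed
qed

lemma listing_reserve:
  assumes "listing es S u {} s"
  shows "listing es (insert v S) u {} (s\<lparr>ar := (ar s)(aST := (ar s aST)(v := rg s rC))\<rparr>)"
proof -
  have "{v'. ((ar s aST)(v := rg s rC)) v' = rg s rC} = insert v S"
    using assms by (auto simp: listing_def)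
  then show ?thesis using assms unfolding listing_def kept_def ready_for_def by simp
qed

lemma wp_reserve_prog:
  assumes l: "listing es {} u {} s" and p: "rg s rP = b" "rg s rE = e" "b \<le> e"
  shows "wp inp w reserve_prog (\<lambda>s'. listing es (yl ` {b..<e}) u {} s' \<and>
    (\<forall>r\<in>{rI, rJ, rZ, rB}. rg s' r = rg s r) \<and> gap s' \<le> gap s + 20 * (e - b) + 2 \<and>
    worst s' = worst s) s"
proof -
  define I where "I s' \<longleftrightarrow> b \<le> rg s' rP \<and> rg s' rP \<le> e \<and> rg s' rE = e \<and>
    listing es (yl ` {b..<rg s' rP}) u {} s' \<and>
    (\<forall>r\<in>{rI, rJ, rZ, rB}. rg s' r = rg s r) \<and> gap s' \<le> gap s + 20 * (rg s' rP - b) \<and>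
    worst s' = worst s"
    for s' :: sstate
  show ?thesis unfolding reserve_prog_def
  proof (rule wp_While[where I = I and m = "\<lambda>s. e - rg s rP"])
    show "I s" using assms by (simp add: I_def)
  next
    fix t assume I: "I t" and "cval t (CLess (Reg rP) (Reg rE))"
    then have c: "rg t rP < e" by (simp add: I_def)
    let ?p = "rg t rP"
    have li: "listing es (yl ` {b..<?p}) u {} t" using I by (simp add: I_def)
    note r = listing_kept[OF li]
    have "yl ` {b..<Suc ?p} = insert (yl ?p) (yl ` {b..<?p})"
      using I by (auto simp: I_def atLeastLessThanSuc)
    moreover note listing_reserve[OF li, of "yl ?p"]
    moreover have "gap t + 15 \<le> gap s + 20 * (Suc ?p - b)" using I by (auto simp: I_def Suc_diff_le)
    moreover have "e - Suc ?p < e - ?p" using c by simp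
    ultimately show "wp inp w (load rV aYL (Reg rP) ;; store aST (Reg rV) (Reg rC) ;; incr rP)
      (\<lambda>s'. I (tick 1 s') \<and> e - rg (tick 1 s') rP < e - rg t rP) (tick 1 t)"
      using I c r by (simp add: I_def tick_def)
  next
    fix t assume I: "I t" and c: "\<not> cval t (CLess (Reg rP) (Reg rE))"
    then have "rg t rP = e" by (simp add: I_def)
    then show "listing es (yl ` {b..<e}) u {} (tick 2 t) \<and>
      (\<forall>r\<in>{rI, rJ, rZ, rB}. rg (tick 2 t) r = rg s r) \<and> gap (tick 2 t) \<le> gap s + 20 * (e - b) + 2 \<and>
      worst (tick 2 t) = worst s"
      using I by (simp add: I_def tick_def)
  qed
qed

text \<open>Each column opens with a reserved target that was not output before, so silence lasts
  for at most one column, apart from the reservation preceding the first.\<close>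

lemma wp_source_prog:
  assumes inj: "inj_on yl {b..<b + d}" and S: "S = yl ` {b..<b + d}"
    and ae: "a = ao u" "e = ao (Suc u)" "a \<le> e" "e - a \<le> dl"
    and s: "listing es S u {} s" "rg s rJ = 0" "rg s rZ = b" "rg s rB = d"
    and g: "0 < d" "gap s \<le> 120 * dl" "worst s \<le> 200 * dl"
  shows "wp inp w source_prog (\<lambda>s'. listing es S u (S \<union> (\<Union>j<d. column_part j a e)) s' \<and>
    rg s' rI = rg s rI \<and> gap s' \<le> 40 * dl + 32 \<and> worst s' \<le> 200 * dl) s"
proof -
  \<comment> \<open>After \<open>j\<close> columns: the first \<open>j\<close> reserved targets, and
    the unreserved ones of these columns.\<close>
  define X where "X j = yl ` {b..<b + j} \<union> ((\<Union>j'<j. column_part j' a e) - S)" for j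
  \<comment> \<open>Only before the first column may \<open>gap\<close> contain the reservation;
    later it is at most what follows the output opening the previous column. At the exit
    \<open>0 < d\<close> rules out the first case.\<close>
  define I where "I s' \<longleftrightarrow> (rg s' rJ = 0 \<or> gap s' \<le> 40 * dl + 30) \<and> gap s' \<le> 120 * dl \<and>
    rg s' rJ \<le> d \<and> rg s' rZ = b \<and> rg s' rB = d \<and> rg s' rI = rg s rI \<and> worst s' \<le> 200 * dl \<and>
    listing es S u (X (rg s' rJ)) s'" for s' :: sstate
  let ?body = "add rK (Reg rZ) (Reg rJ) ;; load rV aYL (Reg rK) ;; Basic (BOut (Reg rU) (Reg rV)) ;;
        load rP aAO (Reg rU) ;; add rX (Reg rU) (Imm 1) ;; load rE aAO (Reg rX) ;;
        column_prog ;; incr rJ"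
  show ?thesis unfolding source_prog_def
  proof (rule wp_While[where I = I and m = "\<lambda>s. d - rg s rJ"])
    show "I s" using s g by (simp add: I_def X_def)
  next
    fix t assume I: "I t" and "cval t (CLess (Reg rJ) (Reg rB))"
    then have c: "rg t rJ < d" by (simp add: I_def)
    define j where "j = rg t rJ"
    let ?Q = "\<lambda>s'. I (tick 1 s') \<and> d - rg (tick 1 s') rJ < d - rg t rJ"
    have li: "listing es S u (X j) t" using I by (simp add: I_def j_def)
    note r = listing_kept[OF li]
    let ?v = "yl (b + j)"
    have "?v \<in> S" using c S by (simp add: j_def)
    moreover have "?v \<notin> yl ` {b..<b + j}"
      using inj c unfolding inj_on_def j_def by fastforce
    ultimately have v: "?v \<in> S" "?v \<notin> X j" by (auto simp: X_def)
    have X: "insert ?v (X j) \<union> (column_part j a e - S) = X (Suc j)"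
      by (auto simp: X_def lessThan_Suc atLeastLessThanSuc)
    \<comment> \<open>Loop test, addition, load and output take 7 steps; two loads and an addition
      after the output take 9.\<close>
    let ?t = "t\<lparr>emitted := emitted t @ [(u, ?v)], worst := max (worst t) (7 + gap t),
      rg := (rg t)(rK := b + j, rV := ?v, rP := a, rX := Suc u, rE := e), gap := 9\<rparr>"
    have li': "listing es S u (insert ?v (X j)) ?t"
      using listing_emit[OF li v] by (simp add: listing_def kept_def ready_for_def)
    have g': "gap t + 7 \<le> 200 * dl" "20 + 40 * (e - a) + 40 \<le> 200 * dl" "40 * (e - a) \<le> 40 * dl"
      "40 * dl + 30 \<le> 120 * dl" "worst t \<le> 200 * dl"
      using I dl_pos ae(4) by (auto simp: I_def)
    have "wp inp w column_prog (wp inp w (incr rJ) ?Q) ?t"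
    proof (rule wp_mono[OF wp_column_prog[OF li', of a e 20 "200 * dl"]])
      fix s'
      assume *: "listing es S u (insert ?v (X j) \<union> (column_part (rg ?t rJ) a e - S)) s' \<and>
        (\<forall>r\<in>{rI, rJ, rZ, rB}. rg s' r = rg ?t r) \<and> gap s' \<le> 20 + 40 * (e - a) + 2 \<and>
        worst s' \<le> 200 * dl"
      then have "listing es S u (X (Suc j)) s'" using X by (simp add: j_def[symmetric])
      then show "wp inp w (incr rJ) ?Q s'"
        using * I g' c by (simp add: I_def tick_def j_def)
    qed (use g' ae(3) in auto)
    then show "wp inp w ?body ?Q (tick 1 t)"
      using I r ae by (simp add: tick_def I_def j_def fun_upd_twist)
  next
    fix t assume I: "I t" and c: "\<not> cval t (CLess (Reg rJ) (Reg rB))"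
    then have j: "rg t rJ = d" by (simp add: I_def)
    then have "X (rg t rJ) = S \<union> (\<Union>j<d. column_part j a e)" by (auto simp: X_def S)
    then show "listing es S u (S \<union> (\<Union>j<d. column_part j a e)) (tick 2 t) \<and>
      rg (tick 2 t) rI = rg s rI \<and> gap (tick 2 t) \<le> 40 * dl + 32 \<and> worst (tick 2 t) \<le> 200 * dl"
      using I j g by (simp add: I_def tick_def)
  qed
qed

section \<open>The columns cover all answers of a node\<close>

definition targets :: "nat \<Rightarrow> nat set" where
  "targets u = (\<Union>z\<in>step_set F1 u. second_rows z)"

lemma succs_subset:
  assumes "u < n" "l < k"
  shows "succs u l \<subseteq> {..<n}"
proof -
  have "Suc u * k \<le> n * k" using assms(1) by (intro mult_le_mono1) simp
  then have "inp (ot + Suc (u * k + l)) \<le> m" using assms(2) by (intro offset_le) simp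
  then show ?thesis using entries by (auto simp: succs_def m_def)
qed

lemma first_row:
  assumes "u < n"
  shows "ao u \<le> ao (Suc u)" "al ` {ao u..<ao (Suc u)} = step_set F1 u" "ao (Suc u) - ao u \<le> dl"
    "q \<in> {ao u..<ao (Suc u)} \<Longrightarrow> al q < n"
proof -
  have *: "enumerates al (ao u) (ao (Suc u)) (step_set F1 u)" using first assms by (simp add: table_def)
  then show "ao u \<le> ao (Suc u)" and im: "al ` {ao u..<ao (Suc u)} = step_set F1 u"
    by (auto simp: enumerates_def)
  show "ao (Suc u) - ao u \<le> dl" using enumerates_card[OF *] dl_first[OF assms] by simp
  have "step_set F1 u \<subseteq> {..<n}" using succs_subset[OF assms] letters(1) by (auto simp: step_set_def)
  then show "q \<in> {ao u..<ao (Suc u)} \<Longrightarrow> al q < n" using im by blast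
qed

lemma second_row:
  assumes "z < n"
  shows "yo z \<le> yo (Suc z)" "yl ` {yo z..<yo (Suc z)} = second_rows z" "yo (Suc z) - yo z \<le> dl"
    "inj_on yl {yo z..<yo (Suc z)}"
proof -
  have *: "enumerates yl (yo z) (yo (Suc z)) (second_rows z)" using second assms by (simp add: table_def)
  then show "yo z \<le> yo (Suc z)" "yl ` {yo z..<yo (Suc z)} = second_rows z"
    "inj_on yl {yo z..<yo (Suc z)}"
    by (auto simp: enumerates_def)
  show "yo (Suc z) - yo z \<le> dl" using enumerates_card[OF *] dl_second[OF assms] by simp
qed

text \<open>Since \<open>d\<close> is the maximal length of the lists, every entry of every list
  lies in one of the first \<open>d\<close> columns; \<open>S\<close> itself is one of the
  lists.\<close>

lemma active_source:
  assumes "i < M"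
  defines "u \<equiv> act i" and "b \<equiv> bst i" and "d \<equiv> bd i"
  shows "u < n" "0 < d" "d \<le> dl" "inj_on yl {b..<b + d}"
    "yl ` {b..<b + d} \<union> (\<Union>j<d. column_part j (ao u) (ao (Suc u))) = targets u"
proof -
  have a: "u < n" "0 < d" "scanned yo al (ao u) (ao (Suc u)) d b"
    using active assms by (auto simp: active_list_def)
  then show "u < n" "0 < d" by auto
  obtain q0 where q0: "q0 \<in> {ao u..<ao (Suc u)}" "b = yo (al q0)" "d = yo (Suc (al q0)) - yo (al q0)"
    using a by (auto simp: scanned_def)
  have z0: "al q0 < n" using first_row(4)[OF a(1) q0(1)] .
  have bd: "b + d = yo (Suc (al q0))" using second_row(1)[OF z0] q0 by simp
  show "d \<le> dl" "inj_on yl {b..<b + d}" using second_row(3,4)[OF z0] q0 bd by auto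
  have S: "yl ` {b..<b + d} = second_rows (al q0)" using second_row(2)[OF z0] q0 bd by simp
  have im: "al ` {ao u..<ao (Suc u)} = step_set F1 u" by (rule first_row(2)[OF a(1)])
  have "second_rows (al q0) \<subseteq> targets u" using q0(1) im by (auto simp: targets_def)
  moreover have "column_part j (ao u) (ao (Suc u)) \<subseteq> targets u" for j
  proof
    fix v assume "v \<in> column_part j (ao u) (ao (Suc u))"
    then obtain q where q: "q \<in> {ao u..<ao (Suc u)}" "v = yl (yo (al q) + j)"
      "yo (al q) + j < yo (Suc (al q))" by (auto simp: column_part_def)
    then have "v \<in> second_rows (al q)" using second_row(2)[OF first_row(4)[OF a(1) q(1)]] by force
    then show "v \<in> targets u" using q(1) im by (auto simp: targets_def)
  qed
  moreover have "v \<in> (\<Union>j<d. column_part j (ao u) (ao (Suc u)))" if "v \<in> targets u" for v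
  proof -
    obtain q where q: "q \<in> {ao u..<ao (Suc u)}" "v \<in> second_rows (al q)"
      using \<open>v \<in> targets u\<close> im unfolding targets_def by (metis UN_E imageE)
    then obtain p where p: "v = yl p" "yo (al q) \<le> p" "p < yo (Suc (al q))"
      using second_row(2)[OF first_row(4)[OF a(1) q(1)]] by force
    have "yo (Suc (al q)) - yo (al q) \<le> d" using a(3) q(1) by (simp add: scanned_def)
    then have "p - yo (al q) < d" using p by simp
    moreover have "v \<in> column_part (p - yo (al q)) (ao u) (ao (Suc u))"
      unfolding column_part_def using p q(1) by (intro CollectI exI[of _ q]) auto
    ultimately show ?thesis by blast
  qed
  ultimately show "yl ` {b..<b + d} \<union> (\<Union>j<d. column_part j (ao u) (ao (Suc u))) = targets u"
    unfolding S by blast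
qed

text \<open>Between two nodes there is only the rest of a column, the set-up and a reservation,
  because every node in \<open>act\<close> outputs in its first column.\<close>

lemma wp_enum_prog:
  assumes "kept s" "emitted s = []" "gap s = 0" "worst s = 0"
  shows "wp inp w enum_prog (\<lambda>s'. distinct (emitted s') \<and>
    set (emitted s') = {(u, v). u < n \<and> v \<in> targets u} \<and>
    sorted_wrt (\<lambda>p p'. fst p \<le> fst p') (emitted s') \<and> gap s' \<le> 200 * dl \<and> worst s' \<le> 200 * dl) s"
proof -
  define I where "I s' \<longleftrightarrow> kept s' \<and> rg s' rI \<le> M \<and> distinct (emitted s') \<and>
    set (emitted s') = {(u, v). u \<in> act ` {..<rg s' rI} \<and> v \<in> targets u} \<and>
    sorted_wrt (\<lambda>p p'. fst p \<le> fst p') (emitted s') \<and>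
    gap s' \<le> 40 * dl + 40 \<and> worst s' \<le> 200 * dl" for s'
  let ?Post = "\<lambda>s'. distinct (emitted s') \<and>
    set (emitted s') = {(u, v). u < n \<and> v \<in> targets u} \<and>
    sorted_wrt (\<lambda>p p'. fst p \<le> fst p') (emitted s') \<and> gap s' \<le> 200 * dl \<and> worst s' \<le> 200 * dl"
  let ?rest = "move rJ (Imm 0) ;; source_prog ;; incr rI"
  let ?body = "load rU aACT (Reg rI) ;; load rZ aBST (Reg rI) ;; load rB aBD (Reg rI) ;;
        incr rC ;; add rE (Reg rZ) (Reg rB) ;; move rP (Reg rZ) ;; reserve_prog ;; ?rest"
  have loop: "wp inp w (While (CLess (Reg rI) (Reg rM)) ?body) ?Post t" if "I t" for t
  proof (rule wp_While[where I = I and m = "\<lambda>s. M - rg s rI"])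
    fix t assume I: "I t" and "cval t (CLess (Reg rI) (Reg rM))"
    then have c: "rg t rI < M" by (simp add: I_def kept_def)
    define i where "i = rg t rI"
    define u b d where "u = act i" and "b = bst i" and "d = bd i"
    note src = active_source[OF c, folded i_def, folded u_def b_def d_def]
    note row = first_row[OF src(1)]
    let ?Q = "\<lambda>s'. I (tick 1 s') \<and> M - rg (tick 1 s') rI < M - rg t rI"
    \<comment> \<open>16 steps: the loop test, three loads of four steps, and three
      assignments.\<close>
    let ?t = "t\<lparr>rg := (rg t)(rU := u, rZ := b, rB := d, rC := Suc (rg t rC), rE := b + d, rP := b),
      gap := gap t + 16\<rparr>"
    have "ar t aST v \<noteq> Suc (rg t rC)" for v using I by (auto simp: I_def kept_def dest: spec[of _ v])
    then have li: "listing (emitted t) {} u {} ?t"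
      using I by (auto simp: listing_def I_def kept_def ready_for_def le_Suc_eq)
    have "wp inp w reserve_prog (wp inp w ?rest ?Q) ?t"
    proof (rule wp_mono[OF wp_reserve_prog[OF li, of b "b + d"]])
      fix t1
      assume *: "listing (emitted t) (yl ` {b..<b + d}) u {} t1 \<and>
        (\<forall>r\<in>{rI, rJ, rZ, rB}. rg t1 r = rg ?t r) \<and> gap t1 \<le> gap ?t + 20 * (b + d - b) + 2 \<and>
        worst t1 = worst ?t"
      let ?t1 = "t1\<lparr>rg := (rg t1)(rJ := 0), gap := gap t1 + 1\<rparr>"
      \<comment> \<open>The total is at most 60 * dl + 59, namely 40 * dl + 40 from the invariant,
        16 for the set-up, 20 * d + 2 for the reservation and 1; here \<open>d <= dl\<close> and
        \<open>1 <= dl\<close>.\<close>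
      have g1: "gap t1 + 1 \<le> 120 * dl" "worst t1 \<le> 200 * dl" using * I src(3) dl_pos by (auto simp: I_def)
      have "wp inp w source_prog (wp inp w (incr rI) ?Q) ?t1"
      proof (rule wp_mono[OF wp_source_prog[OF src(4) refl refl refl row(1,3) _ _ _ _ src(2)]])
        fix t2
        assume "listing (emitted t) (yl ` {b..<b + d}) u
            (yl ` {b..<b + d} \<union> (\<Union>j<d. column_part j (ao u) (ao (Suc u)))) t2 \<and>
          rg t2 rI = rg ?t1 rI \<and> gap t2 \<le> 40 * dl + 32 \<and> worst t2 \<le> 200 * dl"
        then have 2: "listing (emitted t) (yl ` {b..<b + d}) u (targets u) t2"
          "rg t2 rI = i" "gap t2 \<le> 40 * dl + 32" "worst t2 \<le> 200 * dl"
          using * unfolding src(5) by (auto simp: i_def)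
        then obtain xs where xs: "emitted t2 = emitted t @ map (Pair u) xs" "distinct xs"
          "set xs = targets u" by (auto simp: listing_def)
        \<comment> \<open>Earlier nodes are strictly smaller, so the new answers are different from
          all old ones and keep the order.\<close>
        have less: "u' < u" if "u' \<in> act ` {..<i}" for u'
          using active c that unfolding active_list_def i_def u_def by auto
        have em: "set (emitted t) = {(u, v). u \<in> act ` {..<i} \<and> v \<in> targets u}"
          "distinct (emitted t)" "sorted_wrt (\<lambda>p p'. fst p \<le> fst p') (emitted t)"
          using I by (auto simp: I_def i_def)
        have "distinct (emitted t2)" using em(1,2) xs less
          by (auto simp: distinct_map inj_on_def)
        moreover have "act ` {..<Suc i} = insert u (act ` {..<i})" by (auto simp: u_def lessThan_Suc)
        then have "set (emitted t2) = {(u, v). u \<in> act ` {..<Suc i} \<and> v \<in> targets u}"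
          using em(1) xs by auto
        moreover have "sorted_wrt (\<lambda>p p'. fst p \<le> fst p') (map (Pair u) xs)"
          by (simp add: sorted_wrt_map sorted_wrt_iff_nth_less)
        then have "sorted_wrt (\<lambda>p p'. fst p \<le> fst p') (emitted t2)"
          using em(1,3) xs less by (auto simp: sorted_wrt_append intro: less_imp_le)
        moreover have "kept t2" using 2(1) by (simp add: listing_def)
        ultimately show "wp inp w (incr rI) ?Q t2"
          using 2(2-4) c by (simp add: I_def tick_def i_def kept_def ready_for_def)
      qed (use * g1 in auto)
      then show "wp inp w ?rest ?Q t1" by (simp add: tick_def)
    qed auto
    moreover have "ar t aACT i = u" "ar t aBST i = b" "ar t aBD i = d" "rg t rW = w"
      using I by (auto simp: I_def kept_def ready_for_def u_def b_def d_def)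
    ultimately show "wp inp w ?body ?Q (tick 1 t)"
      by (simp add: tick_def i_def[symmetric] add.commute)
  next
    fix t assume I: "I t" and c: "\<not> cval t (CLess (Reg rI) (Reg rM))"
    then have i: "rg t rI = M" by (simp add: I_def kept_def)
    \<comment> \<open>A target of \<open>u\<close> witnesses a nonempty list, so \<open>u\<close>
      cannot be missing from \<open>act\<close>.\<close>
    have "u < n \<and> v \<in> targets u \<longleftrightarrow> u \<in> act ` {..<M} \<and> v \<in> targets u" for u v
    proof
      assume *: "u < n \<and> v \<in> targets u"
      then obtain q where q: "q \<in> {ao u..<ao (Suc u)}" "v \<in> second_rows (al q)"
        using first_row(2)[of u] unfolding targets_def by (metis UN_E imageE)
      then have "yo (al q) < yo (Suc (al q))"
        using second_row(2)[OF first_row(4)[OF _ q(1)]] * by force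
      then show "u \<in> act ` {..<M} \<and> v \<in> targets u"
        using active * q(1) unfolding active_list_def by (metis not_le)
    next
      assume "u \<in> act ` {..<M} \<and> v \<in> targets u"
      then show "u < n \<and> v \<in> targets u" using active by (auto simp: active_list_def)
    qed
    then show "?Post (tick 2 t)" using I i dl_pos by (auto simp: I_def tick_def)
  qed (rule that)
  show ?thesis unfolding enum_prog_def wp_Seq wp_Basic
    using assms by (intro conjI loop) (auto simp: I_def kept_def ready_for_def tick_def)
qed

end


section \<open>The encoded input\<close>

lemma position_less: "x \<in> set xs \<Longrightarrow> position xs x < length xs"
  unfolding position_def by (induction xs) auto

lemma nth_position: "x \<in> set xs \<Longrightarrow> xs ! position xs x = x"
  unfolding position_def by (induction xs) auto

lemma position_nth: "distinct xs \<Longrightarrow> i < length xs \<Longrightarrow> position xs (xs ! i) = i"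
  by (metis nth_eq_iff_index_eq nth_mem nth_position position_less)

text \<open>\<open>off\<close> is the offset table of \<open>encode_db\<close>; splitting the list
  at block \<open>i\<close> shows what the cells between two offsets contain.\<close>

lemma concat_segment:
  assumes "i < length bs"
  defines "off \<equiv> \<lambda>i. length (concat (take i bs))"
  shows "off (Suc i) = off i + length (bs ! i)"
    and "j < length (bs ! i) \<Longrightarrow> concat bs ! (off i + j) = bs ! i ! j"
proof -
  show "off (Suc i) = off i + length (bs ! i)"
    using assms(1) by (simp add: off_def take_Suc_conv_app_nth)
  have "concat bs = concat (take i bs) @ bs ! i @ concat (drop (Suc i) bs)"
    using id_take_nth_drop[OF assms(1)] by (metis concat.simps(2) concat_append)
  then show "j < length (bs ! i) \<Longrightarrow> concat bs ! (off i + j) = bs ! i ! j"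
    by (simp add: off_def nth_append)
qed

lemma concat_segment_set:
  assumes "i < length bs"
  shows "(!) (concat bs) ` {length (concat (take i bs))..<length (concat (take (Suc i) bs))} = set (bs ! i)"
    (is "_ ` {?a..<?b} = _")
proof -
  have "{?a..<?b} = (\<lambda>j. ?a + j) ` {..<length (bs ! i)}"
    using concat_segment(1)[OF assms] by (simp add: lessThan_atLeast0 add.commute)
  then have "(!) (concat bs) ` {?a..<?b} = (\<lambda>j. concat bs ! (?a + j)) ` {..<length (bs ! i)}"
    by (simp add: image_image)
  also have "\<dots> = (!) (bs ! i) ` {..<length (bs ! i)}"
    using concat_segment(2)[OF assms] by (intro image_cong) auto
  also have "\<dots> = set (bs ! i)" by (auto simp: set_conv_nth)
  finally show ?thesis .
qed

definition blocks :: "'a list \<Rightarrow> 'v list \<Rightarrow> ('v \<Rightarrow> 'a \<Rightarrow> 'v list) \<Rightarrow> nat list list" where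
  "blocks sig vs succs = [map (position vs) (succs u x). u \<leftarrow> vs, x \<leftarrow> sig]"

lemma length_blocks: "length (blocks sig vs succs) = length vs * length sig"
  by (simp add: blocks_def length_concat comp_def sum_list_triv)

lemma nth_concat_uniform:
  assumes "\<And>xs. xs \<in> set xss \<Longrightarrow> length xs = k" "i < length xss" "j < k"
  shows "concat xss ! (i * k + j) = xss ! i ! j"
  using assms
proof (induction xss arbitrary: i)
  case (Cons xs xss)
  then show ?case by (cases i) (auto simp: nth_append add.assoc)
qed simp

lemma nth_blocks:
  assumes "u < length vs" "l < length sig"
  shows "blocks sig vs succs ! (u * length sig + l) = map (position vs) (succs (vs ! u) (sig ! l))"
  unfolding blocks_def using assms by (subst nth_concat_uniform) auto

lemma letter_occs_letter_alt: "letter_occs (letter_alt xs) = xs"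
  by (induction xs rule: letter_alt.induct) auto

lemma factors_letter_alt: "factors (letter_alt xs) = [xs]"
  using letter_occs_letter_alt[of xs]
  by (cases xs rule: letter_alt.cases) (auto simp: factors_def)

lemma factors_Conc: "factors (Conc (letter_alt xs) (letter_alt ys)) = [xs, ys]"
  by (simp add: factors_def letter_occs_letter_alt)

lemma lang_letter_alt: "lang (letter_alt xs) = (\<lambda>x. [x]) ` set xs"
  by (induction xs rule: letter_alt.induct) auto

section \<open>Semantics of short RPQs\<close>

inductive_cases path_NilE: "path D u [] v"
inductive_cases path_ConsE: "path D u (x # w) v"

lemma path_Nil_iff: "path D u [] v \<longleftrightarrow> u = v \<and> u \<in> nodes D"
  by (auto elim: path_NilE intro: path.intros)

lemma path_Cons_iff: "path D u (x # w) v \<longleftrightarrow> (\<exists>z. (u, x, z) \<in> arcs D \<and> path D z w v)"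
  by (auto elim: path_ConsE intro: path.intros)

text \<open>The empty path exists only at nodes, so well-formedness is used to see that the end of
  an arc is one.\<close>

lemma path_singleton:
  assumes "graph_db S D"
  shows "path D u [x] v \<longleftrightarrow> (u, x, v) \<in> arcs D"
  using assms by (auto simp: path_Cons_iff path_Nil_iff graph_db_def)

lemma rpq_eval_letter_alt:
  assumes "graph_db S D"
  shows "rpq_eval (letter_alt xs) D = {(u, v). \<exists>x\<in>set xs. (u, x, v) \<in> arcs D}"
  by (auto simp: rpq_eval_def lang_letter_alt path_singleton[OF assms])

lemma rpq_eval_Conc:
  assumes "graph_db S D"
  shows "rpq_eval (Conc (letter_alt xs) (letter_alt ys)) D =
    {(u, v). \<exists>z. (\<exists>x\<in>set xs. (u, x, z) \<in> arcs D) \<and> (\<exists>y\<in>set ys. (z, y, v) \<in> arcs D)}"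
proof -
  have "lang (Conc (letter_alt xs) (letter_alt ys)) = (\<Union>x\<in>set xs. \<Union>y\<in>set ys. {[x, y]})"
  proof (intro equalityI subsetI)
    fix w assume "w \<in> (\<Union>x\<in>set xs. \<Union>y\<in>set ys. {[x, y]})"
    then obtain x y where "x \<in> set xs" "y \<in> set ys" "w = [x] @ [y]" by auto
    then show "w \<in> lang (Conc (letter_alt xs) (letter_alt ys))"
      unfolding lang.simps lang_letter_alt by blast
  qed (auto simp: lang_letter_alt)
  moreover have "path D u [x, y] v \<longleftrightarrow> (\<exists>z. (u, x, z) \<in> arcs D \<and> (z, y, v) \<in> arcs D)" for u v x y
    by (simp only: path_Cons_iff[of D u] path_singleton[OF assms])
  ultimately show ?thesis by (auto simp: rpq_eval_def)
qed

lemma length_concat_comprehension: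
  "length (concat [f u x. u \<leftarrow> us, x \<leftarrow> xs]) = (\<Sum>u\<leftarrow>us. \<Sum>x\<leftarrow>xs. length (f u x))"
  by (induction us) (simp_all add: length_concat comp_def)

text \<open>Every arc has exactly one entry, in the block of its source and letter; the double sum
  counts the arcs as a nested \<open>Sigma\<close>.\<close>

lemma length_concat_blocks:
  assumes "graph_db (set sig) D" "represents sig vs succs D" "distinct sig"
  shows "length (concat (blocks sig vs succs)) = card (arcs D)"
proof -
  have vs: "distinct vs" "set vs = nodes D" using assms(2) by (auto simp: represents_def)
  have len: "length (succs u x) = card {v. (u, x, v) \<in> arcs D}" if "u \<in> nodes D" "x \<in> set sig" for u x
    using assms(2) that distinct_card[of "succs u x"] by (simp add: represents_def)
  have fin: "finite {v. (u, x, v) \<in> arcs D}" for u x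
  proof (rule finite_subset)
    show "{v. (u, x, v) \<in> arcs D} \<subseteq> nodes D" "finite (nodes D)" using assms(1) by (auto simp: graph_db_def)
  qed
  have "length (concat (blocks sig vs succs)) = (\<Sum>u\<leftarrow>vs. \<Sum>x\<leftarrow>sig. length (succs u x))"
    unfolding blocks_def length_concat_comprehension by simp
  also have "\<dots> = (\<Sum>u\<in>nodes D. \<Sum>x\<in>set sig. length (succs u x))"
    using vs assms(3) by (simp add: sum_list_distinct_conv_sum_set)
  also have "\<dots> = (\<Sum>u\<in>nodes D. \<Sum>x\<in>set sig. card {v. (u, x, v) \<in> arcs D})"
    using len by simp
  also have "\<dots> = card (SIGMA u:nodes D. SIGMA x:set sig. {v. (u, x, v) \<in> arcs D})"
    using assms(1) fin by (simp add: card_SigmaI graph_db_def)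
  also have "(SIGMA u:nodes D. SIGMA x:set sig. {v. (u, x, v) \<in> arcs D}) = arcs D"
    using assms(1) by (auto simp: graph_db_def)
  finally show ?thesis .
qed

lemma map_offset_nth:
  "i \<le> n \<Longrightarrow> map f [0..<n + 1] ! i = f i"
  by (simp del: upt_Suc)

lemma encode_input_layout:
  "encode_input sig vs succs q =
    (length vs # encode_query sig q) @
    map (\<lambda>i. length (concat (take i (blocks sig vs succs)))) [0..<length vs * length sig + 1] @
    concat (blocks sig vs succs)"
  using length_blocks[of sig vs succs]
  by (simp add: encode_input_def encode_db_def Let_def blocks_def[symmetric] del: upt_Suc)

text \<open>Treats both query shapes at once; \<open>ys = []\<close> makes the second letter set
  empty when there is one factor.\<close>

locale encoded_query =
  fixes sig :: "'a list" and D :: "('v, 'a) graph_db" and vs :: "'v list"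
    and out :: "'v \<Rightarrow> 'a \<Rightarrow> 'v list" and q :: "'a rexp" and xs ys :: "'a list" and nf :: nat
  assumes sig: "distinct sig" and db: "graph_db (set sig) D" and repr: "represents sig vs out D"
    and xs: "set xs \<subseteq> set sig" "xs \<noteq> []" and ys: "set ys \<subseteq> set sig"
    and q: "nf = 1 \<and> ys = [] \<and> q = letter_alt xs \<or>
      nf = 2 \<and> q = Conc (letter_alt xs) (letter_alt ys)"
begin

abbreviation "L \<equiv> encode_input sig vs out q"
abbreviation "Q \<equiv> length vs # encode_query sig q"
abbreviation "bs \<equiv> blocks sig vs out"

definition inp :: "nat \<Rightarrow> nat" where "inp a = (if a < length L then L ! a else 0)"

abbreviation "n \<equiv> length vs"
abbreviation "k \<equiv> length sig"
definition ot :: nat where "ot = length Q"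
definition dt :: nat where "dt = Suc (ot + n * k)"
abbreviation "F1 \<equiv> position sig ` set xs"
abbreviation "F2 \<equiv> position sig ` set ys"

lemma encode_query: "encode_query sig q =
    (if nf = 2 then 2 # (length xs # map (position sig) xs) @ (length ys # map (position sig) ys)
     else 1 # length xs # map (position sig) xs)"
  using q by (auto simp: encode_query_def factors_letter_alt factors_Conc)

lemma encode_input_eq: "L = Q @ map (\<lambda>i. length (concat (take i bs))) [0..<n * k + 1] @ concat bs"
  using encode_input_layout by simp

lemma length_L: "length L = dt + length (concat bs)"
  unfolding encode_input_eq dt_def ot_def by simp

lemma inp_Q: "i < ot \<Longrightarrow> inp i = Q ! i"
  unfolding inp_def length_L unfolding encode_input_eq dt_def ot_def by (simp only: nth_append_left) simp

lemma inp_offset: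
  assumes "i \<le> n * k"
  shows "inp (ot + i) = length (concat (take i bs))"
proof -
  have "L ! (ot + i) = map (\<lambda>i. length (concat (take i bs))) [0..<n * k + 1] ! i"
    unfolding encode_input_eq ot_def using assms by (simp add: nth_append del: upt_Suc)
  then show ?thesis using assms map_offset_nth[OF assms] by (simp add: inp_def length_L dt_def)
qed

lemma inp_data:
  assumes "p < length (concat bs)"
  shows "inp (dt + p) = concat bs ! p"
proof -
  have "L ! (dt + p) = concat bs ! p"
    unfolding encode_input_eq dt_def ot_def using assms by (simp add: nth_append del: upt_Suc)
  then show ?thesis using assms by (simp add: inp_def length_L)
qed

lemma vs: "distinct vs" "set vs = nodes D"
  using repr by (auto simp: represents_def)

lemma set_out: "u \<in> nodes D \<Longrightarrow> x \<in> set sig \<Longrightarrow> set (out u x) = {v. (u, x, v) \<in> arcs D}"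
  using repr by (auto simp: represents_def)

lemma data_less:
  assumes "v \<in> set (concat bs)"
  shows "v < n"
proof -
  obtain u x y where "u \<in> set vs" "x \<in> set sig" "y \<in> set (out u x)" "v = position vs y"
    using assms by (auto simp: blocks_def)
  then have "y \<in> set vs" using set_out vs db by (auto simp: graph_db_def)
  then show ?thesis using position_less \<open>v = position vs y\<close> by metis
qed

sublocale stored_database inp "length L" n k nf "length xs" "length ys" ot dt F1 F2
proof
  have total: "inp (ot + n * k) = length (concat bs)"
    using inp_offset[of "n * k"] length_blocks[of sig vs out] by simp
  show "inp 0 = n" by (simp add: inp_Q ot_def)
  show "inp 1 = nf" using q by (auto simp: inp_Q ot_def encode_query)
  show "nf \<in> {1, 2}" using q by auto
  show "inp 2 = length xs" by (simp add: inp_Q ot_def encode_query)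
  have "inp (3 + i) = position sig (xs ! i)" if "i < length xs" for i
    using that by (simp add: inp_Q ot_def encode_query nth_append)
  then show "F1 = (\<lambda>i. inp (3 + i)) ` {..<length xs}"
    by (auto simp: set_conv_nth image_iff)
  show "inp (3 + length xs) = length ys" if "nf = 2"
    using that by (simp add: inp_Q ot_def encode_query nth_append)
  have "inp (4 + length xs + i) = position sig (ys ! i)" if "i < length ys" "nf = 2" for i
    using that by (simp add: inp_Q ot_def encode_query nth_append)
  then show "F2 = (\<lambda>i. inp (4 + length xs + i)) ` {..<length ys}" if "nf = 2"
    using that by (auto simp: set_conv_nth image_iff)
  show "F1 \<subseteq> {..<k}" "F2 \<subseteq> {..<k}" using xs ys position_less by fastforce+
  show "ot = (if nf = 2 then 4 + length xs + length ys else 3 + length xs)"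
    by (simp add: ot_def encode_query)
  show "length L = dt + inp (ot + n * k)" by (simp add: length_L total)
  show "inp (ot + i) \<le> inp (Suc (ot + i))" if "i < n * k" for i
    using that inp_offset[of i] inp_offset[of "Suc i"] concat_segment(1)[of i bs] length_blocks[of sig vs out]
    by simp
  show "inp (dt + p) < n" if "p < inp (ot + n * k)" for p
  proof -
    have p: "p < length (concat bs)" using that by (simp only: total)
    show ?thesis unfolding inp_data[OF p] by (rule data_less[OF nth_mem[OF p]])
  qed
qed (simp add: dt_def)

lemma m_eq_card_arcs: "m = card (arcs D)"
  unfolding m_def
  using inp_offset[of "n * k"] length_blocks[of sig vs out] length_concat_blocks[OF db repr sig]
  by simp

lemma succs:
  assumes "u < n" "l < k"
  shows "succs u l = position vs ` {v. (vs ! u, sig ! l, v) \<in> arcs D}"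
proof -
  let ?i = "u * k + l"
  have "Suc u * k \<le> n * k" using assms(1) by (intro mult_le_mono1) simp
  then have i: "?i < n * k" using assms(2) by simp
  let ?S = "{length (concat (take ?i bs))..<length (concat (take (Suc ?i) bs))}"
  have "length (concat (take (Suc ?i) bs)) \<le> length (concat bs)"
    using offset_le[of "Suc ?i"] i inp_offset[of "Suc ?i"] inp_offset[of "n * k"] length_blocks[of sig vs out]
    by (simp add: m_def)
  then have "succs u l = (!) (concat bs) ` ?S"
    unfolding succs_def using inp_offset[of ?i] inp_offset[of "Suc ?i"] i inp_data
    by (intro image_cong) auto
  also have "\<dots> = set (bs ! ?i)" using i by (intro concat_segment_set) (simp add: length_blocks)
  also have "\<dots> = position vs ` {v. (vs ! u, sig ! l, v) \<in> arcs D}"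
  proof -
    have "vs ! u \<in> nodes D" unfolding vs(2)[symmetric] using assms(1) by (rule nth_mem)
    then show ?thesis using set_out assms(2) by (simp add: nth_blocks[OF assms])
  qed
  finally show ?thesis .
qed

lemma step_set:
  assumes "u < n" "set zs \<subseteq> set sig"
  shows "step_set (position sig ` set zs) u = position vs ` {v. \<exists>x\<in>set zs. (vs ! u, x, v) \<in> arcs D}"
proof -
  have "succs u (position sig x) = position vs ` {v. (vs ! u, x, v) \<in> arcs D}" if "x \<in> set zs" for x
  proof -
    have "x \<in> set sig" using that assms(2) by blast
    then show ?thesis using succs[OF assms(1) position_less] by (simp add: nth_position)
  qed
  then show ?thesis by (auto simp: step_set_def)
qed

text \<open>Restricting the letters only removes successors, and numbering nodes by position cannot
  enlarge a set.\<close>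

lemma card_step_set:
  assumes "u < n" "set zs \<subseteq> set sig"
  shows "card (step_set (position sig ` set zs) u) \<le> max_degree D"
proof -
  have fin: "finite {v. \<exists>x. (vs ! u, x, v) \<in> arcs D}"
    by (rule finite_subset[of _ "nodes D"]) (use db in \<open>auto simp: graph_db_def\<close>)
  then have fin': "finite {v. \<exists>x\<in>set zs. (vs ! u, x, v) \<in> arcs D}"
    by (rule rev_finite_subset) auto
  have "card (step_set (position sig ` set zs) u) \<le> card {v. \<exists>x\<in>set zs. (vs ! u, x, v) \<in> arcs D}"
    unfolding step_set[OF assms] by (rule card_image_le[OF fin'])
  also have "\<dots> \<le> degree D (vs ! u)"
    unfolding degree_def by (rule card_mono[OF fin]) auto
  also have "degree D (vs ! u) \<le> max_degree D"
    unfolding max_degree_def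
  proof (rule Max_ge)
    show "finite (insert 0 (degree D ` nodes D))" using db by (simp add: graph_db_def)
    have "vs ! u \<in> nodes D" unfolding vs(2)[symmetric] using assms(1) by (rule nth_mem)
    then show "degree D (vs ! u) \<in> insert 0 (degree D ` nodes D)" by blast
  qed
  finally show ?thesis .
qed

text \<open>The 1 is for the singleton rows of a one-factor query.\<close>

lemma card_second_rows:
  assumes "u < n"
  shows "card (second_rows u) \<le> max 1 (max_degree D)"
  using card_step_set[OF assms ys] by (auto simp: second_rows_def)

text \<open>The same set as \<open>targets\<close>, whose locale also fixes the computed arrays;
  this version depends on the input only.\<close>

definition target_set :: "nat \<Rightarrow> nat set" where
  "target_set u = (\<Union>z\<in>step_set F1 u. second_rows z)"

lemma target_set:
  assumes "u < n"
  shows "target_set u = position vs ` {v. (vs ! u, v) \<in> rpq_eval q D}"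
proof (cases "nf = 2")
  case True
  then have ev: "rpq_eval q D = {(u, v). \<exists>z. (\<exists>x\<in>set xs. (u, x, z) \<in> arcs D) \<and> (\<exists>y\<in>set ys. (z, y, v) \<in> arcs D)}"
    using q rpq_eval_Conc[OF db] by auto
  have "second_rows (position vs z) = position vs ` {v. \<exists>y\<in>set ys. (z, y, v) \<in> arcs D}"
    if "z \<in> nodes D" for z
    unfolding second_rows_def using True that vs step_set[OF _ ys, of "position vs z"]
    by (simp add: position_less nth_position)
  moreover have "z \<in> nodes D" if "(u, x, z) \<in> arcs D" for u x z
    using that db by (auto simp: graph_db_def)
  ultimately show ?thesis unfolding target_set_def step_set[OF assms xs(1)] ev by fastforce
next
  case False
  then have "rpq_eval q D = {(u, v). \<exists>x\<in>set xs. (u, x, v) \<in> arcs D}"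
    using q rpq_eval_letter_alt[OF db] by auto
  then show ?thesis unfolding target_set_def step_set[OF assms xs(1)] second_rows_def
    using False by auto
qed

text \<open>The required list of node pairs is obtained by decoding numbers with \<open>nth\<close>,
  which inverts \<open>position\<close> below \<open>n\<close>.\<close>

lemma semi_sorted:
  assumes "distinct es" "set es = {(u, v). u < n \<and> v \<in> target_set u}"
    "sorted_wrt (\<lambda>p p'. fst p \<le> fst p') es"
  shows "semi_sorted_enumeration vs (rpq_eval q D) es"
  unfolding semi_sorted_enumeration_def
proof (intro exI conjI)
  let ?f = "\<lambda>(a, b). (vs ! a, vs ! b)"
  have nodes: "u \<in> nodes D \<and> v \<in> nodes D" if "(u, v) \<in> rpq_eval q D" for u v
    using that q rpq_eval_letter_alt[OF db] rpq_eval_Conc[OF db] db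
    by (auto simp: graph_db_def)
  have less: "a < n" "b < n" "(vs ! a, vs ! b) \<in> rpq_eval q D" if "(a, b) \<in> set es" for a b
  proof -
    show a: "a < n" using that assms(2) by auto
    have "b \<in> position vs ` {v. (vs ! a, v) \<in> rpq_eval q D}"
      using that target_set[OF a] by (simp add: assms(2))
    then obtain v where v: "b = position vs v" "(vs ! a, v) \<in> rpq_eval q D" by blast
    then have "v \<in> set vs" using nodes vs by blast
    then show "b < n" "(vs ! a, vs ! b) \<in> rpq_eval q D"
      using v by (auto simp: position_less nth_position)
  qed
  have inj: "inj_on ?f (set es)"
    using less(1,2) vs(1) by (auto simp: inj_on_def nth_eq_iff_index_eq)
  show "distinct (map ?f es)" using assms(1) inj by (simp add: distinct_map)
  show "set (map ?f es) = rpq_eval q D"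
  proof (intro set_eqI iffI)
    fix p assume "p \<in> rpq_eval q D"
    then obtain u v where p: "p = (u, v)" "(u, v) \<in> rpq_eval q D" by (cases p) auto
    then have uv: "u \<in> set vs" "v \<in> set vs" using nodes vs by auto
    then have "position vs v \<in> target_set (position vs u)"
      using target_set[of "position vs u"] p by (simp add: position_less nth_position)
    then have "(position vs u, position vs v) \<in> set es"
      using uv assms(2) by (auto simp: position_less)
    then have "?f (position vs u, position vs v) \<in> set (map ?f es)" by (simp only: set_map imageI)
    then show "p \<in> set (map ?f es)" using p uv by (simp add: nth_position)
  qed (use less(3) in auto)
  show "sorted_wrt (\<lambda>p p'. position vs (fst p) \<le> position vs (fst p')) (map ?f es)"
    unfolding sorted_wrt_map
    by (rule sorted_wrt_mono_rel[OF _ assms(3)]) (use less(1) vs(1) in \<open>auto simp: position_nth\<close>)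
  show "es = map (\<lambda>(u, v). (position vs u, position vs v)) (map ?f es)"
    unfolding map_map using less(1,2) vs(1)
    by (intro map_idI[symmetric]) (auto simp: position_nth)
qed

end


section \<open>The theorem\<close>

context encoded_query
begin

text \<open>A query letter exists, so the alphabet is nonempty and \<open>n <= n * k\<close>; thus
  the input length dominates the number of nodes even without arcs.\<close>

lemma sizes: "ot \<le> length (letter_occs q) + 4" "n \<le> n * k" "length L = ot + n * k + 1 + m" "4 \<le> ot"
  "length (letter_occs q) \<ge> 1"
proof -
  have "0 < k" using xs by (cases sig) auto
  then show "n \<le> n * k" by (cases k) auto
  show "length L = ot + n * k + 1 + m" using w unfolding m_def dt_def by simp
  have "1 \<le> length xs" using xs(2) by (cases xs) auto
  then show "4 \<le> ot" unfolding ot by simp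
  from q show "ot \<le> length (letter_occs q) + 4" "length (letter_occs q) \<ge> 1"
    using \<open>1 \<le> length xs\<close> by (auto simp: ot letter_occs_letter_alt)
qed

lemma length_nodes_le: "n \<le> length L"
  using sizes(2,3) by linarith

text \<open>Without repetitions the query has constant size, which the constant of the theorem can
  absorb.\<close>

lemma repetition_free_sizes:
  assumes "repetition_free q"
  shows "length (letter_occs q) \<le> 2 * k"
proof -
  have "length zs \<le> k" if "distinct zs" "set zs \<subseteq> set sig" for zs
    using that sig card_mono[of "set sig" "set zs"] by (simp add: distinct_card)
  moreover have "distinct xs \<and> distinct ys"
    using assms q by (auto simp: repetition_free_def factors_letter_alt factors_Conc)
  ultimately have "length xs \<le> k" "length ys \<le> k" using xs ys by auto
  then show ?thesis using q by (auto simp: letter_occs_letter_alt)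
qed

text \<open>Every input word is a count, a letter, an offset or a node. The summand 10 puts the
  immediate constants of the programs below the bound as well.\<close>

lemma initial_weighted: "weighted (prog_weight k) (length L + k + 10) (initial_state L)"
proof -
  have "inp a \<le> length L + k + 10" for a
  proof (cases "a < length L")
    case True
    have Q: "x \<le> length L + k + 10" if "x \<in> set Q" for x
    proof -
      have "length xs \<le> ot" "length ys \<le> ot" using q unfolding ot by auto
      then have "length xs \<le> length L" "length ys \<le> length L" using sizes(3) by linarith+
      moreover have "position sig x \<le> k" if "x \<in> set xs \<union> set ys" for x
        using that xs ys position_less[of x sig] by (auto intro: less_imp_le)
      ultimately show ?thesis using that length_nodes_le unfolding encode_query
        by (auto split: if_splits intro: le_trans[OF _ trans_le_add1] simp: trans_le_add1 trans_le_add2)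
    qed
    have "a - ot \<le> n * k \<or> a - dt < m" using True sizes(3) unfolding dt_def by linarith
    then consider "a < ot" | i where "a = ot + i" "i \<le> n * k" | p where "a = dt + p" "p < m"
      unfolding dt_def by (metis Suc_leI add_Suc_right le_add_diff_inverse less_Suc_eq_le nat_le_linear
        not_le add_le_cancel_left)
    then show ?thesis
    proof cases
      case 1
      then have "Q ! a \<in> set Q" by (intro nth_mem) (simp add: ot_def)
      then show ?thesis unfolding inp_Q[OF 1] by (rule Q)
    next
      case 2
      then show ?thesis using offset_le[of i] sizes(3) by simp
    next
      case 3
      then show ?thesis using entries[of p] length_nodes_le by (simp add: m_def)
    qed
  qed (simp add: inp_def)
  then show ?thesis by (auto simp: weighted_def initial_state_def inp_def[symmetric])
qed

lemma max_degree_le: "max 1 (max_degree D) \<le> length L"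
proof -
  have fin: "finite (nodes D)" using db by (simp add: graph_db_def)
  have "degree D u \<le> n" for u
  proof -
    have "degree D u \<le> card (nodes D)"
      unfolding degree_def by (rule card_mono[OF fin]) (use db in \<open>auto simp: graph_db_def\<close>)
    then show ?thesis using vs distinct_card by metis
  qed
  then have "max_degree D \<le> n" using fin by (auto simp: max_degree_def)
  then have "max_degree D \<le> n * k" using sizes(2) by (rule le_trans)
  then show ?thesis using sizes(3,4) by simp
qed

text \<open>The left side is the largest weight times the initial bound plus 10 per step, with 400 *
  N steps of preprocessing and a cubic number of steps of enumeration. The base is at least 2, so a
  constant \<open>a\<close> is absorbed through \<open>a < 2 ^ a\<close>.\<close>

lemma power_bound:
  fixes N :: nat
  shows "(26 + k) * ((N + k + 10 + 400 * N * 10) + (N * N * (200 * N) + 200 * N) * 10) <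
    (N + 2) ^ ((26 + k) * (8011 + k) + 3)"
proof -
  define Y where "Y = N + 2"
  have 1: "1 \<le> Y" "N \<le> Y" "2 \<le> Y" by (auto simp: Y_def)
  then have Y: "Y \<le> Y ^ 3" "1 \<le> Y ^ 3" using self_le_power[of Y 3] one_le_power[of Y 3] by auto
  have "N * N * (200 * N) \<le> 200 * Y ^ 3"
    using 1 mult_le_mono[OF mult_le_mono[OF 1(2,2)] 1(2)] by (simp add: numeral_3_eq_3 algebra_simps)
  moreover have "k + 10 \<le> (k + 10) * Y ^ 3" using Y(2) by simp
  \<comment> \<open>The coefficients add up: 1 + (k + 10) + 4000 + 2000 + 2000.\<close>
  ultimately have "(N + k + 10 + 400 * N * 10) + (N * N * (200 * N) + 200 * N) * 10 \<le> (8011 + k) * Y ^ 3"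
    using 1(2) Y(1) by (simp add: algebra_simps)
  then have "(26 + k) * ((N + k + 10 + 400 * N * 10) + (N * N * (200 * N) + 200 * N) * 10)
      \<le> (26 + k) * ((8011 + k) * Y ^ 3)" by (rule mult_le_mono2)
  also have "\<dots> = (26 + k) * (8011 + k) * Y ^ 3" by simp
  also have "\<dots> < 2 ^ ((26 + k) * (8011 + k)) * Y ^ 3"
    using less_exp[of "(26 + k) * (8011 + k)"] 1(1) Y(2) by (intro mult_strict_right_mono) auto
  also have "\<dots> \<le> Y ^ ((26 + k) * (8011 + k)) * Y ^ 3"
    using 1(3) by (intro mult_le_mono1 power_mono) auto
  finally show ?thesis by (simp only: Y_def power_add)
qed

lemma solves:
  defines "B \<equiv> (length L + 2) ^ ((26 + k) * (8011 + k) + 3)"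
  shows "solves_semi_sorted_enum (compile 0 (pre_prog k)) (compile 0 enum_prog) L B vs (rpq_eval q D)
    (200 * (n + n * k + m + ot + 1)) (200 * max 1 (max_degree D))"
proof -
  define s where "s = \<lparr>rg = \<lambda>_. 0, ar = \<lambda>_ _. 0, emitted = [], gap = 0, worst = 0\<rparr>"
  define dl where "dl = max 1 (max_degree D)"
  let ?pre = "compile 0 (pre_prog k)"
  let ?enum = "compile 0 enum_prog"
  let ?N = "length L"
  have sim: "sim inp ?N s (initial_state L)"
    by (auto simp: sim_def s_def initial_state_def layout_def inp_def)
  have pre: "wp inp ?N (pre_prog k) (\<lambda>s'. prepared s' \<and> emitted s' = [] \<and>
    gap s' \<le> 200 * (n + n * k + m + ot + 1)) s"
    by (rule wp_pre_prog) (simp_all add: s_def)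
  obtain T s1 where s1: "prepared s1" "emitted s1 = []" "gap s1 \<le> 200 * (n + n * k + m + ot + 1)"
    and T: "halts_at ?pre (initial_state L) T" "sim inp ?N s1 (exec ?pre (initial_state L) T)"
      "outputs ?pre (initial_state L) T = []" "T \<le> gap s1"
  proof (rule wp_compile[OF pre sim])
    show "pc (initial_state L) = 0" by (simp add: initial_state_def)
    show "ghost s = ([], 0, 0)" by (simp add: ghost_def s_def)
  qed auto
  define \<sigma> where "\<sigma> = exec ?pre (initial_state L) T\<lparr>pc := 0\<rparr>"
  \<comment> \<open>Observations restart with the second program; registers and memory are
    kept.\<close>
  define s2 where "s2 = s1\<lparr>emitted := [], gap := 0, worst := 0\<rparr>"
  have sim2: "sim inp ?N s2 \<sigma>" using T(2) by (simp add: sim_def s2_def \<sigma>_def)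
  interpret P: prepared_database inp ?N n k nf "length xs" "length ys" ot dt F1 F2
    "ar s1 aYO" "ar s1 aYL" "ar s1 aAO" "ar s1 aAL" "ar s1 aACT" "ar s1 aBST" "ar s1 aBD" "rg s1 rM" dl
    using s1(1) card_step_set[OF _ xs(1)] card_second_rows
    by unfold_locales (auto simp: prepared_def dl_def le_max_iff_disj)
  have "P.kept s2" using s1(1) by (simp add: P.kept_def s2_def prepared_def ready_for_def)
  from P.wp_enum_prog[OF this] have enum: "wp inp ?N enum_prog (\<lambda>s'. distinct (emitted s') \<and>
    set (emitted s') = {(u, v). u < n \<and> v \<in> P.targets u} \<and>
    sorted_wrt (\<lambda>p p'. fst p \<le> fst p') (emitted s') \<and> gap s' \<le> 200 * dl \<and> worst s' \<le> 200 * dl) s2"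
    by (simp add: s2_def)
  have pc2: "pc \<sigma> = 0" and ghost2: "ghost s2 = ([], 0, 0)" by (simp_all add: \<sigma>_def s2_def ghost_def)
  obtain T' s3 where s3': "distinct (emitted s3) \<and>
      set (emitted s3) = {(u, v). u < n \<and> v \<in> P.targets u} \<and>
      sorted_wrt (\<lambda>p p'. fst p \<le> fst p') (emitted s3) \<and> gap s3 \<le> 200 * dl \<and> worst s3 \<le> 200 * dl"
    and T': "halts_at ?enum \<sigma> T'" "sim inp ?N s3 (exec ?enum \<sigma> T')" "outputs ?enum \<sigma> T' = emitted s3"
      "delay ?enum \<sigma> T' = max (worst s3) (gap s3)" "T' \<le> length (emitted s3) * worst s3 + gap s3"
    by (rule wp_compile[OF enum sim2 pc2 ghost2])
  then have s3: "distinct (emitted s3)" "set (emitted s3) = {(u, v). u < n \<and> v \<in> P.targets u}"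
      "sorted_wrt (\<lambda>p p'. fst p \<le> fst p') (emitted s3)" "gap s3 \<le> 200 * dl" "worst s3 \<le> 200 * dl"
    by simp_all
  have semi: "semi_sorted_enumeration vs (rpq_eval q D) (emitted s3)"
    using s3 by (intro semi_sorted) (auto simp: P.targets_def target_set_def)
  \<comment> \<open>At most quadratically many answers with linear delay give the polynomial running
    time needed for the word size.\<close>
  have "set (emitted s3) \<subseteq> {..<n} \<times> {..<n}"
  proof -
    have "P.targets u \<subseteq> {..<n}" if "u < n" for u
    proof -
      have nodes: "v \<in> set vs" if "(u, v) \<in> rpq_eval q D" for u v
        using that q rpq_eval_letter_alt[OF db] rpq_eval_Conc[OF db] db vs(2)
        by (auto simp: graph_db_def)
      have "P.targets u = position vs ` {v. (vs ! u, v) \<in> rpq_eval q D}"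
        using target_set[OF that] by (simp add: P.targets_def target_set_def)
      then show ?thesis using nodes position_less by fastforce
    qed
    then show ?thesis using s3(2) by auto
  qed
  then have "card (set (emitted s3)) \<le> n * n"
    using card_mono[of "{..<n} \<times> {..<n}" "set (emitted s3)"] by simp
  then have "length (emitted s3) \<le> n * n" using distinct_card[OF s3(1)] by simp
  also have "\<dots> \<le> ?N * ?N" by (intro mult_le_mono length_nodes_le)
  finally have out_bound: "length (emitted s3) * worst s3 \<le> ?N * ?N * (200 * ?N)"
    using s3(5) max_degree_le by (intro mult_le_mono) (auto simp: dl_def)
  have T'_bound: "T' \<le> ?N * ?N * (200 * ?N) + 200 * ?N"
  proof -
    have "gap s3 \<le> 200 * ?N" using s3(4) mult_le_mono2[OF max_degree_le, of 200]
      unfolding dl_def by (rule le_trans)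
    then show ?thesis using T'(5) out_bound by linarith
  qed
  \<comment> \<open>\<open>?N\<close> equals \<open>ot + n * k + 1 + m\<close>, and the additional
    \<open>n\<close> is at most \<open>n * k\<close>.\<close>
  have "n + n * k + m + ot + 1 \<le> 2 * ?N" using sizes(2,3) by linarith
  then have "200 * (n + n * k + m + ot + 1) \<le> 200 * (2 * ?N)" by (rule mult_le_mono2)
  then have T_bound: "T \<le> 400 * ?N" using T(4) s1(3) by linarith
  let ?V = "?N + k + 10"
  have weight: "1 \<le> prog_weight k r" "prog_weight k r \<le> 26 + k" for r by auto
  \<comment> \<open>Enumeration inherits the words left by preprocessing, so its initial bound
    includes the growth during the first phase.\<close>
  have W: "weighted (prog_weight k) (?V + 400 * ?N * 10) \<sigma>"
  proof -
    have "weighted (prog_weight k) (?V + T * 10) (exec ?pre (initial_state L) T)"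
      by (rule weighted_exec[OF initial_weighted _ weight(1) tame_compile[OF tame_pre_prog]]) simp
    then have "weighted (prog_weight k) (?V + 400 * ?N * 10) (exec ?pre (initial_state L) T)"
      by (rule weighted_mono) (use T_bound in simp)
    then show ?thesis by (simp add: \<sigma>_def weighted_def)
  qed
  note bound = power_bound[of ?N, folded B_def]
  have "(26 + k) * (?V + T * 10) \<le> (26 + k) * ((?V + 400 * ?N * 10) + (?N * ?N * (200 * ?N) + 200 * ?N) * 10)"
    using T_bound by (intro mult_le_mono2) simp
  note pre_bound = le_less_trans[OF this bound]
  have words_pre: "words_below B ?pre (initial_state L) T"
    by (rule words_below_exec[OF initial_weighted _ weight tame_compile[OF tame_pre_prog] pre_bound]) simp
  have "(26 + k) * ((?V + 400 * ?N * 10) + T' * 10)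
      \<le> (26 + k) * ((?V + 400 * ?N * 10) + (?N * ?N * (200 * ?N) + 200 * ?N) * 10)"
    using T'_bound by (intro mult_le_mono2) simp
  note enum_bound = le_less_trans[OF this bound]
  have words_enum: "words_below B ?enum \<sigma> T'"
    by (rule words_below_exec[OF W _ weight tame_compile[OF tame_enum_prog] enum_bound]) simp
  show ?thesis unfolding solves_semi_sorted_enum_def
    using T(1,3,4) T'(1,3,4) words_pre words_enum semi s1(3) s3(4,5)
    by (intro exI[of _ T] exI[of _ T'] exI[of _ "initial_state L"] exI[of _ \<sigma>])
      (auto simp: \<sigma>_def dl_def)
qed

end

lemma solves_mono:
  assumes "solves_semi_sorted_enum pre enm L B vs R p d" "p \<le> p'" "d \<le> d'"
  shows "solves_semi_sorted_enum pre enm L B vs R p' d'"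
  using assms unfolding solves_semi_sorted_enum_def by (meson le_trans)

lemma short_rpq_encoded:
  assumes "distinct sig" "graph_db (set sig) D" "represents sig vs succs D" "short_rpq (set sig) q"
  obtains xs ys nf where "encoded_query sig D vs succs q xs ys nf"
proof -
  from assms(4) consider
      xs where "xs \<noteq> []" "set xs \<subseteq> set sig" "q = letter_alt xs"
    | xs ys where "xs \<noteq> []" "set xs \<subseteq> set sig" "set ys \<subseteq> set sig"
        "q = Conc (letter_alt xs) (letter_alt ys)"
    unfolding short_rpq_def by blast
  then show thesis
  proof cases
    case 1
    then have "encoded_query sig D vs succs q xs [] 1"
      using assms by unfold_locales auto
    then show thesis by (rule that)
  next
    case 2
    then have "encoded_query sig D vs succs q xs ys 2"
      using assms by unfold_locales auto
    then show thesis by (rule that)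
  qed
qed

text \<open>Programs and constants are chosen before the database and the query, so they depend on
  the alphabet only. A query with repeated letters can be arbitrarily long, so its size is added to
  the preprocessing time; \<open>max 1\<close> covers an empty database.\<close>

theorem theorem7p9:
  fixes sig :: "'a list"
  assumes "distinct sig"
  shows "\<exists>pre enum c k. \<forall>(D :: ('v, 'a) graph_db) vs succs q.
    graph_db (set sig) D \<longrightarrow> represents sig vs succs D \<longrightarrow> short_rpq (set sig) q \<longrightarrow>
    (let inp = encode_input sig vs succs q;
         B = (length inp + 2) ^ k;
         q_size = length (letter_occs q)
     in solves_semi_sorted_enum pre enum inp B vs (rpq_eval q D)
          (c * (if repetition_free q then max 1 (db_size D) else db_size D + q_size))
          (c * max 1 (max_degree D)))"
proof -
  define k where "k = length sig"
  \<comment> \<open>Up to the factor 200, preprocessing costs at most S * (k + 2) + q + 5, with S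
    the database size and q the query size. If q is at most 2 * k, this is at most (k + 2) + (2 * k
    + 5) times \<open>max 1 S\<close>; otherwise q is at least 1 and absorbs the 5.\<close>
  define c where "c = 200 * (3 * k + 7)"
  have "let inp = encode_input sig vs succs q; B = (length inp + 2) ^ ((26 + k) * (8011 + k) + 3);
         q_size = length (letter_occs q)
     in solves_semi_sorted_enum (compile 0 (pre_prog k)) (compile 0 enum_prog) inp B vs (rpq_eval q D)
          (c * (if repetition_free q then max 1 (db_size D) else db_size D + q_size))
          (c * max 1 (max_degree D))"
    if "graph_db (set sig) D" "represents sig vs succs D" "short_rpq (set sig) q"
    for D :: "('v, 'a) graph_db" and vs succs q
  proof -
    note db = that
    obtain xs ys nf where "encoded_query sig D vs succs q xs ys nf"
      by (rule short_rpq_encoded[OF assms db])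
    then interpret encoded_query sig D vs succs q xs ys nf .
    let ?S = "db_size D"
    let ?q = "length (letter_occs q)"
    have "length vs = card (nodes D)" using vs distinct_card by metis
    then have S: "length vs \<le> ?S" by (simp add: db_size_def)
    have S': "m \<le> ?S" unfolding m_eq_card_arcs db_size_def by simp
    from S have "length vs * length sig \<le> ?S * k" by (simp add: k_def)
    then have total: "length vs + length vs * length sig + m + ot + 1 \<le> ?S * (k + 2) + ?q + 5"
      using S S' sizes(1) by (simp add: algebra_simps)
    have "?S * (k + 2) + ?q + 5 \<le>
      (3 * k + 7) * (if repetition_free q then max 1 ?S else ?S + ?q)"
    proof (cases "repetition_free q")
      case True
      define X where "X = max 1 ?S"
      then have "?S * (k + 2) \<le> X * (k + 2)" "1 * (2 * k + 5) \<le> X * (2 * k + 5)"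
        by (intro mult_le_mono1; simp)+
      moreover have "?q + 5 \<le> 1 * (2 * k + 5)"
        using repetition_free_sizes[OF True, folded k_def] by simp
      ultimately have "?S * (k + 2) + (?q + 5) \<le> X * (k + 2) + X * (2 * k + 5)"
        by (intro add_mono) (blast intro: le_trans)+
      then have "?S * (k + 2) + ?q + 5 \<le> X * (k + 2) + X * (2 * k + 5)" by simp
      also have "\<dots> = (3 * k + 7) * X" by (simp add: algebra_simps)
      finally show ?thesis using True by (simp only: X_def if_True)
    next
      case False
      have "?S * (k + 2) \<le> ?S * (3 * k + 7)" "6 * ?q \<le> (3 * k + 7) * ?q"
        by (intro mult_le_mono; simp)+
      then have "?S * (k + 2) + ?q + 5 \<le> ?S * (3 * k + 7) + (3 * k + 7) * ?q"
        using sizes(5) by linarith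
      then show ?thesis using False by (simp add: algebra_simps)
    qed
    then have "200 * (length vs + length vs * length sig + m + ot + 1) \<le>
      c * (if repetition_free q then max 1 ?S else ?S + ?q)"
      using total unfolding c_def mult.assoc by (intro mult_le_mono2) linarith
    moreover have "200 * max 1 (max_degree D) \<le> c * max 1 (max_degree D)"
      unfolding c_def by (intro mult_le_mono1) simp
    ultimately show ?thesis
      unfolding Let_def k_def by (rule solves_mono[OF solves])
  qed
  then show ?thesis by blast
qed

end
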